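(* Let $n\ge2$, $j\ge1$. Let $\gamma:\mathbb{R}^2\to\mathbb{R}^n$ be a solution of the $(2j-1)$-th Airy curve flow $$\gamma_t=y_{2j-3}(k)e_1+(e_2,\ldots,e_n)\eta_{2j-3}(k),\qquad(\ast)$$ and let $g=(e_1,\ldots,e_n):\mathbb{R}^2\to SO(n)$ be such that $g(\cdot,t)$ is a parallel frame along $\gamma(\cdot,t)$ with corresponding principal curvatures $k(\cdot,t)$ and $$g^{-1}g_x=\begin{pmatrix}0&-k^t\\ k&0\end{pmatrix},\qquad g^{-1}g_t=\begin{pmatrix}0&-z_{2j-2}(k)^t\\ z_{2j-2}(k)&\xi_{2j-2}(k)\end{pmatrix}.$$ Let $E(x,t,\lambda)$ be the frame of the solution $u=\Psi(k)$ of the $(2j-1)$-th vmKdV$_n$ flow with initial data $E(0,0,\lambda)=\mathrm{diag}(1,g(0,0))$. Let $s\in\mathbb{R}\setminus\{0\}$, let $\mathbf{c}\in\mathbb{R}^n$ be a unit vector, $v=\begin{pmatrix}1\\ i\mathbf{c}\end{pmatrix}$, and $\tilde v(x,t)=E(x,t,-is)^{-1}v$. Then: (1) $E(x,t,0)=\mathrm{diag}(1,g(x,t))$. (2) $\tilde v=(y_0,iy_1,\ldots,iy_n)^t$ for some $y_0,\ldots,y_n:\mathbb{R}^2\to\mathbb{R}$, where $y_0$ never vanishes and $\sum_{i=1}^ny_i^2=y_0^2$. (3) Set $$\tilde{\mathbf{c}}=\frac1{y_0}(y_1,\ldots,y_n)^t,\qquad\tilde\gamma=-(\mathrm{I}_n-2\mathbf{c}\mathbf{c}^t)\left(\gamma-\frac{2}{sy_0}\sum_{i=1}^ny_ie_i\right),$$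 $$\tilde g=(\mathrm{I}_n-2\mathbf{c}\mathbf{c}^t)\,g\,(\mathrm{I}_n-2\tilde{\mathbf{c}}\tilde{\mathbf{c}}^t),\qquad\tilde k=k-\frac{2s}{y_0}(y_2,\ldots,y_n)^t.$$ Then $\tilde\gamma$ is a solution of the $(2j-1)$-th Airy curve flow $(\ast)$, and $\tilde g$ is a parallel frame of $\tilde\gamma$ with corresponding principal curvatures $\tilde k$.
   Context: Parallel frames. For a curve $\gamma$ in $\mathbb{R}^n$ parametrized by arc-length $x$, a parallel frame is a smooth $SO(n)$-valued $g=(e_1,\ldots,e_n)$ with $e_1=\gamma_x$ and $g^{-1}g_x=\begin{pmatrix}0&-k^t\\ k&0\end{pmatrix}$; $k=(k_1,\ldots,k_{n-1})^t$ are the principal curvatures with respect to $g$. In the flow $(\ast)$, $\gamma(\cdot,t)$ is parametrized by arc-length, $(e_1,\ldots,e_n)(\cdot,t)$ is a parallel frame along $\gamma(\cdot,t)$ with principal curvatures $k(\cdot,t)$, and the right-hand side is independent of the choice of parallel frame. The coefficients $Q_i$. Write $(n+1)\times(n+1)$ matrices in blocks of sizes $1,1,n-1$. Let $a=e_{21}-e_{12}\in so(n+1)$ ($e_{ij}$ elementary matrices) and $u=\Psi(k)=\begin{pmatrix}0&0&0\\ 0&0&-k^t\\ 0&k&0\end{pmatrix}$. There is a unique formal series $Q(u,\lambda)=a\lambda+\sum_{i\ge0}Q_i(u)\lambda^{-i}$ with real coefficients of the form $$Q_{2i-1}=\begin{pmatrix}0&-y_{2i-1}&-\eta_{2i-1}^t\\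 y_{2i-1}&0&0\\ \eta_{2i-1}&0&0\end{pmatrix},\qquad Q_{2i}=\begin{pmatrix}0&0&0\\ 0&0&-z_{2i}^t\\ 0&z_{2i}&\xi_{2i}\end{pmatrix}$$ ($y$ scalar, $\eta,z\in\mathbb{R}^{n-1}$, $\xi\in so(n-1)$) such that $[\partial_x+a\lambda+u,Q(u,\lambda)]=0$ and $Q(u,\lambda)$ is conjugate to $a\lambda$; all entries are differential polynomials in $k$. Set $Q_{-1}=a$ (so $y_{-1}=1$, $\eta_{-1}=0$). For example $z_0=k$, $\xi_0=0$, $y_1=-\frac12\|k\|^2$, $\eta_1=-k_x$, $z_2=-(k_{xx}+\frac12\|k\|^2k)$, $\xi_2=k_xk^t-kk_x^t$. (The functions $y_{2i-1}(k)$ are not to be confused with the components $y_0,\ldots,y_n$ of $\tilde v$.) The $(2j-1)$-th vmKdV$_n$ flow is $u_t=[\partial_x+u,Q_{2j-2}(u)]$, equivalently $k_t=(z_{2j-2}(k))_x-\xi_{2j-2}(k)k$. A frame of a solution $u$ is a solution $E(x,t,\lambda)\in O(n+1,\mathbb{C})$, holomorphic in $\lambda\in\mathbb{C}$, of $E^{-1}E_x=a\lambda+u$, $E^{-1}E_t=a\lambda^{2j-1}+\sum_{i=0}^{2j-2}Q_i(u)\lambda^{2j-2-i}$, satisfying $\overline{E(x,t,\bar\lambda)}=E(x,t,\lambda)$ and $\mathrm{I}_{1,n}E(x,t,-\lambda)\mathrm{I}_{1,n}^{-1}=E(x,t,\lambda)$, where $\mathrm{I}_{1,n}=\mathrm{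diag}(1,-\mathrm{I}_n)$.
   Formalization: The sign in the new curvatures is corrected: k̃ = k + (2s/y₀)(y₂,…,yₙ)ᵗ instead of minus. With the minus sign the claim fails, e.g. n=2, j=1, γ=(x+t,0), g=I, k=0, c=e₂, where g̃ has curvature +2s/cosh(s(x+t)). *)

theory Defs
  imports "HOL-Analysis.Analysis" "HOL-Computational_Algebra.Formal_Laurent_Series"
begin

text \<open>
  Dimensions. The finite type \<open>'m\<close> indexes the \<open>n - 1\<close> principal curvatures, so
  \<open>n = CARD('m) + 1\<close> is an arbitrary integer \<open>\<ge> 2\<close>. The space \<open>\<real>\<^sup>n\<close> is \<open>real ^ 'm option\<close>
  with \<open>None\<close> as first index, and the square matrices of size \<open>n + 1\<close>, in blocks
  \<open>1, 1, n - 1\<close>, are indexed by \<open>'m option option\<close> with block indices \<open>None\<close>,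
  \<open>Some None\<close>, \<open>Some (Some i)\<close>.

  A function of \<open>(x, t)\<close> is curried: \<open>f x t\<close>.
\<close>

section \<open>Smoothness and partial derivatives\<close>

text \<open>\<open>Ck m f\<close>: \<open>f\<close> is of class \<open>C\<^sup>m\<close> on the whole (finite-dimensional) space.\<close>

primrec Ck :: "nat \<Rightarrow> ('a::euclidean_space \<Rightarrow> 'b::real_normed_vector) \<Rightarrow> bool" where
  "Ck 0 f \<longleftrightarrow> continuous_on UNIV f"
| "Ck (Suc m) f \<longleftrightarrow>
     (\<forall>p. f differentiable (at p)) \<and> (\<forall>v. Ck m (\<lambda>p. frechet_derivative f (at p) v))"

definition smooth :: "('a::euclidean_space \<Rightarrow> 'b::real_normed_vector) \<Rightarrow> bool" where
  "smooth f \<longleftrightarrow> (\<forall>m. Ck m f)"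

definition smooth2 :: "(real \<Rightarrow> real \<Rightarrow> 'b::real_normed_vector) \<Rightarrow> bool" where
  "smooth2 f \<longleftrightarrow> smooth (\<lambda>p. f (fst p) (snd p))"

definition dx :: "(real \<Rightarrow> real \<Rightarrow> 'b::real_normed_vector) \<Rightarrow> real \<Rightarrow> real \<Rightarrow> 'b" where
  "dx f x t = vector_derivative (\<lambda>\<xi>. f \<xi> t) (at x)"

definition dt :: "(real \<Rightarrow> real \<Rightarrow> 'b::real_normed_vector) \<Rightarrow> real \<Rightarrow> real \<Rightarrow> 'b" where
  "dt f x t = vector_derivative (\<lambda>\<tau>. f x \<tau>) (at t)"

section \<open>Block vectors and matrices\<close>

definition vcons :: "'a \<Rightarrow> 'a ^ 'm \<Rightarrow> 'a ^ 'm option" where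
  "vcons p w = (\<chi> r. case r of None \<Rightarrow> p | Some i \<Rightarrow> w $ i)"

definition vtail :: "'a ^ 'm option \<Rightarrow> 'a ^ 'm" where
  "vtail w = (\<chi> i. w $ Some i)"

text \<open>\<open>block p r c B\<close> is the matrix with first row \<open>(p, r\<^sup>t)\<close> and remaining rows \<open>(c, B)\<close>.\<close>

definition block :: "'a \<Rightarrow> 'a ^ 'm \<Rightarrow> 'a ^ 'm \<Rightarrow> 'a ^ 'm ^ 'm \<Rightarrow> 'a ^ 'm option ^ 'm option" where
  "block p r c B = (\<chi> i j. case i of
       None \<Rightarrow> (case j of None \<Rightarrow> p | Some j' \<Rightarrow> r $ j')
     | Some i' \<Rightarrow> (case j of None \<Rightarrow> c $ i' | Some j' \<Rightarrow> B $ i' $ j'))"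

definition skew_block :: "real ^ 'm \<Rightarrow> real ^ 'm ^ 'm \<Rightarrow> real ^ 'm option ^ 'm option" where
  "skew_block w \<xi> = block 0 (- w) w \<xi>"

definition odd_mat :: "real \<Rightarrow> real ^ 'm \<Rightarrow> real ^ 'm option option ^ 'm option option" where
  "odd_mat y \<eta> = skew_block (vcons y \<eta>) 0"

definition even_mat :: "real ^ 'm \<Rightarrow> real ^ 'm ^ 'm \<Rightarrow> real ^ 'm option option ^ 'm option option" where
  "even_mat z \<xi> = block 0 0 0 (skew_block z \<xi>)"

text \<open>\<open>a = e\<^sub>2\<^sub>1 - e\<^sub>1\<^sub>2\<close>\<close>

definition amat :: "real ^ 'm::finite option option ^ 'm option option" where
  "amat = odd_mat 1 0"

definition Psi :: "real ^ 'm \<Rightarrow> real ^ 'm option option ^ 'm option option" where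
  "Psi k = even_mat k 0"

definition diag1 :: "'a::{zero,one} ^ 'm ^ 'm \<Rightarrow> 'a ^ 'm option ^ 'm option" where
  "diag1 B = block 1 0 0 B"

definition I1n :: "complex ^ 'm::finite option ^ 'm option" where
  "I1n = diag1 (- mat 1)"

definition cmat :: "real ^ 'a ^ 'b \<Rightarrow> complex ^ 'a ^ 'b" where
  "cmat A = (\<chi> i j. of_real (A $ i $ j))"

definition commutator :: "'a::ring_1 ^ 'n ^ 'n \<Rightarrow> 'a ^ 'n ^ 'n \<Rightarrow> 'a ^ 'n ^ 'n" where
  "commutator A B = A ** B - B ** A"

text \<open>\<open>I - 2 c c\<^sup>t\<close>\<close>

definition refl_mat :: "real ^ 'n \<Rightarrow> real ^ 'n ^ 'n" where
  "refl_mat c = mat 1 - (\<chi> i j. 2 * (c $ i * c $ j))"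

section \<open>The formal series \<open>Q(u, \<lambda>)\<close>\<close>

text \<open>
  Formal series in \<open>\<lambda>\<^sup>-\<^sup>1\<close> with finitely many positive powers of \<open>\<lambda>\<close> are Laurent series in
  \<open>X = \<lambda>\<^sup>-\<^sup>1\<close>. Hence \<open>\<lambda>\<close> is \<open>fls_X_inv\<close>, and the coefficient of \<open>\<lambda>\<^sup>-\<^sup>m\<close> has index \<open>m\<close>. In
  particular \<open>Q\<^sub>-\<^sub>1\<close> is the coefficient of \<open>\<lambda>\<close>.
\<close>

definition fls_mat :: "real ^ 'a ^ 'b \<Rightarrow> real fls ^ 'a ^ 'b" where
  "fls_mat A = (\<chi> i j. fls_const (A $ i $ j))"

definition coeff_mat :: "real fls ^ 'a ^ 'b \<Rightarrow> int \<Rightarrow> real ^ 'a ^ 'b" where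
  "coeff_mat F m = (\<chi> i j. fls_nth (F $ i $ j) m)"

definition a_lambda :: "real fls ^ 'm::finite option option ^ 'm option option" where
  "a_lambda = mat fls_X_inv ** fls_mat amat"

text \<open>
  The defining properties of \<open>Q(u, \<lambda>)\<close> for \<open>u = \<Psi>(k)\<close> along one smooth curve
  \<open>k : \<real> \<rightarrow> \<real>\<^sup>n\<^sup>-\<^sup>1\<close>. The sixth condition is \<open>[\<partial>\<^sub>x + a\<lambda> + u, Q] = Q\<^sub>x + [a\<lambda> + u, Q] = 0\<close>, read
  off coefficient by coefficient.
\<close>

definition is_Q_series ::
    "(real \<Rightarrow> real ^ 'm::finite) \<Rightarrow> (real \<Rightarrow> real fls ^ 'm option option ^ 'm option option) \<Rightarrow> bool"
  where
  "is_Q_series k F \<longleftrightarrow>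
     (\<forall>m. smooth (\<lambda>x. coeff_mat (F x) m)) \<and>
     (\<forall>x. \<forall>m < -1. coeff_mat (F x) m = 0) \<and>
     (\<forall>x. coeff_mat (F x) (-1) = amat) \<and>
     (\<forall>x. \<forall>i \<ge> 1. \<exists>y \<eta>. coeff_mat (F x) (2 * i - 1) = odd_mat y \<eta>) \<and>
     (\<forall>x. \<forall>i \<ge> 0. \<exists>z \<xi>. transpose \<xi> = - \<xi> \<and> coeff_mat (F x) (2 * i) = even_mat z \<xi>) \<and>
     (\<forall>x m. vector_derivative (\<lambda>x'. coeff_mat (F x') m) (at x) +
            coeff_mat (commutator (a_lambda + fls_mat (Psi (k x))) (F x)) m = 0) \<and>
     (\<forall>x. \<exists>M :: real fls ^ 'm option option ^ 'm option option. invertible M \<and> F x = M ** a_lambda ** matrix_inv M)"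

definition Q_series ::
    "(real \<Rightarrow> real ^ 'm::finite) \<Rightarrow> real \<Rightarrow> real fls ^ 'm option option ^ 'm option option" where
  "Q_series k = (THE F. is_Q_series k F)"

definition Qc ::
    "int \<Rightarrow> (real \<Rightarrow> real ^ 'm::finite) \<Rightarrow> real \<Rightarrow> real ^ 'm option option ^ 'm option option" where
  "Qc m k x = coeff_mat (Q_series k x) m"

definition yc :: "int \<Rightarrow> (real \<Rightarrow> real ^ 'm::finite) \<Rightarrow> real \<Rightarrow> real" where
  "yc m k x = Qc m k x $ Some None $ None"

definition etac :: "int \<Rightarrow> (real \<Rightarrow> real ^ 'm::finite) \<Rightarrow> real \<Rightarrow> real ^ 'm" where
  "etac m k x = (\<chi> i. Qc m k x $ Some (Some i) $ None)"

definition zc :: "int \<Rightarrow> (real \<Rightarrow> real ^ 'm::finite) \<Rightarrow> real \<Rightarrow> real ^ 'm" where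
  "zc m k x = (\<chi> i. Qc m k x $ Some (Some i) $ Some None)"

definition xic :: "int \<Rightarrow> (real \<Rightarrow> real ^ 'm::finite) \<Rightarrow> real \<Rightarrow> real ^ 'm ^ 'm" where
  "xic m k x = (\<chi> i l. Qc m k x $ Some (Some i) $ Some (Some l))"

section \<open>Parallel frames and the Airy curve flows\<close>

text \<open>The columns of \<open>g x\<close> are \<open>e\<^sub>1, \<dots>, e\<^sub>n\<close>; \<open>e\<^sub>1\<close> is column \<open>None\<close>.\<close>

definition parallel_frame ::
    "(real \<Rightarrow> real ^ 'm::finite option) \<Rightarrow> (real \<Rightarrow> real ^ 'm option ^ 'm option) \<Rightarrow>
     (real \<Rightarrow> real ^ 'm) \<Rightarrow> bool" where
  "parallel_frame \<gamma> g k \<longleftrightarrow>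
     smooth \<gamma> \<and> (\<forall>x. norm (vector_derivative \<gamma> (at x)) = 1) \<and>
     smooth g \<and> (\<forall>x. rotation_matrix (g x)) \<and>
     (\<forall>x. column None (g x) = vector_derivative \<gamma> (at x)) \<and>
     (\<forall>x. matrix_inv (g x) ** vector_derivative g (at x) = skew_block (k x) 0)"

definition parallel_frames ::
    "(real \<Rightarrow> real \<Rightarrow> real ^ 'm::finite option) \<Rightarrow>
     (real \<Rightarrow> real \<Rightarrow> real ^ 'm option ^ 'm option) \<Rightarrow> (real \<Rightarrow> real \<Rightarrow> real ^ 'm) \<Rightarrow> bool" where
  "parallel_frames \<gamma> g k \<longleftrightarrow>
     smooth2 g \<and> (\<forall>t. parallel_frame (\<lambda>x. \<gamma> x t) (\<lambda>x. g x t) (\<lambda>x. k x t))"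

text \<open>
  The \<open>(2j-1)\<close>-th Airy curve flow. Its right-hand side does not depend on the parallel frame, so
  at each time any one parallel frame may be used.
\<close>

definition airy_flow :: "nat \<Rightarrow> (real \<Rightarrow> real \<Rightarrow> real ^ 'm::finite option) \<Rightarrow> bool" where
  "airy_flow j \<gamma> \<longleftrightarrow>
     smooth2 \<gamma> \<and>
     (\<forall>t. \<exists>e \<kappa>. parallel_frame (\<lambda>x. \<gamma> x t) e \<kappa> \<and>
        (\<forall>x. dt \<gamma> x t =
           yc (2 * int j - 3) \<kappa> x *\<^sub>R column None (e x) +
           (\<Sum>i\<in>UNIV. etac (2 * int j - 3) \<kappa> x $ i *\<^sub>R column (Some i) (e x))))"

section \<open>The vmKdV flows and their frames\<close>

definition vmkdv_flow :: "nat \<Rightarrow> (real \<Rightarrow> real \<Rightarrow> real ^ 'm::finite) \<Rightarrow> bool" where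
  "vmkdv_flow j k \<longleftrightarrow>
     smooth2 k \<and>
     (\<forall>x t. dt (\<lambda>x t. Psi (k x t)) x t =
        dx (\<lambda>x t. Qc (2 * int j - 2) (\<lambda>\<xi>. k \<xi> t) x) x t +
        commutator (Psi (k x t)) (Qc (2 * int j - 2) (\<lambda>\<xi>. k \<xi> t) x))"

definition vmkdv_frame ::
    "nat \<Rightarrow> (real \<Rightarrow> real \<Rightarrow> real ^ 'm::finite) \<Rightarrow>
     (real \<Rightarrow> real \<Rightarrow> complex \<Rightarrow> complex ^ 'm option option ^ 'm option option) \<Rightarrow> bool" where
  "vmkdv_frame j k E \<longleftrightarrow>
     vmkdv_flow j k \<and>
     (\<forall>l. smooth2 (\<lambda>x t. E x t l)) \<and>
     (\<forall>x t l. orthogonal_matrix (E x t l)) \<and>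
     (\<forall>x t r s. (\<lambda>l. E x t l $ r $ s) holomorphic_on UNIV) \<and>
     (\<forall>x t l. matrix_inv (E x t l) ** dx (\<lambda>x t. E x t l) x t =
        mat l ** cmat amat + cmat (Psi (k x t))) \<and>
     (\<forall>x t l. matrix_inv (E x t l) ** dt (\<lambda>x t. E x t l) x t =
        mat (l ^ (2 * j - 1)) ** cmat amat +
        (\<Sum>i = 0..2 * j - 2.
           mat (l ^ (2 * j - 2 - i)) ** cmat (Qc (int i) (\<lambda>\<xi>. k \<xi> t) x))) \<and>
     (\<forall>x t l. (\<chi> r s. cnj (E x t (cnj l) $ r $ s)) = E x t l) \<and>
     (\<forall>x t l. I1n ** E x t (- l) ** matrix_inv I1n = E x t l)"

text \<open>The complex vector \<open>(p, i w)\<^sup>t\<close>.\<close>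

definition ivec :: "real \<Rightarrow> real ^ 'n \<Rightarrow> complex ^ 'n option" where
  "ivec p w = vcons (of_real p) (\<chi> i. \<i> * of_real (w $ i))"

end

theory Submission
  imports Defs
begin

text \<open>
  With \<open>X = \<lambda>\<^sup>-\<^sup>1\<close> the series \<open>q = \<lambda>\<^sup>-\<^sup>1 Q\<close> is a formal power series over the ring of smooth matrix functions,
  and being conjugate to \<open>a\<close> amounts to \<open>q\<^sup>3 = - q\<close>. Linearising the zero curvature and the cubic
  equation at the lowest coefficient shows that every gauge transformation between two Lax operators
  intertwines their series; this gives uniqueness, the symmetries of \<open>Q\<close> and the independence of the
  parallel frame. Existence comes from a formal gauge transformation that diagonalises the Lax operator.

  For part (3), write \<open>J\<close> for the skew matrix with first column \<open>(0, c')\<close>. The equation for the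
  \<open>x\<close>-derivative of \<open>c'\<close> says that \<open>1 + 2 s X J + s\<^sup>2 X\<^sup>2 (1 + 2 J\<^sup>2)\<close> is a gauge transformation between the Lax
  operators of \<open>k\<close> and \<open>k'\<close>. Its intertwining relation expresses the odd coefficients of the new series
  recursively. Evaluating the frame equation at \<open>\<lambda> = -is\<close> along the same recursion identifies
  the \<open>t\<close>-derivative of \<open>c'\<close>, and then the flow equation for the transformed curve is linear algebra.
\<close>

section \<open>Functions of class \<open>C\<^sup>m\<close>\<close>

text \<open>The conjugating matrix in the definition of \<open>Q\<close> is asserted separately at
  every \<open>x\<close>, with no regularity in \<open>x\<close>, so it cannot be differentiated.
  The cubic equation keeps what is needed of it: \<open>a\<close> has the eigenvalues 0, i, -i, and
  together with zero curvature and the leading coefficient \<open>a\<close> the equation leaves no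
  freedom, because \<open>3 a^2 + 1\<close> is injective. An intertwiner may be singular, which
  admits polynomial ones. The dressing polynomial comes from the rational loop with simple poles at
  \<open>is\<close> and \<open>-is\<close> whose residues are multiples of projections onto the
  isotropic lines through \<open>(1, i c')\<close> and \<open>(1, -i c')\<close>; multiplying by
  \<open>\<lambda>^2 + s^2\<close> clears the poles. The obstacle in part (3) is that the velocity
  of the new curve involves coefficients of the new curvature, while \<open>E\<close> is governed by
  the old ones. The first column of the dressing relation contains only the old even coefficients.
  It therefore runs in parallel with a Horner evaluation of the frame equation at
  \<open>-is\<close>, and the even terms cancel against \<open>g_t\<close>.\<close>

lemma Ck_Suc_imp_Ck: "Ck (Suc m) f \<Longrightarrow> Ck m f"
proof (induction m arbitrary: f)
  case 0
  then show ?case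
    by (auto simp: continuous_on_eq_continuous_at intro: differentiable_imp_continuous_within)
next
  case (Suc m)
  then show ?case by simp
qed

lemma Ck_SucI:
  assumes "\<And>p. (f has_derivative f' p) (at p)" "\<And>v. Ck m (\<lambda>p. f' p v)"
  shows "Ck (Suc m) f"
proof -
  have "frechet_derivative f (at p) = f' p" for p
    using assms(1) frechet_derivative_at by metis
  then show ?thesis using assms by (auto simp: differentiable_def)
qed

lemma Ck_SucD:
  assumes "Ck (Suc m) f"
  shows "(f has_derivative frechet_derivative f (at p)) (at p)"
    and "Ck m (\<lambda>p. frechet_derivative f (at p) v)"
  using assms by (auto simp: frechet_derivative_works)

lemma Ck_const [simp]: "Ck m (\<lambda>_. c)"
proof (induction m arbitrary: c)
  case (Suc m)
  show ?case by (rule Ck_SucI[where f'="\<lambda>_ _. 0"]) (auto intro: Suc)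
qed simp

lemma Ck_bounded_linear:
  assumes "bounded_linear h" "Ck m f"
  shows "Ck m (\<lambda>p. h (f p))"
  using assms(2)
proof (induction m arbitrary: f)
  case 0
  then show ?case by (simp add: bounded_linear.continuous_on[OF assms(1)])
next
  case (Suc m)
  show ?case
    by (rule Ck_SucI[OF bounded_linear.has_derivative[OF assms(1) Ck_SucD(1)[OF Suc.prems]]])
      (rule Suc.IH[OF Ck_SucD(2)[OF Suc.prems]])
qed

lemma Ck_add:
  assumes "Ck m f" "Ck m g"
  shows "Ck m (\<lambda>p. f p + g p)"
  using assms
proof (induction m arbitrary: f g)
  case 0
  then show ?case by (simp add: continuous_on_add)
next
  case (Suc m)
  show ?case
    by (rule Ck_SucI[OF has_derivative_add[OF Ck_SucD(1)[OF Suc.prems(1)] Ck_SucD(1)[OF Suc.prems(2)]]])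
      (rule Suc.IH[OF Ck_SucD(2)[OF Suc.prems(1)] Ck_SucD(2)[OF Suc.prems(2)]])
qed

lemma Ck_bilinear:
  assumes B: "bounded_bilinear B" and "Ck m f" "Ck m g"
  shows "Ck m (\<lambda>p. B (f p) (g p))"
  using assms(2,3)
proof (induction m arbitrary: f g)
  case 0
  then show ?case by (simp add: bounded_bilinear.continuous_on[OF B])
next
  case (Suc m)
  show ?case
    by (rule Ck_SucI[OF bounded_bilinear.FDERIV[OF B Ck_SucD(1)[OF Suc.prems(1)] Ck_SucD(1)[OF Suc.prems(2)]]])
      (rule Ck_add[OF Suc.IH[OF Ck_Suc_imp_Ck[OF Suc.prems(1)] Ck_SucD(2)[OF Suc.prems(2)]]
         Suc.IH[OF Ck_SucD(2)[OF Suc.prems(1)] Ck_Suc_imp_Ck[OF Suc.prems(2)]]])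
qed

text \<open>The derivative of \<open>1/f\<close> is a product of \<open>1/f\<close> and the
  derivative of \<open>f\<close>, so the induction feeds on \<open>1/f\<close> itself.\<close>

lemma Ck_inverse:
  fixes f :: "'a::euclidean_space \<Rightarrow> real"
  assumes "Ck m f" and nz: "\<And>p. f p \<noteq> 0"
  shows "Ck m (\<lambda>p. inverse (f p))"
  using assms(1)
proof (induction m)
  case 0
  then show ?case by (simp add: continuous_on_inverse nz)
next
  case (Suc m)
  have IH: "Ck m (\<lambda>p. inverse (f p))" by (rule Suc.IH[OF Ck_Suc_imp_Ck[OF Suc.prems]])
  note mult = Ck_bilinear[OF bounded_bilinear_mult]
  have "((\<lambda>p. inverse (f p)) has_derivative
      (\<lambda>v. - (inverse (f p) * frechet_derivative f (at p) v * inverse (f p)))) (at p)" for p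
    by (rule Deriv.has_derivative_inverse[OF nz Ck_SucD(1)[OF Suc.prems]])
  then show ?case
    by (rule Ck_SucI) (intro Ck_bounded_linear[OF bounded_linear_minus[OF bounded_linear_ident]]
      mult IH Ck_SucD(2)[OF Suc.prems])
qed

text \<open>With \<open>q + h p\<close> running through a coordinate line of the plane, this
  restricts functions of \<open>(x, t)\<close> to one variable.\<close>

lemma Ck_affine:
  assumes "bounded_linear h" "Ck m f"
  shows "Ck m (\<lambda>p. f (q + h p))"
  using assms(2)
proof (induction m arbitrary: f)
  case 0
  have "continuous_on UNIV (\<lambda>p. q + h p)"
    by (intro continuous_intros bounded_linear.continuous_on[OF assms(1)])
  then show ?case using 0 continuous_on_compose2[of UNIV f UNIV "\<lambda>p. q + h p"] by simp
next
  case (Suc m)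
  have d: "((\<lambda>p. q + h p) has_derivative h) (at p)" for p
    by (auto intro!: derivative_eq_intros bounded_linear_imp_has_derivative[OF assms(1)])
  have "((\<lambda>p. f (q + h p)) has_derivative (\<lambda>v. frechet_derivative f (at (q + h p)) (h v))) (at p)" for p
    by (rule has_derivative_compose[OF d Ck_SucD(1)[OF Suc.prems]])
  then show ?case
    by (rule Ck_SucI) (rule Suc.IH[OF Ck_SucD(2)[OF Suc.prems]])
qed

lemma smooth_const [simp]: "smooth (\<lambda>_. c)"
  by (simp add: smooth_def)

lemma smooth_add: "smooth f \<Longrightarrow> smooth g \<Longrightarrow> smooth (\<lambda>p. f p + g p)"
  by (simp add: smooth_def Ck_add)

lemma smooth_bounded_linear: "bounded_linear h \<Longrightarrow> smooth f \<Longrightarrow> smooth (\<lambda>p. h (f p))"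
  by (simp add: smooth_def Ck_bounded_linear)

lemma smooth_bilinear:
  "bounded_bilinear B \<Longrightarrow> smooth f \<Longrightarrow> smooth g \<Longrightarrow> smooth (\<lambda>p. B (f p) (g p))"
  by (simp add: smooth_def Ck_bilinear)

lemma smooth_inverse:
  fixes f :: "'a::euclidean_space \<Rightarrow> real"
  shows "smooth f \<Longrightarrow> (\<And>p. f p \<noteq> 0) \<Longrightarrow> smooth (\<lambda>p. inverse (f p))"
  by (simp add: smooth_def Ck_inverse)

lemma smooth_affine:
  assumes "bounded_linear h" "smooth f"
  shows "smooth (\<lambda>p. f (q + h p))"
  using assms(2) by (simp add: smooth_def Ck_affine[OF assms(1)])

lemma smooth_minus: "smooth f \<Longrightarrow> smooth (\<lambda>p. - f p)"
  by (rule smooth_bounded_linear[OF bounded_linear_minus[OF bounded_linear_ident]])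

lemma smooth_diff: "smooth f \<Longrightarrow> smooth g \<Longrightarrow> smooth (\<lambda>p. f p - g p)"
  using smooth_add[OF _ smooth_minus, of f g] by simp

lemma smooth_has_derivative:
  "smooth f \<Longrightarrow> (f has_derivative frechet_derivative f (at p)) (at p)"
  using Ck_SucD(1) unfolding smooth_def by blast

lemma smooth_has_vector_derivative:
  "smooth f \<Longrightarrow> (f has_vector_derivative vector_derivative f (at x)) (at x)"
  using smooth_has_derivative differentiableI_vector[unfolded has_vector_derivative_def]
  by (metis differentiableI has_derivative_at_withinI vector_derivative_works)

lemma smooth_vector_derivative: 
  assumes "smooth f"
  shows "smooth (\<lambda>x. vector_derivative f (at x))"
proof -
  have "vector_derivative f (at x) = frechet_derivative f (at x) 1" for x
  proof (rule vector_derivative_at)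
    have "linear (frechet_derivative f (at x))"
      using smooth_has_derivative[OF assms] has_derivative_linear by blast
    then have "frechet_derivative f (at x) = (\<lambda>h. h *\<^sub>R frechet_derivative f (at x) 1)"
      by (auto simp: fun_eq_iff linear_scale[of _ _ "1::real", symmetric])
    then show "(f has_vector_derivative frechet_derivative f (at x) 1) (at x)"
      unfolding has_vector_derivative_def using smooth_has_derivative[OF assms, of x] by simp
  qed
  moreover have "Ck m (\<lambda>x. frechet_derivative f (at x) 1)" for m
    using assms Ck_SucD(2) unfolding smooth_def by blast
  ultimately show ?thesis by (simp add: smooth_def)
qed

lemma smooth2_x:
  assumes "smooth2 f"
  shows "smooth (\<lambda>x. f x t)"
proof -
  have "bounded_linear (\<lambda>x. (x, 0) :: real \<times> real)" by (intro bounded_linear_intros)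
  from smooth_affine[OF this assms[unfolded smooth2_def], of "(0, t)"]
  show ?thesis by simp
qed

lemma smooth2_t:
  assumes "smooth2 f"
  shows "smooth (\<lambda>t. f x t)"
proof -
  have "bounded_linear (\<lambda>t. (0, t) :: real \<times> real)" by (intro bounded_linear_intros)
  from smooth_affine[OF this assms[unfolded smooth2_def], of "(x, 0)"]
  show ?thesis by simp
qed

lemma smooth2_dx: "smooth2 f \<Longrightarrow> ((\<lambda>\<xi>. f \<xi> t) has_vector_derivative dx f x t) (at x)"
  unfolding dx_def by (rule smooth_has_vector_derivative[OF smooth2_x])

lemma smooth2_dt: "smooth2 f \<Longrightarrow> ((\<lambda>\<tau>. f x \<tau>) has_vector_derivative dt f x t) (at t)"
  unfolding dt_def by (rule smooth_has_vector_derivative[OF smooth2_t])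

section \<open>Calculus of matrix products\<close>

lemma bounded_bilinear_matrix_mult:
  "bounded_bilinear ((**) :: 'a::{euclidean_space,real_algebra_1}^'n::finite^'m::finite \<Rightarrow> 'a^'p::finite^'n \<Rightarrow> 'a^'p^'m)"
proof -
  have "bilinear ((**) :: 'a^'n^'m \<Rightarrow> 'a^'p^'n \<Rightarrow> 'a^'p^'m)"
    unfolding bilinear_def
    by (auto intro!: linearI simp: matrix_matrix_mult_def vec_eq_iff algebra_simps sum.distrib sum_distrib_left scaleR_sum_right)
  then show ?thesis by (simp add: bilinear_conv_bounded_bilinear)
qed

lemma bounded_bilinear_matrix_vector_mult:
  "bounded_bilinear ((*v) :: 'a::{euclidean_space,real_algebra_1}^'n::finite^'m::finite \<Rightarrow> 'a^'n \<Rightarrow> 'a^'m)"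
proof -
  have "bilinear ((*v) :: 'a^'n^'m \<Rightarrow> 'a^'n \<Rightarrow> 'a^'m)"
    unfolding bilinear_def
    by (auto intro!: linearI simp: matrix_vector_mult_def vec_eq_iff algebra_simps sum.distrib scaleR_sum_right)
  then show ?thesis by (simp add: bilinear_conv_bounded_bilinear)
qed

lemmas smooth_matrix_mult = smooth_bilinear[OF bounded_bilinear_matrix_mult]
lemmas smooth_matrix_vector_mult = smooth_bilinear[OF bounded_bilinear_matrix_vector_mult]
lemmas smooth_scaleR = smooth_bilinear[OF bounded_bilinear_scaleR]

lemmas has_vector_derivative_matrix_mult = 
  bounded_bilinear.has_vector_derivative[OF bounded_bilinear_matrix_mult]
lemmas has_vector_derivative_matrix_vector_mult = 
  bounded_bilinear.has_vector_derivative[OF bounded_bilinear_matrix_vector_mult]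

unbundle no vec_syntax
unbundle fps_syntax

section \<open>Formal series over a differential ring\<close>

text \<open>Extracts the lowest coefficient of a product; without commutativity a left and a right
  version are both needed.\<close>

lemma fps_mult_nth_left:
  fixes f g :: "'a::semiring_0 fps"
  assumes "\<And>i. i < n \<Longrightarrow> g $ i = 0"
  shows "(f * g) $ n = f $ 0 * g $ n"
proof -
  have "(f * g) $ n = (\<Sum>i\<in>{0}. f $ i * g $ (n - i))"
    unfolding fps_mult_nth by (rule sum.mono_neutral_right) (auto simp: assms)
  then show ?thesis by simp
qed

lemma fps_mult_nth_right:
  fixes f g :: "'a::semiring_0 fps"
  assumes "\<And>i. i < n \<Longrightarrow> f $ i = 0"
  shows "(f * g) $ n = f $ n * g $ 0"
proof -
  have "(f * g) $ n = (\<Sum>i\<in>{n}. f $ i * g $ (n - i))"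
    unfolding fps_mult_nth by (rule sum.mono_neutral_right) (auto simp: assms)
  then show ?thesis by simp
qed

text \<open>\<open>X\<close> is central even though the coefficients do not commute.\<close>

lemma fps_X_left_commute:
  fixes f g :: "'a::semiring_1 fps"
  shows "f * (fps_X * g) = fps_X * (f * g)"
  by (metis fps_mult_fps_X_commute mult.assoc)

text \<open>A noncommutative real differential algebra. The model is the ring of smooth matrix
  functions with d/dx.\<close>

locale derivation =
  fixes D :: "'a::real_algebra_1 \<Rightarrow> 'a"
  assumes D_add: "D (x + y) = D x + D y"
    and D_mult: "D (x * y) = D x * y + x * D y"
    and D_scaleR: "D (r *\<^sub>R x) = r *\<^sub>R D x"
begin

lemma D_0 [simp]: "D 0 = 0"
  using D_add[of 0 0] by simp

lemma D_1 [simp]: "D 1 = 0"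
  using D_mult[of 1 1] by simp

lemma D_minus: "D (- x) = - D x"
  using D_add[of x "- x"] by (simp add: eq_neg_iff_add_eq_0 add.commute)

lemma D_sum: "D (\<Sum>i\<in>A. f i) = (\<Sum>i\<in>A. D (f i))"
  by (induction A rule: infinite_finite_induct) (auto simp: D_add)

definition DD :: "'a fps \<Rightarrow> 'a fps" where
  "DD q = Abs_fps (\<lambda>n. D (q $ n))"

lemma DD_nth [simp]: "DD q $ n = D (q $ n)"
  by (simp add: DD_def)

lemma DD_add: "DD (p + q) = DD p + DD q"
  by (simp add: fps_eq_iff D_add)

lemma DD_minus: "DD (- p) = - DD p"
  by (simp add: fps_eq_iff D_minus)

lemma DD_diff: "DD (p - q) = DD p - DD q"
  using DD_add[of p "- q"] by (simp add: DD_minus)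

lemma DD_mult: "DD (p * q) = DD p * q + p * DD q"
  by (simp add: fps_eq_iff fps_mult_nth D_sum D_mult sum.distrib)

lemma DD_1 [simp]: "DD 1 = 0"
  by (simp add: fps_eq_iff)

text \<open>This is \<open>X (a \<lambda> + u)\<close>, the potential of the Lax operator cleared of
  its positive power of \<open>\<lambda>\<close>.\<close>

definition lax :: "'a \<Rightarrow> 'a \<Rightarrow> 'a fps" where
  "lax a u = fps_const a + fps_X * fps_const u"

lemma lax_nth: "lax a u $ 0 = a" "lax a u $ Suc 0 = u" "n \<ge> 2 \<Longrightarrow> lax a u $ n = 0"
  by (auto simp: lax_def)

text \<open>
  The equation \<open>[\<partial>\<^sub>x + a\<lambda> + u, Q] = 0\<close> divided by \<open>\<lambda>\<^sup>2\<close>, for \<open>q = \<lambda>\<^sup>-\<^sup>1 Q\<close> and \<open>X = \<lambda>\<^sup>-\<^sup>1\<close>. Being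
  conjugate to \<open>a\<close> enters through the equation \<open>q\<^sup>3 = - q\<close>.
\<close>

definition Q_solution :: "'a \<Rightarrow> 'a \<Rightarrow> 'a fps \<Rightarrow> bool" where
  "Q_solution a u q \<longleftrightarrow> q $ 0 = a \<and> q * q * q = - q \<and>
     fps_X * DD q = q * lax a u - lax a u * q"

text \<open>The defect \<open>H = p d - d q\<close> obeys linear equations. If \<open>h\<close> is
  its first coefficient not yet known to vanish, zero curvature makes \<open>h\<close> commute with
  \<open>a\<close>, and the cubic equation becomes \<open>(3 a^2 + 1) h = 0\<close>. Since
  \<open>a^2\<close> has only the eigenvalues 0 and -1, the factor takes the values 1 and -2, so
  \<open>h = 0\<close>.\<close>

lemma Q_solution_intertwine:
  assumes aaa: "a * a * a = - a"
    and p: "Q_solution a u' p" and q: "Q_solution a u q"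
    and d: "fps_X * DD d = d * lax a u - lax a u' * d"
  shows "p * d = d * q"
proof -
  define H where "H = p * d - d * q"
  let ?A = "lax a u" and ?A' = "lax a u'"
  have X: "fps_X * (f * g) = f * (fps_X * g)" for f g :: "'a fps"
    by (metis fps_mult_fps_X_commute mult.assoc)
  have "fps_X * DD H = (fps_X * DD p) * d + p * (fps_X * DD d) - (fps_X * DD d) * q - d * (fps_X * DD q)"
    by (simp add: H_def DD_diff DD_mult algebra_simps X[of p] X[of d])
  also have "\<dots> = H * ?A - ?A' * H"
  proof -
    have Lp: "fps_X * DD p = p * ?A' - ?A' * p" and Lq: "fps_X * DD q = q * ?A - ?A * q"
      using p q by (auto simp: Q_solution_def)
    show ?thesis unfolding Lp Lq d H_def by (simp add: algebra_simps)
  qed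
  finally have lin: "fps_X * DD H = H * ?A - ?A' * H" .
  have ppp: "p * p * p = - p" and qqq: "q * q * q = - q"
    using p q by (auto simp: Q_solution_def)
  \<comment> \<open>Telescoping: the three cubic terms add up to
    \<open>p^3 d - d q^3\<close>.\<close>
  have "p * p * H + p * H * q + H * q * q + H = p * p * p * d - d * (q * q * q) + p * d - d * q"
    by (simp add: H_def algebra_simps)
  then have cubic: "p * p * H + p * H * q + H * q * q + H = 0"
    by (simp add: ppp qqq)
  have "H $ n = 0" for n
  proof (induction n rule: less_induct)
    case (less n)
    let ?h = "H $ n"
    \<comment> \<open>The factor \<open>X\<close> shifts the derivative to coefficient
      \<open>n - 1\<close> of \<open>H\<close>, already known to be zero.\<close>
    have "(fps_X * DD H) $ n = 0"
      using less.IH by (cases n) auto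
    then have "?h * a = a * ?h"
      using lin fps_mult_nth_left[of n H ?A'] fps_mult_nth_right[of n H ?A] less.IH
      by (simp add: lax_nth)
    have p0: "p $ 0 = a" and q0: "q $ 0 = a" using p q by (auto simp: Q_solution_def)
    have pH: "(p * H) $ i = a * H $ i" if "i \<le> n" for i
      using that less.IH fps_mult_nth_left[of i H p] p0 by simp
    have Hq: "(H * q) $ i = H $ i * a" if "i \<le> n" for i
      using that less.IH fps_mult_nth_right[of i H q] q0 by simp
    have "(p * (p * H)) $ n = a * (a * ?h)"
      using fps_mult_nth_left[of n "p * H" p] pH less.IH p0 by simp
    moreover have "(p * H * q) $ n = a * ?h * a"
      using fps_mult_nth_right[of n "p * H" q] pH less.IH q0 by simp
    moreover have "(H * q * q) $ n = ?h * a * a"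
      using fps_mult_nth_right[of n "H * q" q] Hq less.IH q0 by simp
    ultimately have "a * (a * ?h) + a * ?h * a + ?h * a * a + ?h = 0"
      using arg_cong[OF cubic, of "\<lambda>f. f $ n"] by (simp add: mult.assoc)
    then have c: "a * (a * ?h) + a * (a * ?h) + a * (a * ?h) + ?h = 0"
      by (simp add: mult.assoc \<open>?h * a = a * ?h\<close>)
    \<comment> \<open>With \<open>k = a^2 h\<close> the equation reads \<open>3 k + h = 0\<close>;
      applying \<open>a^2\<close> gives \<open>-3 k + k = 0\<close>.\<close>
    define k where "k = a * (a * ?h)"
    have "a * (a * k) = - k"
      using aaa by (metis k_def mult.assoc mult_minus_left)
    have "a * (a * (k + k + k + ?h)) = 0"
      using c by (simp add: k_def)
    then have "- k = k" 
      by (simp add: distrib_left \<open>a * (a * k) = - k\<close> flip: k_def)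
    then have "k + k = 0" by (metis add.right_inverse)
    then have "k = 0" by (metis scaleR_2 scaleR_eq_0_iff zero_neq_numeral)
    then show ?case using c by (simp flip: k_def)
  qed
  then show ?thesis by (simp add: H_def fps_eq_iff)
qed

lemma Q_solution_unique:
  assumes "a * a * a = - a" "Q_solution a u p" "Q_solution a u q"
  shows "p = q"
  using Q_solution_intertwine[OF assms, of 1] by simp

text \<open>If \<open>J^3 = -J\<close>, then \<open>\<lambda>^2\<close> times this series acts as
  \<open>\<lambda>^2 + s^2\<close> on the kernel of \<open>J\<close> and as
  \<open>(\<lambda> + is)^2\<close>, \<open>(\<lambda> - is)^2\<close> on its eigenspaces for i and
  -i.\<close>

definition dressing :: "real \<Rightarrow> 'a \<Rightarrow> 'a fps" where
  "dressing s J = 1 + fps_X * fps_const ((2 * s) *\<^sub>R J) +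
     fps_X * (fps_X * fps_const (s\<^sup>2 *\<^sub>R (1 + 2 *\<^sub>R (J * J))))"

lemma dressing_mult_nth:
  "(dressing s J * f) $ n = f $ n + (if n \<ge> 1 then (2 * s) *\<^sub>R (J * f $ (n - 1)) else 0) +
     (if n \<ge> 2 then s\<^sup>2 *\<^sub>R ((1 + 2 *\<^sub>R (J * J)) * f $ (n - 2)) else 0)"
proof -
  have "dressing s J * f = f + fps_X * (fps_const ((2 * s) *\<^sub>R J) * f) +
     fps_X * (fps_X * (fps_const (s\<^sup>2 *\<^sub>R (1 + 2 *\<^sub>R (J * J))) * f))"
    by (simp only: dressing_def distrib_right mult.assoc mult_1)
  then show ?thesis by (auto simp: numeral_2_eq_2)
qed

lemma mult_dressing_nth:
  "(f * dressing s J) $ n = f $ n + (if n \<ge> 1 then (2 * s) *\<^sub>R (f $ (n - 1) * J) else 0) +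
     (if n \<ge> 2 then s\<^sup>2 *\<^sub>R (f $ (n - 2) * (1 + 2 *\<^sub>R (J * J))) else 0)"
proof -
  have "f * dressing s J = f + fps_X * (f * fps_const ((2 * s) *\<^sub>R J)) +
     fps_X * (fps_X * (f * fps_const (s\<^sup>2 *\<^sub>R (1 + 2 *\<^sub>R (J * J)))))"
    by (simp only: dressing_def distrib_left fps_X_left_commute[of f] mult_1_right)
  then show ?thesis by (auto simp: numeral_2_eq_2)
qed

text \<open>Only the powers up to \<open>X^3\<close> matter. \<open>X^1\<close> is the formula for
  \<open>u'\<close>, \<open>X^2\<close> the equation for \<open>D J\<close>, and \<open>X^3\<close>
  then follows from the algebraic relations between \<open>a\<close> and \<open>J\<close>.\<close>

lemma dressing_gauge:
  assumes JJJ: "J * (J * J) = - J"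
    and aJ: "a + J * (J * a) + a * (J * J) = J * (a * J)"
    and JaJJ: "J * (a * (J * J)) = J * (J * (a * J))"
    and DJ: "D J = J * u - u * J + s *\<^sub>R (a + J * (a * J))"
    and u': "u' = u - (2 * s) *\<^sub>R (J * a - a * J)"
  shows "fps_X * DD (dressing s J) = dressing s J * lax a u' - lax a u * dressing s J"
proof (rule fps_ext)
  fix n :: nat
  \<comment> \<open>The factor \<open>s\<close> is absorbed into \<open>j\<close>, so that only the coefficients 2 and \<open>r = s\<^sup>2\<close> are left.\<close>
  define j where "j = s *\<^sub>R J"
  define r where "r = s\<^sup>2"
  have jj: "(2 * s) *\<^sub>R J = j + j" "s\<^sup>2 *\<^sub>R (1 + 2 *\<^sub>R (J * J)) = r *\<^sub>R 1 + (j * j + j * j)"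
    by (simp_all add: j_def r_def power2_eq_square scaleR_2 algebra_simps flip: scaleR_2)
  have dr: "dressing s J = 1 + fps_X * fps_const (j + j) + fps_X * (fps_X * fps_const (r *\<^sub>R 1 + (j * j + j * j)))"
    by (simp only: dressing_def jj)
  have dl: "dressing s J * f = f + fps_X * (fps_const (j + j) * f) +
     fps_X * (fps_X * (fps_const (r *\<^sub>R 1 + (j * j + j * j)) * f))" for f
    by (simp only: dr distrib_right mult.assoc mult_1)
  have dr': "f * dressing s J = f + fps_X * (f * fps_const (j + j)) +
     fps_X * (fps_X * (f * fps_const (r *\<^sub>R 1 + (j * j + j * j))))" for f
    by (simp only: dr distrib_left fps_X_left_commute[of f] mult_1_right)
  \<comment> \<open>These relations serve as rewrite rules for \<open>r a\<close>,
    \<open>j j j a\<close> and \<open>j a j j\<close>; afterwards both remaining identities are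
    equalities of noncommutative monomials.\<close>
  have ra: "r *\<^sub>R a = j * (a * j) - j * (j * a) - a * (j * j)"
    using arg_cong[OF aJ, of "\<lambda>z. r *\<^sub>R z"] by (simp add: j_def r_def power2_eq_square algebra_simps)
  have rj: "j * (j * j) = - (r *\<^sub>R j)"
    using JJJ by (simp add: j_def r_def power2_eq_square algebra_simps)
  then have rja: "j * (j * (j * a)) = - (r *\<^sub>R (j * a))"
    by (metis mult.assoc mult_minus_left mult_scaleR_left)
  have jajj: "j * (a * (j * j)) = j * (j * (a * j))"
    using JaJJ by (simp add: j_def)
  have Dj: "D j = j * u - u * j + r *\<^sub>R a + j * (a * j)"
    by (simp add: j_def r_def D_scaleR DJ power2_eq_square algebra_simps)
  have u': "u' = u - (j * a - a * j) - (j * a - a * j)"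
    unfolding u' by (simp add: j_def algebra_simps flip: scaleR_2)
  have D1: "D (x *\<^sub>R 1) = 0" for x by (simp add: D_scaleR)
  consider "n = 0" | "n = 1" | "n = 2" | "n = 3" | "n \<ge> 4" by linarith
  then show "(fps_X * DD (dressing s J)) $ n = (dressing s J * lax a u' - lax a u * dressing s J) $ n"
  proof cases
    case 3
    have "D j + D j = (j + j) * u' + (r *\<^sub>R 1 + (j * j + j * j)) * a - (u * (j + j) + a * (r *\<^sub>R 1 + (j * j + j * j)))"
      by (simp add: Dj u' ra algebra_simps)
    then show ?thesis using 3 by (simp add: dl dr' lax_nth) (simp add: dr D_add)
  next
    case 4
    have "D (r *\<^sub>R 1 + (j * j + j * j)) = (r *\<^sub>R 1 + (j * j + j * j)) * u' - u * (r *\<^sub>R 1 + (j * j + j * j))"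
      by (simp add: D_add D_mult D1 Dj u' rja jajj algebra_simps)
    then show ?thesis using 4 by (simp add: dl dr' lax_nth) (simp add: dr D_add)
  next
    case 5
    then show ?thesis by (simp add: dl dr' lax_nth) (auto simp: dr)
  next
    case 2
    then show ?thesis by (simp add: dl dr' lax_nth u') (simp add: dr algebra_simps)
  next
    case 1
    then show ?thesis by (simp add: dl dr' lax_nth)
  qed
qed

lemma dressing_intertwines:
  assumes "a * a * a = - a" "Q_solution a u' p" "Q_solution a u q"
    and "J * (J * J) = - J"
    and "a + J * (J * a) + a * (J * J) = J * (a * J)"
    and "J * (a * (J * J)) = J * (J * (a * J))"
    and "D J = J * u - u * J + s *\<^sub>R (a + J * (a * J))"
    and "u' = u - (2 * s) *\<^sub>R (J * a - a * J)"
  shows "q * dressing s J = dressing s J * p"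
  by (rule Q_solution_intertwine[OF assms(1,3,2) dressing_gauge[OF assms(4-8)]])

section \<open>Existence by formal diagonalisation\<close>

context
  fixes a u :: 'a
begin

text \<open>
  The recursion for a gauge transformation \<open>M\<close> that takes \<open>\<partial>\<^sub>x + a\<lambda> + u\<close> to \<open>\<partial>\<^sub>x + a\<lambda> + h\<close> with \<open>h\<close>
  commuting with \<open>a\<close>. Since \<open>T = ad a\<close> satisfies \<open>T (T\<^sup>2 + 1) (T\<^sup>2 + 4) = 0\<close>, every \<open>x\<close> is the
  sum of \<open>x + T (gauge_step x)\<close>, which is in the kernel of \<open>T\<close>, and of \<open>- T (gauge_step x)\<close>.
\<close>

definition ad :: "'a \<Rightarrow> 'a" where
  "ad x = a * x - x * a"

text \<open>The constants make \<open>gauge_diag\<close> equal to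
  \<open>(T^2 + 1) (T^2 + 4) / 4 = 1 + (5 T^2 + T^4) / 4\<close>, the polynomial in \<open>T\<close>
  that is 1 on the kernel of \<open>T\<close> and 0 on the other eigenspaces.\<close>

definition gauge_step :: "'a \<Rightarrow> 'a" where
  "gauge_step x = (1/4) *\<^sub>R ad (5 *\<^sub>R x + ad (ad x))"

definition gauge_diag :: "'a \<Rightarrow> 'a" where
  "gauge_diag x = x + ad (gauge_step x)"

text \<open>Coefficient \<open>i + 1\<close> of the gauge equation reads
  \<open>h_i - ad M_(i+1) = gauge_rem i\<close>, where the right side involves only earlier
  coefficients of \<open>M\<close> and \<open>h\<close>. The choice
  \<open>M_(i+1) = gauge_step (gauge_rem i)\<close> leaves
  \<open>h_i = gauge_diag (gauge_rem i)\<close>.\<close>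

function gauge_rem :: "nat \<Rightarrow> 'a" where
  "gauge_rem i = (if i = 0 then u else
     D (gauge_step (gauge_rem (i - 1))) + u * gauge_step (gauge_rem (i - 1)) -
     (\<Sum>j=1..i. gauge_step (gauge_rem (j - 1)) * gauge_diag (gauge_rem (i - j))))"
  by auto
termination by (relation "Wellfounded.measure id") auto

declare gauge_rem.simps [simp del]

text \<open>The eigenvalues of \<open>T\<close> are differences of those of \<open>a\<close>, namely
  0, i, -i, 2i, -2i. The proof verifies the resulting polynomial identity using only
  \<open>a^3 = -a\<close>.\<close>

lemma ad_gauge_diag:
  assumes "a * a * a = - a"
  shows "ad (gauge_diag x) = 0"
proof -
  have a1: "a * (a * (a * y)) = - (a * y)" for y
    using assms by (metis mult.assoc mult_minus_left)
  have a2: "a * (a * a) = - a" using assms by (simp add: mult.assoc)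
  \<comment> \<open>\<open>Y\<close> and \<open>P\<close> belong to the eigenvalues 2i and -2i:
    \<open>T Y = -2 P\<close>, \<open>T P = 2 Y\<close>, and
    \<open>T (T^2 + 1) x = -3 Y\<close>.\<close>
  define Y where "Y = a * (a * (x * a)) - a * (x * (a * a))"
  define P where "P = a * (x * a) + a * (a * (x * (a * a)))"
  have lin: "ad (y + z) = ad y + ad z" "ad (y - z) = ad y - ad z" "ad (- y) = - ad y"
    "ad (r *\<^sub>R y) = r *\<^sub>R ad y" for y z r
    by (simp_all add: ad_def algebra_simps)
  have "3 *\<^sub>R Y = (1 + 1 + 1) *\<^sub>R Y" by simp
  then have "3 *\<^sub>R Y = Y + Y + Y" by (simp only: scaleR_add_left scaleR_one)
  moreover have "ad (ad (ad x)) = - ad x - (Y + Y + Y)"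
    by (simp add: ad_def Y_def algebra_simps a1 a2)
  ultimately have T3: "ad (ad (ad x)) = - ad x - 3 *\<^sub>R Y" by simp
  have TY: "ad Y = - 2 *\<^sub>R P" unfolding scaleR_minus_left scaleR_2
    by (simp add: ad_def Y_def P_def algebra_simps a1 a2)
  have TP: "ad P = 2 *\<^sub>R Y" unfolding scaleR_2
    by (simp add: ad_def Y_def P_def algebra_simps a1 a2)
  have "ad (gauge_diag x) = ad x + (1/4) *\<^sub>R (5 *\<^sub>R ad (ad (ad x)) + ad (ad (ad (ad (ad x)))))"
    by (simp add: gauge_diag_def gauge_step_def lin)
  also have "\<dots> = ad x + (1/4) *\<^sub>R ((-4) *\<^sub>R ad x + (-15 + 3 + 12) *\<^sub>R Y)"
    unfolding T3 lin TY TP by (simp add: algebra_simps T3 flip: scaleR_add_left scaleR_left_diff_distrib)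
  also have "\<dots> = 0" by simp
  finally show ?thesis .
qed

text \<open>For the operator with potential \<open>a + X h\<close>, where \<open>h\<close> commutes
  with \<open>a\<close>, the constant series \<open>a\<close> is a solution; it is transported back
  as \<open>M a M^-1\<close>. The pair \<open>M\<close>, \<open>N\<close> is exported because it
  also witnesses conjugacy.\<close>

lemma Q_solution_exists:
  assumes "a * a * a = - a" "D a = 0"
  obtains q M N where "Q_solution a u q" "M * N = 1" "N * M = 1" "q = M * fps_const a * N"
proof -
  define m where "m n = (if n = 0 then 1 else gauge_step (gauge_rem (n - 1)))" for n
  define M where "M = Abs_fps m"
  define h where "h = Abs_fps (\<lambda>n. gauge_diag (gauge_rem n))"
  let ?a = "fps_const a"
  have M0: "M $ 0 = 1" by (simp add: M_def m_def)
  have ha: "h * ?a = ?a * h"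
    using ad_gauge_diag[OF assms(1)] by (simp add: fps_eq_iff h_def ad_def)
  have eq: "fps_X * DD M = M * (?a + fps_X * h) - lax a u * M"
  proof (rule fps_ext)
    fix n
    show "(fps_X * DD M) $ n = (M * (?a + fps_X * h) - lax a u * M) $ n"
    proof (cases n)
      case 0
      then show ?thesis by (simp add: M0 lax_nth)
    next
      case (Suc n)
      have rem: "gauge_rem n = D (m n) + u * m n - (\<Sum>j=1..n. m j * gauge_diag (gauge_rem (n - j)))"
        by (subst gauge_rem.simps) (auto simp: m_def intro!: sum.cong)
      have "(M * h) $ n = gauge_diag (gauge_rem n) + (\<Sum>j=1..n. m j * gauge_diag (gauge_rem (n - j)))"
        unfolding fps_mult_nth by (subst sum.atLeast_Suc_atMost) (auto simp: M_def h_def m_def)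
      then have Mh: "(M * h) $ n = ad (m (Suc n)) + D (m n) + u * m n"
        using rem by (simp add: gauge_diag_def m_def)
      have "M * (?a + fps_X * h) = M * ?a + fps_X * (M * h)"
        by (metis (no_types) distrib_left fps_mult_fps_X_commute mult.assoc)
      moreover have "lax a u * M = ?a * M + fps_X * (fps_const u * M)"
        by (simp add: lax_def algebra_simps)
      ultimately show ?thesis using Suc
        by (simp add: Mh) (simp add: M_def ad_def)
    qed
  qed
  \<comment> \<open>Constant coefficient 1 suffices for a two-sided inverse over a noncommutative
    ring.\<close>
  define N where "N = fps_right_inverse M 1"
  have N: "M * N = 1" "N * M = 1"
    using fps_right_inverse[of M 1] fps_left_inverse'[of 1 M 1] by (simp_all add: M0 N_def)
  define q where "q = M * ?a * N"
  have DN: "DD N = - (N * DD M * N)"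
  proof -
    have "N * (DD M * N + M * DD N) = 0" using DD_mult[of M N] N by simp
    moreover have "N * (M * DD N) = DD N" using N by (simp flip: mult.assoc)
    ultimately show ?thesis by (simp add: algebra_simps eq_neg_iff_add_eq_0)
  qed
  have X: "fps_X * (f * g) = f * (fps_X * g)" for f g :: "'a fps"
    by (metis fps_mult_fps_X_commute mult.assoc)
  have N': "N * (M * y) = y" "M * (N * y) = y" for y using N by (simp_all flip: mult.assoc)
  have "DD ?a = 0" using assms(2) by (simp add: fps_eq_iff fps_const_def)
  then have "fps_X * DD q = (fps_X * DD M) * ?a * N - M * ?a * N * (fps_X * DD M) * N"
    by (simp add: q_def DD_mult DN algebra_simps X[of M] X[of ?a] X[of N])
  also have "\<dots> = q * lax a u - lax a u * q"
  proof -
    define Y where "Y = fps_X * h"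
    have Ya: "Y * ?a = ?a * Y" by (simp add: Y_def ha X[of ?a] mult.assoc)
    then have Ya': "Y * (?a * z) = ?a * (Y * z)" for z by (metis mult.assoc)
    show ?thesis unfolding eq q_def Y_def[symmetric] by (simp add: algebra_simps N' N Ya Ya')
  qed
  finally have lin: "fps_X * DD q = q * lax a u - lax a u * q" .
  have a3: "?a * (?a * (?a * z)) = - (?a * z)" for z
  proof -
    have "?a * ?a * ?a = - ?a" using assms(1) by simp
    then show ?thesis by (metis mult.assoc mult_minus_left)
  qed
  have "q * q * q = - q" by (simp add: q_def mult.assoc N' a3)
  moreover have "q $ 0 = a"
    using arg_cong[OF N(1), of "\<lambda>f. f $ 0"] by (simp add: q_def M0)
  ultimately have "Q_solution a u q" using lin by (simp add: Q_solution_def)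
  then show ?thesis using that N q_def by blast
qed

end

end

unbundle no fps_syntax
unbundle vec_syntax

section \<open>Matrix algebra\<close>

lemma matrix_add_rdistrib:
  fixes A B :: "'a::semiring_1 ^ 'n ^ 'm"
  shows "(A + B) ** C = A ** C + B ** C"
  by (simp add: matrix_matrix_mult_def vec_eq_iff sum.distrib algebra_simps)

lemma matrix_diff_ldistrib:
  fixes B C :: "'a::ring_1 ^ 'n ^ 'm"
  shows "A ** (B - C) = A ** B - A ** C"
  by (simp add: matrix_matrix_mult_def vec_eq_iff sum_subtractf algebra_simps)

lemma matrix_diff_rdistrib:
  fixes A B :: "'a::ring_1 ^ 'n ^ 'm"
  shows "(A - B) ** C = A ** C - B ** C"
  by (simp add: matrix_matrix_mult_def vec_eq_iff sum_subtractf algebra_simps)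

lemma matrix_minus_left:
  fixes A :: "'a::ring_1 ^ 'n ^ 'm"
  shows "(- A) ** B = - (A ** B)"
  by (simp add: matrix_matrix_mult_def vec_eq_iff sum_negf)

lemma matrix_minus_right:
  fixes A :: "'a::ring_1 ^ 'n ^ 'm"
  shows "A ** (- B) = - (A ** B)"
  by (simp add: matrix_matrix_mult_def vec_eq_iff sum_negf)

lemma matrix_scaleR_left:
  fixes A :: "'a::real_algebra_1 ^ 'n ^ 'm"
  shows "(r *\<^sub>R A) ** B = r *\<^sub>R (A ** B)"
  by (simp add: matrix_matrix_mult_def vec_eq_iff scaleR_sum_right)

lemma matrix_scaleR_right:
  fixes A :: "'a::real_algebra_1 ^ 'n ^ 'm"
  shows "A ** (r *\<^sub>R B) = r *\<^sub>R (A ** B)"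
  by (simp add: matrix_matrix_mult_def vec_eq_iff scaleR_sum_right)

lemma matrix_zero_left [simp]: "0 ** A = (0 :: 'a::semiring_1 ^ 'n ^ 'm)"
  and matrix_zero_right [simp]: "B ** 0 = (0 :: 'a::semiring_1 ^ 'n ^ 'm)"
  by (simp_all add: matrix_matrix_mult_def vec_eq_iff)

lemmas matrix_distribs = matrix_add_ldistrib matrix_add_rdistrib matrix_diff_ldistrib
  matrix_diff_rdistrib matrix_minus_left matrix_minus_right matrix_scaleR_left matrix_scaleR_right

section \<open>The differential ring of smooth matrix functions\<close>

text \<open>As a type of their own, smooth matrix functions form a \<open>real_algebra_1\<close> and
  can serve as coefficients of power series.\<close>

typedef 'n smat = "{f :: real \<Rightarrow> real ^ 'n::finite ^ 'n. smooth f}"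
  morphisms fn Smat
  by (intro exI[of _ "\<lambda>_. 0"]) simp

setup_lifting type_definition_smat

lemma smooth_fn: "smooth (fn f)"
  using fn by simp

instantiation smat :: (finite) real_algebra_1
begin

lift_definition zero_smat :: "'a smat" is "\<lambda>_. 0" by simp
lift_definition one_smat :: "'a smat" is "\<lambda>_. mat 1" by simp
lift_definition plus_smat :: "'a smat \<Rightarrow> 'a smat \<Rightarrow> 'a smat" is "\<lambda>f g x. f x + g x"
  by (rule smooth_add)
lift_definition minus_smat :: "'a smat \<Rightarrow> 'a smat \<Rightarrow> 'a smat" is "\<lambda>f g x. f x - g x"
  by (rule smooth_diff)
lift_definition uminus_smat :: "'a smat \<Rightarrow> 'a smat" is "\<lambda>f x. - f x"
  by (rule smooth_minus)
lift_definition times_smat :: "'a smat \<Rightarrow> 'a smat \<Rightarrow> 'a smat" is "\<lambda>f g x. f x ** g x"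
  by (rule smooth_matrix_mult)
lift_definition scaleR_smat :: "real \<Rightarrow> 'a smat \<Rightarrow> 'a smat" is "\<lambda>r f x. r *\<^sub>R f x"
  by (rule smooth_scaleR) simp

instance
proof
  show "(0 :: 'a smat) \<noteq> 1"
    by transfer (simp add: fun_eq_iff vec_eq_iff mat_def)
qed (transfer; simp add: fun_eq_iff matrix_mul_assoc matrix_distribs algebra_simps)+

end

lift_definition sderiv :: "'n::finite smat \<Rightarrow> 'n smat" is "\<lambda>f x. vector_derivative f (at x)"
  by (rule smooth_vector_derivative)

interpretation sderiv: derivation sderiv
proof
  fix f g :: "'n::finite smat" and r :: real
  show "sderiv (f + g) = sderiv f + sderiv g"
    by transfer (auto simp: fun_eq_iff intro!: vector_derivative_at has_vector_derivative_add smooth_has_vector_derivative)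
  show "sderiv (f * g) = sderiv f * g + f * sderiv g"
  proof (transfer, rule ext)
    fix f g :: "real \<Rightarrow> real ^ 'n ^ 'n" and x assume "smooth f" "smooth g"
    then show "vector_derivative (\<lambda>x. f x ** g x) (at x) =
      vector_derivative f (at x) ** g x + f x ** vector_derivative g (at x)"
      by (subst add.commute, intro vector_derivative_at has_vector_derivative_matrix_mult smooth_has_vector_derivative)
  qed
  show "sderiv (r *\<^sub>R f) = r *\<^sub>R sderiv f"
  proof (transfer, rule ext)
    fix f :: "real \<Rightarrow> real ^ 'n ^ 'n" and x r assume "smooth f"
    then show "vector_derivative (\<lambda>x. r *\<^sub>R f x) (at x) = r *\<^sub>R vector_derivative f (at x)"
      by (intro vector_derivative_at bounded_linear.has_vector_derivative[OF bounded_linear_scaleR_right] smooth_has_vector_derivative)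
  qed
qed

lift_definition sconst :: "real ^ 'n::finite ^ 'n \<Rightarrow> 'n smat" is "\<lambda>A _. A" by simp

lemma sderiv_sconst [simp]: "sderiv (sconst A) = 0"
  by transfer simp

lemma fn_simps [simp]:
  "fn 0 x = 0" "fn 1 x = mat 1" "fn (f + g) x = fn f x + fn g x" "fn (f - g) x = fn f x - fn g x"
  "fn (- f) x = - fn f x" "fn (f * g) x = fn f x ** fn g x" "fn (r *\<^sub>R f) x = r *\<^sub>R fn f x"
  "fn (sconst A) x = A"
  by (transfer; simp)+

lemma fn_sderiv: "fn (sderiv f) x = vector_derivative (fn f) (at x)"
  by transfer simp

lemma fn_sum: "fn (\<Sum>i\<in>A. f i) x = (\<Sum>i\<in>A. fn (f i) x)"
  by (induction A rule: infinite_finite_induct) auto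

lemma smat_eqI: "(\<And>x. fn f x = fn g x) \<Longrightarrow> f = g"
  by (simp add: fn_inject[symmetric] fun_eq_iff)

lemma fn_Smat: "smooth f \<Longrightarrow> fn (Smat f) = f"
  by (simp add: Smat_inverse)

section \<open>Matrices of Laurent series\<close>

text \<open>Evaluation at \<open>x\<close>, a ring homomorphism from series of matrix functions to
  the matrices of Laurent series in which \<open>Q\<close> is defined.\<close>

definition ser :: "real \<Rightarrow> 'n::finite smat fps \<Rightarrow> real fls ^ 'n ^ 'n" where
  "ser x q = (\<chi> i j. fps_to_fls (Abs_fps (\<lambda>n. fn (fps_nth q n) x $ i $ j)))"

lemma ser_nth: "fls_nth (ser x q $ i $ j) m = (if m < 0 then 0 else fn (fps_nth q (nat m)) x $ i $ j)"
  by (simp add: ser_def)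

lemma fps_to_fls_sum: "fps_to_fls (\<Sum>i\<in>A. f i) = (\<Sum>i\<in>A. fps_to_fls (f i :: 'a::comm_ring_1 fps))"
  by (induction A rule: infinite_finite_induct) auto

lemma ser_mult: "ser x (p * q) = ser x p ** ser x q"
proof -
  have "Abs_fps (\<lambda>n. fn (fps_nth (p * q) n) x $ i $ j) =
     (\<Sum>k\<in>UNIV. Abs_fps (\<lambda>n. fn (fps_nth p n) x $ i $ k) * Abs_fps (\<lambda>n. fn (fps_nth q n) x $ k $ j))" for i j
    by (rule fps_ext)
      (simp add: fps_mult_nth fps_sum_nth fn_sum matrix_matrix_mult_def sum.swap[of _ UNIV])
  then show ?thesis
    by (simp add: ser_def matrix_matrix_mult_def vec_eq_iff fps_to_fls_sum fls_times_fps_to_fls)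
qed

lemma ser_minus: "ser x (- q) = - ser x q"
  by (simp add: vec_eq_iff fls_eq_iff ser_nth)

lemma ser_const: "ser x (fps_const f) = fls_mat (fn f x)"
  by (simp add: vec_eq_iff fls_eq_iff ser_nth fls_mat_def)

lemma ser_1: "ser x 1 = mat 1"
  by (simp add: vec_eq_iff fls_eq_iff ser_nth mat_def)

lemma ser_eqI: "(\<And>x. ser x p = ser x q) \<Longrightarrow> p = q"
proof (intro fps_ext smat_eqI)
  fix n x assume "\<And>x. ser x p = ser x q"
  then have "fls_nth (ser x p $ i $ j) (int n) = fls_nth (ser x q $ i $ j) (int n)" for i j by simp
  then show "fn (fps_nth p n) x = fn (fps_nth q n) x" by (simp add: ser_nth vec_eq_iff)
qed

lemma mat_X_inv_commute: "mat fls_X_inv ** F = F ** mat (fls_X_inv :: real fls)"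
  by (simp add: matrix_matrix_mult_def mat_def vec_eq_iff if_distrib if_distribR sum.delta sum.delta'
      mult.commute cong: if_cong)

lemma coeff_mat_X_inv: "coeff_mat (mat fls_X_inv ** F) m = coeff_mat F (m + 1)"
  by (simp add: coeff_mat_def matrix_matrix_mult_def mat_def vec_eq_iff if_distrib if_distribR
      sum.delta sum.delta' fls_X_inv_times_conv_shift cong: if_cong)

lemma coeff_mat_ser: "coeff_mat (ser x q) m = (if m < 0 then 0 else fn (fps_nth q (nat m)) x)"
  by (simp add: coeff_mat_def ser_nth vec_eq_iff)

lemma fls_sum_nth: "fls_nth (\<Sum>i\<in>A. f i) m = (\<Sum>i\<in>A. fls_nth (f i) m)"
  by (induction A rule: infinite_finite_induct) auto

lemma coeff_mat_const_mult: 
  "coeff_mat (fls_mat A ** F) m = A ** coeff_mat F m" "coeff_mat (F ** fls_mat A) m = coeff_mat F m ** A"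
  by (simp_all add: coeff_mat_def fls_mat_def matrix_matrix_mult_def vec_eq_iff fls_sum_nth)

lemma coeff_mat_add: "coeff_mat (F + G) m = coeff_mat F m + coeff_mat G m"
  and coeff_mat_diff: "coeff_mat (F - G) m = coeff_mat F m - coeff_mat G m"
  by (simp_all add: coeff_mat_def vec_eq_iff)

lemma coeff_mat_eqI: "(\<And>m. coeff_mat F m = coeff_mat G m) \<Longrightarrow> F = G"
  by (simp add: coeff_mat_def vec_eq_iff fls_eq_iff)

lemma matrix_inv_eqI:
  fixes A B :: "'a::semiring_1 ^ 'n ^ 'n"
  assumes "A ** B = mat 1" "B ** A = mat 1"
  shows "matrix_inv A = B"
proof -
  have "A ** matrix_inv A = mat 1 \<and> matrix_inv A ** A = mat 1"
    unfolding matrix_inv_def by (rule someI[of _ B]) (simp add: assms)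
  then show ?thesis by (metis assms(2) matrix_mul_assoc matrix_mul_lid matrix_mul_rid)
qed

text \<open>\<open>\<lambda> = X^-1\<close> is central and lowers the index by one, so
  \<open>a\<close> meets the next coefficient.\<close>

lemma coeff_mat_lax:
  "coeff_mat (commutator (a_lambda + fls_mat U) F) m =
   commutator amat (coeff_mat F (m + 1)) + commutator U (coeff_mat F m)"
proof -
  have "F ** a_lambda = mat fls_X_inv ** (F ** fls_mat amat)"
    by (metis a_lambda_def mat_X_inv_commute matrix_mul_assoc)
  then show ?thesis
    by (simp add: commutator_def matrix_distribs coeff_mat_diff coeff_mat_add
      coeff_mat_const_mult a_lambda_def coeff_mat_X_inv flip: matrix_mul_assoc)
qed

section \<open>Block matrices\<close>

lemma sum_UNIV_option: "(\<Sum>i\<in>(UNIV :: 'm::finite option set). f i) = f None + (\<Sum>i\<in>UNIV. f (Some i))"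
  by (simp add: UNIV_option_conv sum.reindex)

lemma vec_option_eq_iff:
  fixes v w :: "'a ^ 'm::finite option"
  shows "v = w \<longleftrightarrow> v $ None = w $ None \<and> (\<forall>i. v $ Some i = w $ Some i)"
  by (metis not_Some_eq vec_eq_iff)

lemma block_nth [simp]:
  "block p r c B $ None $ None = p" "block p r c B $ None $ Some j = r $ j"
  "block p r c B $ Some i $ None = c $ i" "block p r c B $ Some i $ Some j = B $ i $ j"
  by (simp_all add: block_def)

lemma vcons_nth [simp]: "vcons p w $ None = p" "vcons p w $ Some i = w $ i"
  by (simp_all add: vcons_def)

definition outer :: "real ^ 'n \<Rightarrow> real ^ 'm \<Rightarrow> real ^ 'm ^ 'n" where
  "outer v w = (\<chi> i j. v $ i * w $ j)"

lemma block_arith: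
  fixes B :: "'a::real_algebra_1 ^ 'm ^ 'm"
  shows "block p r c B + block p' r' c' B' = block (p + p') (r + r') (c + c') (B + B')"
    "block p r c B - block p' r' c' B' = block (p - p') (r - r') (c - c') (B - B')"
    "- block p r c B = block (- p) (- r) (- c) (- B)"
    "a *\<^sub>R block p r c B = block (a *\<^sub>R p) (a *\<^sub>R r) (a *\<^sub>R c) (a *\<^sub>R B)"
  by (simp_all add: vec_option_eq_iff)

lemma block_eq_iff: "block p r c B = block p' r' c' B' \<longleftrightarrow> p = p' \<and> r = r' \<and> c = c' \<and> B = B'"
  by (auto simp: vec_option_eq_iff vec_eq_iff)

lemma block_1: "block 1 0 0 (mat 1) = mat 1"
  by (simp add: vec_option_eq_iff mat_def)

lemma transpose_block: "transpose (block p r c B) = block p c r (transpose B)"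
  by (simp add: vec_option_eq_iff transpose_def)

lemma block_diag_mult:
  fixes B :: "'a::semiring_1 ^ 'm::finite ^ 'm"
  shows "block p 0 0 B ** block p' 0 0 B' = block (p * p') 0 0 (B ** B')"
  by (simp add: vec_option_eq_iff matrix_matrix_mult_def sum_UNIV_option)

lemma block_mixed_mult:
  fixes B :: "real ^ 'm::finite ^ 'm"
  shows "block p 0 0 B ** block 0 r c 0 = block 0 (p *\<^sub>R r) (B *v c) 0"
    "block 0 r c 0 ** block p 0 0 B = block 0 (transpose B *v r) (p *\<^sub>R c) 0"
  by (simp_all add: vec_option_eq_iff matrix_matrix_mult_def matrix_vector_mult_def transpose_def
      sum_UNIV_option mult.commute)

lemma block_off_diag_mult:
  fixes r :: "real ^ 'm::finite"
  shows "block 0 r c 0 ** block 0 r' c' 0 = block (r \<bullet> c') 0 0 (outer c r')"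
  by (simp add: vec_option_eq_iff matrix_matrix_mult_def outer_def sum_UNIV_option inner_vec_def)

lemmas block_mult = block_diag_mult block_mixed_mult block_off_diag_mult

lemma outer_mult_vec: "outer v w *v x = (w \<bullet> x) *\<^sub>R v"
  by (simp add: vec_eq_iff outer_def matrix_vector_mult_def inner_vec_def sum_distrib_right
      sum_distrib_left algebra_simps)

lemma transpose_outer: "transpose (outer v w) = outer w v"
  by (simp add: vec_eq_iff outer_def transpose_def)

lemma outer_minus: "outer (- v) w = - outer v w" "outer v (- w) = - outer v w"
  by (simp_all add: vec_eq_iff outer_def)

lemma transpose_minus: "transpose (- A) = - transpose (A :: 'a::ring_1 ^ 'n ^ 'm)"
  and transpose_add: "transpose (A + B) = transpose A + transpose (B :: 'a::ring_1 ^ 'n ^ 'm)"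
  and transpose_diff: "transpose (A - B) = transpose A - transpose (B :: 'a::ring_1 ^ 'n ^ 'm)"
  by (simp_all add: vec_eq_iff transpose_def)

lemma matrix_minus_vec: "(- A) *v x = - (A *v x :: 'a::ring_1 ^ 'm)"
  by (simp add: vec_eq_iff matrix_vector_mult_def sum_negf)

lemma matrix_vec_minus: "A *v (- x) = - (A *v x :: 'a::ring_1 ^ 'm)"
  by (simp add: vec_eq_iff matrix_vector_mult_def sum_negf)

lemma refl_mat_outer: "refl_mat c = mat 1 - 2 *\<^sub>R outer c c"
  by (simp add: refl_mat_def outer_def vec_eq_iff)

lemma skew_block_0: "skew_block w 0 = block 0 (- w) w 0"
  by (simp add: skew_block_def)

lemma transpose_skew_block: "transpose \<xi> = - \<xi> \<Longrightarrow> transpose (skew_block w \<xi>) = - skew_block w \<xi>"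
  by (simp add: skew_block_def transpose_block block_arith)

lemma amat_skew: "amat = skew_block (axis None 1) 0"
  by (simp add: amat_def odd_mat_def) (simp add: vec_option_eq_iff axis_def vcons_def skew_block_def split: option.splits)

lemma skew_block_cube:
  assumes "norm c = 1"
  shows "skew_block c 0 ** (skew_block c 0 ** skew_block c 0) = - skew_block c 0"
  using assms
  by (simp add: skew_block_0 block_mult block_arith transpose_outer transpose_minus outer_minus
      matrix_minus_vec matrix_vec_minus outer_mult_vec norm_eq_1)

text \<open>Since \<open>J a J\<close> collapses to a multiple of \<open>J\<close>, the term
  \<open>s (a + J a J)\<close> in the equation for \<open>D J\<close> stands for the vector
  \<open>s (e - (c . e) c)\<close>.\<close>

lemma skew_block_triple:
  "skew_block c 0 ** (skew_block e 0 ** skew_block c 0) = - (c \<bullet> e) *\<^sub>R skew_block c 0"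
  by (simp add: skew_block_0 block_mult block_arith transpose_outer transpose_minus outer_minus
      matrix_minus_vec matrix_vec_minus outer_mult_vec inner_commute)

lemma skew_block_dressing:
  fixes c e :: "real ^ 'm::finite"
  assumes "norm c = 1"
  defines "J \<equiv> skew_block c 0" and "a \<equiv> skew_block e 0"
  shows "a + J ** (J ** a) + a ** (J ** J) = J ** (a ** J)"
    and "J ** (a ** (J ** J)) = J ** (J ** (a ** J))"
proof -
  show "a + J ** (J ** a) + a ** (J ** J) = J ** (a ** J)"
    using assms(1) unfolding J_def a_def skew_block_triple
    by (simp add: skew_block_0 block_mult block_arith transpose_outer transpose_minus outer_minus
      matrix_minus_vec matrix_vec_minus outer_mult_vec norm_eq_1 block_eq_iff inner_commute)
  have "J ** (a ** (J ** J)) = (J ** (a ** J)) ** J"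
    by (simp add: matrix_mul_assoc)
  then show "J ** (a ** (J ** J)) = J ** (J ** (a ** J))"
    unfolding J_def a_def skew_block_triple by (simp add: matrix_distribs)
qed

lemma amat_cube: "amat ** amat ** amat = - amat"
  using skew_block_cube[of "axis None 1"] by (simp add: amat_skew norm_axis_1 flip: matrix_mul_assoc)

lemma transpose_amat: "transpose amat = - amat"
  unfolding amat_skew by (rule transpose_skew_block) (simp add: transpose_def vec_eq_iff)

lemma transpose_Psi: "transpose (Psi k) = - Psi k"
proof -
  have "transpose (skew_block k 0) = - skew_block k 0"
    by (rule transpose_skew_block) (simp add: transpose_def vec_eq_iff)
  then show ?thesis by (simp add: Psi_def even_mat_def transpose_block block_arith)
qed

text \<open>The real counterpart of \<open>I1n\<close>; conjugation by it fixes the even matrices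
  and negates the odd ones.\<close>

definition parity :: "real ^ 'm::finite option ^ 'm option" where
  "parity = diag1 (- mat 1)"

lemma parity_sq: "parity ** parity = mat 1"
  by (simp add: parity_def diag1_def block_diag_mult block_1 matrix_minus_left matrix_minus_right)

lemma parity_conj:
  fixes B :: "real ^ 'm::finite ^ 'm"
  shows "parity ** block p r c B ** parity = block p (- r) (- c) B"
proof -
  have m: "(- mat 1 :: real ^ 'm ^ 'm) *v x = - x" "transpose (- mat 1 :: real ^ 'm ^ 'm) = - mat 1" for x
    by (simp_all add: matrix_minus_vec transpose_minus)
  have e: "block p r c B = block p 0 0 B + block 0 r c 0" by (simp add: block_arith)
  show ?thesis
    by (subst e, unfold matrix_add_ldistrib matrix_add_rdistrib parity_def diag1_def block_mult)
      (simp add: block_arith m matrix_minus_left matrix_minus_right)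
qed

lemma parity_conj_amat: "parity ** amat ** parity = - amat"
  by (simp add: amat_skew skew_block_0 parity_conj block_arith)

lemma parity_conj_Psi: "parity ** Psi k ** parity = Psi k"
  by (simp add: Psi_def even_mat_def parity_conj)

lemma ex_block: "\<exists>p r c B. A = block p r c B"
proof -
  have "A = block (A $ None $ None) (\<chi> j. A $ None $ Some j) (\<chi> i. A $ Some i $ None) (\<chi> i j. A $ Some i $ Some j)"
    by (simp add: vec_option_eq_iff)
  then show ?thesis by blast
qed

lemma vec_eq_minus_self: "v = - v \<longleftrightarrow> v = (0 :: real ^ 'n)" "A = - A \<longleftrightarrow> A = (0 :: real ^ 'n ^ 'm)"
  by (simp_all add: vec_eq_iff)

lemma skew_block_of_skew:
  fixes A :: "real ^ 'm::finite option ^ 'm option"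
  assumes "transpose A = - A"
  obtains w \<xi> where "A = skew_block w \<xi>" "transpose \<xi> = - \<xi>"
proof -
  obtain p r c B where A: "A = block p r c B" using ex_block[of A] by blast
  have e: "p = - p" "r = - c" "transpose B = - B"
    using assms unfolding A transpose_block block_arith block_eq_iff by blast+
  then have "A = skew_block c B"
    unfolding A skew_block_def block_eq_iff by simp
  then show ?thesis using e(3) that by blast
qed

text \<open>Reduces the prescribed block shape to two symmetries, each of which can be obtained from
  uniqueness of the series.\<close>

lemma odd_mat_of_parity:
  fixes A :: "real ^ 'm::finite option option ^ 'm option option"
  assumes "transpose A = - A" "parity ** A ** parity = - A"
  shows "A = odd_mat (A $ Some None $ None) (\<chi> i. A $ Some (Some i) $ None)"
proof -
  obtain w \<xi> where A: "A = skew_block w \<xi>" by (rule skew_block_of_skew[OF assms(1)])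
  have "\<xi> = 0"
    using assms(2) unfolding A skew_block_def parity_conj block_arith block_eq_iff
    by (simp add: vec_eq_minus_self)
  moreover have w: "vcons (w $ None) (\<chi> i. w $ Some i) = w" by (simp add: vec_option_eq_iff)
  moreover have e: "A $ Some None $ None = w $ None" "(\<chi> i. A $ Some (Some i) $ None) = (\<chi> i. w $ Some i)"
    unfolding A skew_block_def by simp_all
  ultimately show ?thesis unfolding odd_mat_def e w using A by simp
qed

lemma even_mat_of_parity:
  fixes A :: "real ^ 'm::finite option option ^ 'm option option"
  assumes "transpose A = - A" "parity ** A ** parity = A"
  defines "\<xi> \<equiv> \<chi> i j. A $ Some (Some i) $ Some (Some j)"
  shows "A = even_mat (\<chi> i. A $ Some (Some i) $ Some None) \<xi>" "transpose \<xi> = - \<xi>"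
proof -
  obtain w \<eta> where A: "A = skew_block w \<eta>" and \<eta>: "transpose \<eta> = - \<eta>"
    by (rule skew_block_of_skew[OF assms(1)])
  obtain z \<zeta> where z: "\<eta> = skew_block z \<zeta>" and \<zeta>: "transpose \<zeta> = - \<zeta>"
    by (rule skew_block_of_skew[OF \<eta>])
  have w: "w = 0"
    using assms(2) unfolding A skew_block_def parity_conj block_eq_iff
    by (simp add: vec_eq_minus_self eq_commute[of "- w"])
  have e: "\<xi> = \<zeta>" "(\<chi> i. A $ Some (Some i) $ Some None) = z"
    unfolding \<xi>_def A skew_block_def z by (simp_all add: vec_eq_iff)
  show "A = even_mat (\<chi> i. A $ Some (Some i) $ Some None) \<xi>"
    unfolding even_mat_def e using A w z by (simp add: skew_block_def)
  show "transpose \<xi> = - \<xi>" using \<zeta> e by simp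
qed

section \<open>Existence and uniqueness of the series \<open>Q\<close>\<close>

lemma Psi_linear: "bounded_linear (Psi :: real ^ 'm::finite \<Rightarrow> _)"
proof -
  have "linear (Psi :: real ^ 'm::finite \<Rightarrow> _)"
    by (rule linearI) (simp_all add: Psi_def even_mat_def skew_block_def block_arith)
  then show ?thesis by (simp add: linear_conv_bounded_linear)
qed

definition psi_smat :: "(real \<Rightarrow> real ^ 'm::finite) \<Rightarrow> 'm option option smat" where
  "psi_smat k = Smat (\<lambda>x. Psi (k x))"

lemma fn_psi_smat: "smooth k \<Longrightarrow> fn (psi_smat k) x = Psi (k x)"
  by (simp add: psi_smat_def fn_Smat smooth_bounded_linear[OF Psi_linear])

definition is_Q_fps :: "(real \<Rightarrow> real ^ 'm::finite) \<Rightarrow> 'm option option smat fps \<Rightarrow> bool" where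
  "is_Q_fps k = sderiv.Q_solution (sconst amat) (psi_smat k)"

lemma sconst_amat_cube: "sconst amat * sconst amat * sconst amat = - sconst amat"
  by (rule smat_eqI) (simp add: amat_cube)

lemma is_Q_fps_unique: "is_Q_fps k p \<Longrightarrow> is_Q_fps k q \<Longrightarrow> p = q"
  unfolding is_Q_fps_def by (rule sderiv.Q_solution_unique[OF sconst_amat_cube])

lemma lax_equation_coeffs: 
  assumes "smooth k"
  shows "fps_X * sderiv.DD q = q * sderiv.lax (sconst amat) (psi_smat k) - sderiv.lax (sconst amat) (psi_smat k) * q
    \<longleftrightarrow> (\<forall>x. commutator amat (fn (fps_nth q 0) x) = 0) \<and>
     (\<forall>n x. vector_derivative (fn (fps_nth q n)) (at x) +
        commutator amat (fn (fps_nth q (Suc n)) x) + commutator (Psi (k x)) (fn (fps_nth q n) x) = 0)"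
    (is "?l = ?r \<longleftrightarrow> ?A \<and> ?B")
proof -
  let ?a = "sconst amat" and ?u = "psi_smat k"
  have "?r = q * fps_const ?a + fps_X * (q * fps_const ?u) - (fps_const ?a * q + fps_X * (fps_const ?u * q))"
    unfolding sderiv.lax_def distrib_left distrib_right mult.assoc fps_X_left_commute[of q] ..
  then have r: "fps_nth ?r n = fps_nth q n * ?a - ?a * fps_nth q n +
     (if n = 0 then 0 else fps_nth q (n - 1) * ?u - ?u * fps_nth q (n - 1))" for n
    by simp
  have zero: "fps_nth ?l 0 = fps_nth ?r 0 \<longleftrightarrow> ?A"
    unfolding r by (auto simp: commutator_def fn_inject[symmetric] fun_eq_iff)
  have suc: "fps_nth ?l (Suc n) = fps_nth ?r (Suc n) \<longleftrightarrow> (\<forall>x. vector_derivative (fn (fps_nth q n)) (at x) +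
        commutator amat (fn (fps_nth q (Suc n)) x) + commutator (Psi (k x)) (fn (fps_nth q n) x) = 0)" for n
    unfolding r fn_inject[symmetric] fun_eq_iff
    by (simp add: fn_sderiv fn_psi_smat[OF assms] commutator_def algebra_simps)
  have "?l = ?r \<longleftrightarrow> (\<forall>n. fps_nth ?l n = fps_nth ?r n)" by (simp add: fps_eq_iff)
  also have "\<dots> \<longleftrightarrow> (fps_nth ?l 0 = fps_nth ?r 0) \<and> (\<forall>n. fps_nth ?l (Suc n) = fps_nth ?r (Suc n))"
    by (metis not0_implies_Suc)
  finally show ?thesis unfolding zero suc .
qed

text \<open>Passing to \<open>q^3 = -q\<close> removes the pointwise matrix \<open>M\<close>, so the
  equation can be checked at each \<open>x\<close> separately.\<close>

lemma is_Q_series_fps: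
  assumes k: "smooth k" and F: "is_Q_series k F"
  obtains q where "is_Q_fps k q" "\<And>x. F x = mat fls_X_inv ** ser x q"
proof -
  \<comment> \<open>Index shift by one: coefficient \<open>n\<close> of \<open>q\<close> is
    \<open>Q_(n-1)\<close>.\<close>
  define q where "q = Abs_fps (\<lambda>n. Smat (\<lambda>x. coeff_mat (F x) (int n - 1)))"
  have sm: "smooth (\<lambda>x. coeff_mat (F x) m)" and low: "m < -1 \<Longrightarrow> coeff_mat (F x) m = 0"
    and lead: "coeff_mat (F x) (-1) = amat"
    and zc: "vector_derivative (\<lambda>x'. coeff_mat (F x') m) (at x) +
            coeff_mat (commutator (a_lambda + fls_mat (Psi (k x))) (F x)) m = 0" for m x
    using F by (simp_all add: is_Q_series_def)
  have qn: "fn (fps_nth q n) = (\<lambda>x. coeff_mat (F x) (int n - 1))" for n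
    by (simp add: q_def fn_Smat sm)
  have Fq: "F x = mat fls_X_inv ** ser x q" for x
    by (rule coeff_mat_eqI) (auto simp: coeff_mat_X_inv coeff_mat_ser qn low)
  have q0: "fps_nth q 0 = sconst amat"
    by (rule smat_eqI) (simp add: qn lead)
  have lin: "fps_X * sderiv.DD q = q * sderiv.lax (sconst amat) (psi_smat k) - sderiv.lax (sconst amat) (psi_smat k) * q"
    unfolding lax_equation_coeffs[OF k]
  proof (intro conjI allI)
    show "commutator amat (fn (fps_nth q 0) x) = 0" for x by (simp add: q0 commutator_def)
    show "vector_derivative (fn (fps_nth q n)) (at x) + commutator amat (fn (fps_nth q (Suc n)) x) +
        commutator (Psi (k x)) (fn (fps_nth q n) x) = 0" for n x
      using zc[of "int n - 1" x] by (simp add: qn coeff_mat_lax add.assoc)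
  qed
  have "ser x (q * q * q) = ser x (- q)" for x
  proof -
    obtain M :: "real fls ^ 'a option option ^ 'a option option" where M: "invertible M" "F x = M ** a_lambda ** matrix_inv M"
      using F unfolding is_Q_series_def by blast
    define L :: "real fls ^ 'a option option ^ 'a option option" where "L = mat fls_X_inv"
    define A :: "real fls ^ 'a option option ^ 'a option option" where "A = fls_mat amat"
    define N where "N = matrix_inv M"
    have NM: "N ** M = mat 1" using M(1) unfolding N_def invertible_def by (metis matrix_inv_eqI)
    have "ser x (fps_const (sconst amat) * fps_const (sconst amat) * fps_const (sconst amat)) =
        ser x (- fps_const (sconst amat))"
      by (simp add: sconst_amat_cube)
    then have A3: "A ** (A ** A) = - A"
      unfolding ser_mult ser_minus by (simp add: ser_const A_def matrix_mul_assoc)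
    have L: "L ** G = G ** L" for G unfolding L_def by (rule mat_X_inv_commute)
    \<comment> \<open>\<open>\<lambda>\<close> can be cancelled because multiplication by it only
      shifts coefficients.\<close>
    have inj: "G = H" if "L ** G = L ** H" for G H
    proof (rule coeff_mat_eqI)
      fix m show "coeff_mat G m = coeff_mat H m"
        using arg_cong[OF that, of "\<lambda>B. coeff_mat B (m - 1)"] by (simp add: L_def coeff_mat_X_inv)
    qed
    have "L ** ser x q = L ** (M ** A ** N)"
      using Fq[of x] M(2) L[of M] by (simp add: a_lambda_def N_def L_def A_def matrix_mul_assoc)
    then have q: "ser x q = M ** A ** N" by (rule inj)
    have "ser x (q * q * q) = M ** A ** (N ** M) ** A ** (N ** M) ** A ** N"
      by (simp only: ser_mult q matrix_mul_assoc)
    also have "\<dots> = M ** (A ** (A ** A)) ** N" by (simp add: NM matrix_mul_assoc)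
    also have "\<dots> = ser x (- q)" by (simp add: A3 ser_minus q matrix_minus_left matrix_minus_right)
    finally show ?thesis .
  qed
  then have "q * q * q = - q" by (rule ser_eqI)
  then have "is_Q_fps k q" using q0 lin by (simp add: is_Q_fps_def sderiv.Q_solution_def)
  then show ?thesis using that Fq by blast
qed

section \<open>Symmetries of \<open>Q\<close> under transposition and parity\<close>

lemma bounded_linear_transpose: "bounded_linear (transpose :: real ^ 'n ^ 'n \<Rightarrow> _)"
  unfolding linear_conv_bounded_linear[symmetric]
  by (rule linearI) (simp_all add: transpose_def vec_eq_iff)

lift_definition stranspose :: "'n::finite smat \<Rightarrow> 'n smat" is "\<lambda>f x. transpose (f x)"
  by (rule smooth_bounded_linear[OF bounded_linear_transpose])

lemma fn_stranspose [simp]: "fn (stranspose f) x = transpose (fn f x)"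
  by transfer simp

text \<open>Transposition reverses products, and \<open>a\<close> and \<open>u\<close> are skew;
  hence the negative transpose of \<open>q\<close> solves the same equations and equals
  \<open>q\<close> by uniqueness.\<close>

lemma is_Q_fps_transpose:
  assumes k: "smooth k" and q: "is_Q_fps k q"
  shows "transpose (fn (fps_nth q n) x) = - fn (fps_nth q n) x"
proof -
  define \<tau> :: "'a option option smat fps \<Rightarrow> 'a option option smat fps"
    where "\<tau> q = Abs_fps (\<lambda>n. stranspose (fps_nth q n))" for q
  have \<tau>: "fn (fps_nth (\<tau> q) n) = (\<lambda>x. transpose (fn (fps_nth q n) x))" for q n
    by (simp add: \<tau>_def fun_eq_iff)
  have mult: "\<tau> (p * q) = \<tau> q * \<tau> p" for p q
  proof (rule fps_ext, rule smat_eqI)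
    fix n x
    have "fn (fps_nth (\<tau> (p * q)) n) x = (\<Sum>i=0..n. transpose (fn (fps_nth p i) x ** fn (fps_nth q (n - i)) x))"
      by (simp add: \<tau> fps_mult_nth fn_sum linear_sum[OF bounded_linear.linear[OF bounded_linear_transpose]])
    also have "\<dots> = (\<Sum>i=0..n. transpose (fn (fps_nth q i) x) ** transpose (fn (fps_nth p (n - i)) x))"
      by (subst sum.atLeastAtMost_rev) (simp add: matrix_transpose_mul)
    finally show "fn (fps_nth (\<tau> (p * q)) n) x = fn (fps_nth (\<tau> q * \<tau> p) n) x"
      by (simp add: \<tau> fps_mult_nth fn_sum)
  qed
  have neg: "\<tau> (- q) = - \<tau> q" for q
    by (rule fps_ext, rule smat_eqI) (simp add: \<tau> transpose_minus)
  have q0: "fps_nth q 0 = sconst amat" and qqq: "q * q * q = - q"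
    and lin: "fps_X * sderiv.DD q = q * sderiv.lax (sconst amat) (psi_smat k) - sderiv.lax (sconst amat) (psi_smat k) * q"
    using q by (auto simp: is_Q_fps_def sderiv.Q_solution_def)
  have "is_Q_fps k (- \<tau> q)"
    unfolding is_Q_fps_def sderiv.Q_solution_def
  proof (intro conjI)
    show "fps_nth (- \<tau> q) 0 = sconst amat"
      by (rule smat_eqI) (simp add: \<tau> q0 transpose_amat)
    have "\<tau> q * (\<tau> q * \<tau> q) = - \<tau> q"
      by (metis mult neg qqq)
    then show "- \<tau> q * - \<tau> q * - \<tau> q = - (- \<tau> q)"
      by (simp add: mult.assoc)
    show "fps_X * sderiv.DD (- \<tau> q) = - \<tau> q * sderiv.lax (sconst amat) (psi_smat k) - sderiv.lax (sconst amat) (psi_smat k) * - \<tau> q"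
      unfolding lax_equation_coeffs[OF k]
    proof (intro conjI allI)
      fix n x
      show "commutator amat (fn (fps_nth (- \<tau> q) 0) x) = 0"
        by (simp add: \<tau> q0 transpose_amat commutator_def)
      have "vector_derivative (fn (fps_nth (- \<tau> q) n)) (at x) =
          - transpose (vector_derivative (fn (fps_nth q n)) (at x))"
      proof (rule vector_derivative_at)
        have "fn (fps_nth (- \<tau> q) n) = (\<lambda>x. - transpose (fn (fps_nth q n) x))"
          by (simp add: \<tau> fun_eq_iff)
        then show "(fn (fps_nth (- \<tau> q) n) has_vector_derivative
            - transpose (vector_derivative (fn (fps_nth q n)) (at x))) (at x)"
          by (auto intro!: has_vector_derivative_minus bounded_linear.has_vector_derivative[OF bounded_linear_transpose]
              smooth_has_vector_derivative smooth_fn)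
      qed
      moreover have "- transpose (vector_derivative (fn (fps_nth q n)) (at x) +
        commutator amat (fn (fps_nth q (Suc n)) x) + commutator (Psi (k x)) (fn (fps_nth q n) x)) = 0"
        using lin unfolding lax_equation_coeffs[OF k] by (simp add: transpose_def zero_vec_def)
      ultimately show "vector_derivative (fn (fps_nth (- \<tau> q) n)) (at x) +
        commutator amat (fn (fps_nth (- \<tau> q) (Suc n)) x) + commutator (Psi (k x)) (fn (fps_nth (- \<tau> q) n) x) = 0"
        by (simp add: \<tau> transpose_add commutator_def transpose_diff matrix_transpose_mul matrix_distribs
            transpose_amat transpose_Psi algebra_simps)
    qed
  qed
  from is_Q_fps_unique[OF this q] have "fn (fps_nth (- \<tau> q) n) x = fn (fps_nth q n) x" by simp
  then have "- transpose (fn (fps_nth q n) x) = fn (fps_nth q n) x" by (simp add: \<tau>)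
  then show ?thesis by (metis minus_minus)
qed


text \<open>Conjugation by \<open>parity\<close> together with
  \<open>\<lambda> \<mapsto> -\<lambda>\<close> preserves \<open>a \<lambda> + u\<close>, hence
  \<open>Q\<close>. The exponent is \<open>Suc n\<close> because \<open>q = \<lambda>^-1 Q\<close>
  picks up one more sign.\<close>

lemma is_Q_fps_parity:
  assumes k: "smooth k" and q: "is_Q_fps k q"
  shows "parity ** fn (fps_nth q n) x ** parity = (-1) ^ Suc n *\<^sub>R fn (fps_nth q n) x"
proof -
  let ?P = "parity :: real ^ 'a option option ^ 'a option option"
  define \<sigma> :: "'a option option smat fps \<Rightarrow> 'a option option smat fps"
    where "\<sigma> q = Abs_fps (\<lambda>n. (-1) ^ n *\<^sub>R (sconst ?P * fps_nth q n * sconst ?P))" for q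
  have \<sigma>: "fn (fps_nth (\<sigma> q) n) = (\<lambda>x. (-1) ^ n *\<^sub>R (?P ** fn (fps_nth q n) x ** ?P))" for q n
    by (simp add: \<sigma>_def fun_eq_iff)
  have PP: "?P ** (?P ** A) = A" for A :: "real ^ 'a option option ^ 'a option option"
    by (simp add: matrix_mul_assoc parity_sq)
  have conj: "?P ** (A ** B) ** ?P = (?P ** A ** ?P) ** (?P ** B ** ?P)" for A B
    by (simp add: PP flip: matrix_mul_assoc)
  have mult: "\<sigma> (p * q) = \<sigma> p * \<sigma> q" for p q
  proof (rule fps_ext, rule smat_eqI)
    fix n x
    have "bounded_linear (\<lambda>A. (-1) ^ n *\<^sub>R (?P ** A ** ?P))"
      by (subst linear_conv_bounded_linear[symmetric])
        (rule linearI, simp_all add: matrix_distribs algebra_simps)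
    then have lin: "linear (\<lambda>A. (-1) ^ n *\<^sub>R (?P ** A ** ?P))" by (rule bounded_linear.linear)
    have pow: "(-1) ^ n = (-1 :: real) ^ (n - i) * (-1) ^ i" if "i \<in> {0..n}" for i
      using that by (simp flip: power_add)
    have "fn (fps_nth (\<sigma> (p * q)) n) x = (\<Sum>i=0..n. (-1) ^ n *\<^sub>R (?P ** (fn (fps_nth p i) x ** fn (fps_nth q (n - i)) x) ** ?P))"
      by (simp only: \<sigma> fps_mult_nth fn_sum linear_sum[OF lin] fn_simps)
    also have "\<dots> = (\<Sum>i=0..n. fn (fps_nth (\<sigma> p) i) x ** fn (fps_nth (\<sigma> q) (n - i)) x)"
      by (rule sum.cong[OF refl]) (simp only: \<sigma> conj pow matrix_scaleR_left matrix_scaleR_right scaleR_scaleR)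
    finally show "fn (fps_nth (\<sigma> (p * q)) n) x = fn (fps_nth (\<sigma> p * \<sigma> q) n) x"
      by (simp add: fps_mult_nth fn_sum)
  qed
  have neg: "\<sigma> (- q) = - \<sigma> q" for q
    by (rule fps_ext, rule smat_eqI) (simp add: \<sigma> matrix_distribs)
  have q0: "fps_nth q 0 = sconst amat" and qqq: "q * q * q = - q"
    and lin: "fps_X * sderiv.DD q = q * sderiv.lax (sconst amat) (psi_smat k) - sderiv.lax (sconst amat) (psi_smat k) * q"
    using q by (auto simp: is_Q_fps_def sderiv.Q_solution_def)
  have comm: "?P ** commutator amat A ** ?P = - commutator amat (?P ** A ** ?P)"
    "?P ** commutator (Psi u) A ** ?P = commutator (Psi u) (?P ** A ** ?P)"
    for A :: "real ^ 'a option option ^ 'a option option" and u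
    unfolding commutator_def matrix_diff_ldistrib matrix_diff_rdistrib conj parity_conj_amat parity_conj_Psi
    by (simp_all add: matrix_distribs)
  have "is_Q_fps k (- \<sigma> q)"
    unfolding is_Q_fps_def sderiv.Q_solution_def
  proof (intro conjI)
    show "fps_nth (- \<sigma> q) 0 = sconst amat"
      by (rule smat_eqI) (simp add: \<sigma> q0 parity_conj_amat)
    have "\<sigma> q * \<sigma> q * \<sigma> q = - \<sigma> q"
      by (metis mult neg qqq)
    then show "- \<sigma> q * - \<sigma> q * - \<sigma> q = - (- \<sigma> q)"
      by simp
    show "fps_X * sderiv.DD (- \<sigma> q) = - \<sigma> q * sderiv.lax (sconst amat) (psi_smat k) - sderiv.lax (sconst amat) (psi_smat k) * - \<sigma> q"
      unfolding lax_equation_coeffs[OF k]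
    proof (intro conjI allI)
      fix n x
      show "commutator amat (fn (fps_nth (- \<sigma> q) 0) x) = 0"
        by (simp add: \<sigma> q0 parity_conj_amat commutator_def)
      define D0 A0 B0 where "D0 = vector_derivative (fn (fps_nth q n)) (at x)" and
        "A0 = fn (fps_nth q (Suc n)) x" and "B0 = fn (fps_nth q n) x"
      have "vector_derivative (fn (fps_nth (- \<sigma> q) n)) (at x) = - ((-1) ^ n *\<^sub>R (?P ** D0 ** ?P))"
      proof (rule vector_derivative_at)
        have "fn (fps_nth (- \<sigma> q) n) = (\<lambda>x. - ((-1) ^ n *\<^sub>R (?P ** fn (fps_nth q n) x ** ?P)))"
          by (simp add: \<sigma> fun_eq_iff)
        moreover have "bounded_linear (\<lambda>A. - ((-1) ^ n *\<^sub>R (?P ** A ** ?P)))"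
          by (subst linear_conv_bounded_linear[symmetric])
            (rule linearI, simp_all add: matrix_distribs algebra_simps)
        ultimately show "(fn (fps_nth (- \<sigma> q) n) has_vector_derivative - ((-1) ^ n *\<^sub>R (?P ** D0 ** ?P))) (at x)"
          unfolding D0_def by (simp only:)
            (rule bounded_linear.has_vector_derivative, assumption, rule smooth_has_vector_derivative, rule smooth_fn)
      qed
      moreover have "?P ** (D0 + commutator amat A0 + commutator (Psi (k x)) B0) ** ?P = 0"
        using lin unfolding lax_equation_coeffs[OF k] D0_def A0_def B0_def by simp
      then have "?P ** D0 ** ?P - commutator amat (?P ** A0 ** ?P) + commutator (Psi (k x)) (?P ** B0 ** ?P) = 0"
        unfolding matrix_add_ldistrib matrix_add_rdistrib comm by simp
      then have "(- ((-1) ^ n)) *\<^sub>R (?P ** D0 ** ?P - commutator amat (?P ** A0 ** ?P) + commutator (Psi (k x)) (?P ** B0 ** ?P)) = 0"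
        by simp
      ultimately show "vector_derivative (fn (fps_nth (- \<sigma> q) n)) (at x) +
        commutator amat (fn (fps_nth (- \<sigma> q) (Suc n)) x) + commutator (Psi (k x)) (fn (fps_nth (- \<sigma> q) n) x) = 0"
        by (simp add: \<sigma> A0_def B0_def commutator_def matrix_distribs algebra_simps)
    qed
  qed
  from is_Q_fps_unique[OF this q] have "fn (fps_nth (- \<sigma> q) n) x = fn (fps_nth q n) x" by simp
  then have "(-1) ^ n *\<^sub>R (?P ** fn (fps_nth q n) x ** ?P) = - fn (fps_nth q n) x"
    by (simp add: \<sigma> minus_equation_iff)
  from arg_cong[OF this, of "\<lambda>A. (-1) ^ n *\<^sub>R A"] show ?thesis
    by (simp flip: power_mult_distrib)
qed

text \<open>The even index \<open>2 * i\<close> of \<open>q\<close> carries the odd coefficient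
  \<open>Q_(2i-1)\<close>.\<close>

lemma is_Q_fps_odd:
  assumes "smooth k" "is_Q_fps k q"
  obtains w where "fn (fps_nth q (2 * i)) x = skew_block w 0"
proof -
  define A where "A = fn (fps_nth q (2 * i)) x"
  have "A = odd_mat (A $ Some None $ None) (\<chi> i. A $ Some (Some i) $ None)"
    using is_Q_fps_parity[OF assms, of "2 * i" x] is_Q_fps_transpose[OF assms, of "2 * i" x]
    by (intro odd_mat_of_parity) (simp_all add: A_def)
  then show ?thesis using that unfolding A_def odd_mat_def by blast
qed

lemma is_Q_series_of_fps:
  assumes k: "smooth k" and q: "is_Q_fps k q"
    and M: "M * N = 1" "N * M = 1" "q = M * fps_const (sconst amat) * N"
  shows "is_Q_series k (\<lambda>x. mat fls_X_inv ** ser x q)"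
  unfolding is_Q_series_def
proof (intro conjI allI impI)
  let ?F = "\<lambda>x. mat fls_X_inv ** ser x q"
  have cf: "coeff_mat (?F x) m = (if m < -1 then 0 else fn (fps_nth q (nat (m + 1))) x)" for x m
    by (auto simp: coeff_mat_X_inv coeff_mat_ser)
  show "smooth (\<lambda>x. coeff_mat (?F x) m)" for m
    by (cases "m < -1") (simp_all add: cf smooth_fn)
  show "m < -1 \<Longrightarrow> coeff_mat (?F x) m = 0" for x m by (simp add: cf)
  show "coeff_mat (?F x) (-1) = amat" for x
    using q by (simp add: cf is_Q_fps_def sderiv.Q_solution_def)
  note par = is_Q_fps_parity[OF k q] and tr = is_Q_fps_transpose[OF k q]
  show "\<exists>y \<eta>. coeff_mat (?F x) (2 * i - 1) = odd_mat y \<eta>" if "i \<ge> 1" for x i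
  proof -
    have "nat (2 * i - 1 + 1) = 2 * nat i" using that by simp
    then show ?thesis
      using that odd_mat_of_parity[OF tr, of "2 * nat i" x] par[of "2 * nat i" x] 
      by (auto simp: cf)
  qed
  show "\<exists>z \<xi>. transpose \<xi> = - \<xi> \<and> coeff_mat (?F x) (2 * i) = even_mat z \<xi>" if "i \<ge> 0" for x i
  proof -
    have "nat (2 * i + 1) = Suc (2 * nat i)" using that by simp
    then show ?thesis
      using that even_mat_of_parity[OF tr, of "Suc (2 * nat i)" x] par[of "Suc (2 * nat i)" x] 
      by (auto simp: cf)
  qed
  have lin: "fps_X * sderiv.DD q = q * sderiv.lax (sconst amat) (psi_smat k) - sderiv.lax (sconst amat) (psi_smat k) * q"
    using q by (auto simp: is_Q_fps_def sderiv.Q_solution_def)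
  show "vector_derivative (\<lambda>x'. coeff_mat (?F x') m) (at x) +
            coeff_mat (commutator (a_lambda + fls_mat (Psi (k x))) (?F x)) m = 0" for x m
  proof -
    \<comment> \<open>At \<open>m = -2\<close> only the commutator of the leading coefficient with
      \<open>a\<close> is left; below that every term is zero.\<close>
    consider "m < -2" | "m = -2" | "m \<ge> -1" by linarith
    then show ?thesis
    proof cases
      case 1
      then show ?thesis unfolding coeff_mat_lax cf by (simp add: commutator_def)
    next
      case 2
      then show ?thesis using lin unfolding lax_equation_coeffs[OF k]
        by (simp add: coeff_mat_lax cf) (simp add: commutator_def)
    next
      case 3
      then obtain n where n: "m = int n - 1" by (metis add.commute diff_add_cancel nonneg_int_cases
          uminus_add_conv_diff diff_ge_0_iff_ge diff_minus_eq_add)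
      show ?thesis using lin unfolding lax_equation_coeffs[OF k] n
        by (simp add: coeff_mat_lax cf add.assoc nat_add_distrib)
    qed
  qed
  show "\<exists>M :: real fls ^ 'a option option ^ 'a option option. invertible M \<and> ?F x = M ** a_lambda ** matrix_inv M" for x
  proof (intro exI conjI)
    have MN: "ser x M ** ser x N = mat 1" "ser x N ** ser x M = mat 1"
      using M(1,2) by (metis ser_mult ser_1)+
    then show "invertible (ser x M)" unfolding invertible_def by blast
    have "ser x q = ser x M ** fls_mat amat ** ser x N"
      using M(3) by (simp add: ser_mult ser_const)
    then show "?F x = ser x M ** a_lambda ** matrix_inv (ser x M)"
      unfolding matrix_inv_eqI[OF MN] a_lambda_def
      by (metis mat_X_inv_commute matrix_mul_assoc)
  qed
qed

text \<open>Resolves the definite description behind \<open>Q_series\<close>; all later statements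
  on coefficients go through this \<open>q\<close>.\<close>

lemma Q_series_fps:
  assumes k: "smooth k"
  obtains q where "is_Q_fps k q" "is_Q_series k (Q_series k)"
    "\<And>m x. Qc m k x = (if m < -1 then 0 else fn (fps_nth q (nat (m + 1))) x)"
proof -
  obtain q M N where q: "is_Q_fps k q" and M: "M * N = 1" "N * M = 1" "q = M * fps_const (sconst amat) * N"
    using sderiv.Q_solution_exists[OF sconst_amat_cube sderiv_sconst] unfolding is_Q_fps_def by metis
  define F where "F = (\<lambda>x. mat fls_X_inv ** ser x q)"
  have F: "is_Q_series k F" unfolding F_def by (rule is_Q_series_of_fps[OF k q M])
  have "G = F" if G: "is_Q_series k G" for G
  proof
    fix x
    obtain p where p: "is_Q_fps k p" and "\<And>x. G x = mat fls_X_inv ** ser x p"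
      by (rule is_Q_series_fps[OF k G]) blast
    then show "G x = F x" using is_Q_fps_unique[OF p q] by (simp add: F_def)
  qed
  then have "Q_series k = F" unfolding Q_series_def using F by (intro the_equality)
  then show ?thesis using that[OF q] F
    by (auto simp: Qc_def F_def coeff_mat_X_inv coeff_mat_ser)
qed

section \<open>Relations between the coefficients of two series\<close>

text \<open>The pair \<open>(y, \<eta>)\<close> of \<open>Q_(2i-1)\<close> as one vector: the
  velocity of the flow is \<open>g\<close> applied to \<open>wc (j - 1)\<close>.\<close>

definition wc :: "nat \<Rightarrow> (real \<Rightarrow> real ^ 'm::finite) \<Rightarrow> real \<Rightarrow> real ^ 'm option" where
  "wc i k x = vcons (yc (2 * int i - 1) k x) (etac (2 * int i - 1) k x)"

text \<open>The nonzero block of \<open>Q_(2i)\<close>; for \<open>i = j - 1\<close> it is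
  \<open>g^-1 g_t\<close>.\<close>

definition Kc :: "nat \<Rightarrow> (real \<Rightarrow> real ^ 'm::finite) \<Rightarrow> real \<Rightarrow> real ^ 'm option ^ 'm option" where
  "Kc i k x = skew_block (zc (2 * int i) k x) (xic (2 * int i) k x)"

lemma fn_Q_fps:
  assumes k: "smooth k" and q: "is_Q_fps k q"
  shows "fn (fps_nth q n) x = Qc (int n - 1) k x"
proof -
  obtain p where p: "is_Q_fps k p" "\<And>m x. Qc m k x = (if m < -1 then 0 else fn (fps_nth p (nat (m + 1))) x)"
    by (rule Q_series_fps[OF k]) blast
  then show ?thesis using is_Q_fps_unique[OF p(1) q] by simp
qed

lemma Qc_odd:
  assumes "smooth k"
  shows "Qc (2 * int i - 1) k x = skew_block (wc i k x) 0"
proof -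
  obtain q where q: "is_Q_fps k q" by (rule Q_series_fps[OF assms])
  obtain w where "fn (fps_nth q (2 * i)) x = skew_block w 0" by (rule is_Q_fps_odd[OF assms q])
  then have w: "Qc (2 * int i - 1) k x = skew_block w 0"
    using fn_Q_fps[OF assms q, of "2 * i" x] by simp
  then have "wc i k x = w"
    by (simp add: wc_def yc_def etac_def vec_option_eq_iff skew_block_def)
  then show ?thesis using w by simp
qed

lemma Qc_even:
  assumes "smooth k"
  shows "Qc (2 * int i) k x = block 0 0 0 (Kc i k x)" and "transpose (Kc i k x) = - Kc i k x"
proof -
  obtain q where q: "is_Q_fps k q" by (rule Q_series_fps[OF assms])
  have Q: "Qc (2 * int i) k x = fn (fps_nth q (Suc (2 * i))) x"
    using fn_Q_fps[OF assms q, of "Suc (2 * i)" x] by simp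
  have "parity ** Qc (2 * int i) k x ** parity = Qc (2 * int i) k x"
    using is_Q_fps_parity[OF assms q, of "Suc (2 * i)" x] by (simp add: Q)
  note * = even_mat_of_parity[OF is_Q_fps_transpose[OF assms q, of "Suc (2 * i)" x, folded Q] this]
  show "Qc (2 * int i) k x = block 0 0 0 (Kc i k x)"
    using *(1) by (simp add: even_mat_def Kc_def zc_def xic_def)
  show "transpose (Kc i k x) = - Kc i k x"
    unfolding Kc_def by (rule transpose_skew_block) (use *(2) in \<open>simp add: xic_def\<close>)
qed

lemma Qc_minus_1: "smooth k \<Longrightarrow> Qc (-1) k x = amat"
proof -
  assume k: "smooth k"
  obtain q where q: "is_Q_fps k q" by (rule Q_series_fps[OF k])
  then show ?thesis
    using fn_Q_fps[OF k q, of 0 x] by (simp add: is_Q_fps_def sderiv.Q_solution_def)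
qed

lemma skew_block_inj: "skew_block v \<xi> = skew_block w \<eta> \<longleftrightarrow> v = w \<and> \<xi> = \<eta>"
  by (auto simp: skew_block_def block_eq_iff)

lemma wc_0: "smooth k \<Longrightarrow> wc 0 k x = axis None 1"
  using Qc_odd[of k 0 x] by (simp add: Qc_minus_1 amat_skew skew_block_inj)

lemma refl_mat_mult_vec: "refl_mat c *v w = w - (2 * (c \<bullet> w)) *\<^sub>R c"
  by (simp add: refl_mat_outer matrix_vector_mult_diff_rdistrib outer_mult_vec 
      scaleR_matrix_vector_assoc[symmetric])

lemma bounded_linear_skew_block: "bounded_linear (\<lambda>w :: real ^ 'm::finite. skew_block w 0)"
  unfolding linear_conv_bounded_linear[symmetric]
  by (rule linearI) (simp_all add: skew_block_def block_arith)

text \<open>The assumed equation for \<open>c\<close> is the Riccati equation that makes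
  \<open>dressing s J\<close> intertwine the two series. The relation is the first column of
  coefficient \<open>2 i + 2\<close>; the even coefficient of \<open>k'\<close> is multiplied by
  \<open>J\<close> from the left and enters only the first row.\<close>

lemma Qc_dressing:
  fixes k :: "real \<Rightarrow> real ^ 'm::finite" and c :: "real \<Rightarrow> real ^ 'm option"
  assumes k: "smooth k" and c: "smooth c" and norm: "\<And>x. norm (c x) = 1"
    and c': "\<And>x. (c has_vector_derivative
        s *\<^sub>R (axis None 1 - (c x $ None) *\<^sub>R c x) - skew_block (k x) 0 *v c x) (at x)"
  defines "k' \<equiv> \<lambda>x. k x + (2 * s) *\<^sub>R vtail (c x)"
  shows "smooth k'"
    and "wc (Suc i) k x - wc (Suc i) k' x =
      s\<^sup>2 *\<^sub>R (wc i k x + refl_mat (c x) *v wc i k' x) - (2 * s) *\<^sub>R (Kc i k x *v c x)"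
proof -
  have vtail: "bounded_linear (vtail :: real ^ 'm option \<Rightarrow> _)"
    unfolding linear_conv_bounded_linear[symmetric]
    by (rule linearI) (simp_all add: vtail_def vec_eq_iff)
  show k': "smooth k'"
    unfolding k'_def by (intro smooth_add k smooth_scaleR smooth_const smooth_bounded_linear[OF vtail] c)
  have sJ: "smooth (\<lambda>x. skew_block (c x) 0)"
    by (rule smooth_bounded_linear[OF bounded_linear_skew_block c])
  define J where "J = Smat (\<lambda>x. skew_block (c x) 0)"
  have J: "fn J = (\<lambda>x. skew_block (c x) 0)" by (simp add: J_def fn_Smat sJ)
  let ?a = "sconst amat" and ?e = "axis None 1 :: real ^ 'm option"
  have amat: "amat = skew_block ?e 0" by (rule amat_skew)
  have DJ: "sderiv J = J * psi_smat k - psi_smat k * J + s *\<^sub>R (?a + J * (?a * J))"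
  proof (rule smat_eqI)
    fix x
    let ?c' = "s *\<^sub>R (?e - (c x $ None) *\<^sub>R c x) - skew_block (k x) 0 *v c x"
    have T: "transpose (skew_block (k x) 0) = - skew_block (k x) 0"
      by (rule transpose_skew_block) (simp add: transpose_def vec_eq_iff)
    have "((\<lambda>x. skew_block (c x) 0) has_vector_derivative skew_block ?c' 0) (at x)"
      by (rule bounded_linear.has_vector_derivative[OF bounded_linear_skew_block c'])
    then have "fn (sderiv J) x = skew_block ?c' 0"
      unfolding fn_sderiv J by (rule vector_derivative_at)
    also have "\<dots> = fn (J * psi_smat k - psi_smat k * J + s *\<^sub>R (?a + J * (?a * J))) x"
      by (simp add: J fn_psi_smat[OF k] amat skew_block_triple Psi_def even_mat_def inner_axis)
        (simp add: skew_block_0[of "c x"] skew_block_0[of "axis None 1"] skew_block_0[of "v - w" for v w] block_mult block_arith block_eq_iff T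
          matrix_minus_vec matrix_vec_minus algebra_simps del: transpose_matrix_vector)
    finally show "fn (sderiv J) x = fn (J * psi_smat k - psi_smat k * J + s *\<^sub>R (?a + J * (?a * J))) x" .
  qed
  have u': "psi_smat k' = psi_smat k - (2 * s) *\<^sub>R (J * ?a - ?a * J)"
  proof (rule smat_eqI)
    fix x
    have "skew_block (k' x) 0 = skew_block (k x) 0 + (2 * s) *\<^sub>R (outer (c x) ?e - outer ?e (c x))"
      by (simp add: k'_def skew_block_def vec_option_eq_iff outer_def axis_def vtail_def)
    then show "fn (psi_smat k') x = fn (psi_smat k - (2 * s) *\<^sub>R (J * ?a - ?a * J)) x"
      by (simp add: J fn_psi_smat[OF k] fn_psi_smat[OF k'] amat Psi_def even_mat_def)
        (simp add: skew_block_0 block_mult block_arith block_eq_iff inner_commute outer_minus algebra_simps)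
  qed
  obtain q where q: "is_Q_fps k q" by (rule Q_series_fps[OF k])
  obtain p where p: "is_Q_fps k' p" by (rule Q_series_fps[OF k'])
  have "q * sderiv.dressing s J = sderiv.dressing s J * p"
  proof (rule sderiv.dressing_intertwines[OF sconst_amat_cube])
    show "sderiv.Q_solution ?a (psi_smat k') p" "sderiv.Q_solution ?a (psi_smat k) q"
      using p q by (simp_all add: is_Q_fps_def)
    show "J * (J * J) = - J"
      by (rule smat_eqI) (simp add: J skew_block_cube[OF norm])
    show "?a + J * (J * ?a) + ?a * (J * J) = J * (?a * J)" "J * (?a * (J * J)) = J * (J * (?a * J))"
      by (rule smat_eqI; simp add: J amat skew_block_dressing[OF norm])+
  qed (rule DJ, rule u')
  note eq = arg_cong[OF this, of "\<lambda>f. fn (fps_nth f (Suc (Suc (2 * i)))) x"]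
  have Qn: "fn (fps_nth q (Suc (Suc (2 * i)))) x = skew_block (wc (Suc i) k x) 0"
    "fn (fps_nth q (Suc (2 * i))) x = block 0 0 0 (Kc i k x)"
    "fn (fps_nth q (2 * i)) x = skew_block (wc i k x) 0"
    using Qc_odd[OF k, of "Suc i" x] Qc_odd[OF k, of i x] Qc_even(1)[OF k, of i x]
    by (simp_all add: fn_Q_fps[OF k q] algebra_simps)
  have Pn: "fn (fps_nth p (Suc (Suc (2 * i)))) x = skew_block (wc (Suc i) k' x) 0"
    "fn (fps_nth p (Suc (2 * i))) x = block 0 0 0 (Kc i k' x)"
    "fn (fps_nth p (2 * i)) x = skew_block (wc i k' x) 0"
    using Qc_odd[OF k', of "Suc i" x] Qc_odd[OF k', of i x] Qc_even(1)[OF k', of i x]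
    by (simp_all add: fn_Q_fps[OF k' p] algebra_simps)
  \<comment> \<open>The quadratic coefficient \<open>1 + 2 J^2\<close> is block diagonal, and this
    is where the reflection in \<open>c\<close> comes from.\<close>
  have JJ: "mat 1 + 2 *\<^sub>R (skew_block (c x) 0 ** skew_block (c x) 0) = block (-1) 0 0 (refl_mat (c x))"
    using norm[of x]
    by (subst block_1[symmetric]) (simp add: skew_block_0 block_mult block_arith block_eq_iff refl_mat_outer norm_eq_1 outer_minus)
  have "skew_block (wc (Suc i) k x) 0 + (2 * s) *\<^sub>R (block 0 0 0 (Kc i k x) ** skew_block (c x) 0) +
       s\<^sup>2 *\<^sub>R (skew_block (wc i k x) 0 ** block (-1) 0 0 (refl_mat (c x))) =
     skew_block (wc (Suc i) k' x) 0 + (2 * s) *\<^sub>R (skew_block (c x) 0 ** block 0 0 0 (Kc i k' x)) +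
       s\<^sup>2 *\<^sub>R (block (-1) 0 0 (refl_mat (c x)) ** skew_block (wc i k' x) 0)"
    using eq unfolding sderiv.dressing_mult_nth sderiv.mult_dressing_nth by (simp add: Qn Pn J JJ)
  \<comment> \<open>Comparison of the lower left blocks.\<close>
  then have "wc (Suc i) k x + (2 * s) *\<^sub>R (Kc i k x *v c x) - s\<^sup>2 *\<^sub>R wc i k x =
    wc (Suc i) k' x + s\<^sup>2 *\<^sub>R (refl_mat (c x) *v wc i k' x)"
    unfolding skew_block_0 block_mult block_arith block_eq_iff by simp
  then show "wc (Suc i) k x - wc (Suc i) k' x =
      s\<^sup>2 *\<^sub>R (wc i k x + refl_mat (c x) *v wc i k' x) - (2 * s) *\<^sub>R (Kc i k x *v c x)"
    by (simp add: algebra_simps)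
qed

lemma skew_quadratic:
  fixes A :: "real ^ 'n ^ 'n"
  assumes "transpose A = - A"
  shows "c \<bullet> (A *v c) = 0"
proof -
  have "c \<bullet> (A *v c) = (transpose A *v c) \<bullet> c" by (simp add: dot_lmul_matrix)
  also have "\<dots> = - (c \<bullet> (A *v c))"
    unfolding assms matrix_minus_vec inner_minus_left by (simp add: inner_commute)
  finally show ?thesis by simp
qed

text \<open>Paired with \<open>c\<close>, the reflection changes a sign and the skew term vanishes,
  so the difference of the two components is multiplied by \<open>s^2\<close> at each step. It
  starts at 0 because both series begin with \<open>a\<close>.\<close>

lemma wc_dressing_inner:
  assumes "smooth k" "smooth k'" "norm c = 1"
    and rel: "\<And>i. wc (Suc i) k x - wc (Suc i) k' x =
      s\<^sup>2 *\<^sub>R (wc i k x + refl_mat c *v wc i k' x) - (2 * s) *\<^sub>R (Kc i k x *v c)"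
  shows "c \<bullet> wc i k x = c \<bullet> wc i k' x"
proof (induction i)
  case 0
  then show ?case using assms(1,2) by (simp add: wc_0)
next
  case (Suc i)
  have "c \<bullet> (wc (Suc i) k x - wc (Suc i) k' x) = s\<^sup>2 * (c \<bullet> wc i k x - c \<bullet> wc i k' x)"
    using assms(3) skew_quadratic[OF Qc_even(2)[OF assms(1)], of c i x] unfolding rel
    by (simp add: refl_mat_mult_vec norm_eq_1 algebra_simps)
  then show ?case using Suc by (simp add: algebra_simps)
qed

text \<open>\<open>H\<close> is the change between two parallel frames with the same first vector.
  Then \<open>diag(1, H)\<close> commutes with \<open>a\<close> and is a gauge transformation
  independent of \<open>\<lambda>\<close>.\<close>

lemma wc_gauge:
  fixes k \<kappa> :: "real \<Rightarrow> real ^ 'm::finite"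
  assumes k: "smooth k" and \<kappa>: "smooth \<kappa>" and H: "smooth H"
    and e: "\<And>x. H x *v axis None 1 = axis None 1" "\<And>x. transpose (H x) *v axis None 1 = axis None 1"
    and H': "\<And>x. (H has_vector_derivative H x ** skew_block (k x) 0 - skew_block (\<kappa> x) 0 ** H x) (at x)"
  shows "wc i \<kappa> x = H x *v wc i k x"
proof -
  have lin: "bounded_linear (\<lambda>A :: real ^ 'm option ^ 'm option. block 0 0 0 A)"
    unfolding linear_conv_bounded_linear[symmetric]
    by (rule linearI) (simp_all add: block_arith)
  have diag: "block 1 0 0 A = block 1 0 0 0 + block 0 0 0 A" for A :: "real ^ 'm option ^ 'm option"
    by (simp add: block_arith)
  have "smooth (\<lambda>x. block 1 0 0 0 + block 0 0 0 (H x))"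
    by (intro smooth_add smooth_const smooth_bounded_linear[OF lin] H)
  then have sD: "smooth (\<lambda>x. block 1 0 0 (H x))" by (subst diag)
  define D where "D = Smat (\<lambda>x. block 1 0 0 (H x))"
  have D: "fn D = (\<lambda>x. block 1 0 0 (H x))" by (simp add: D_def fn_Smat sD)
  have Da: "D * sconst amat = sconst amat * D"
    by (rule smat_eqI) (simp add: D amat_skew skew_block_0 block_mult e matrix_vec_minus block_eq_iff
        del: transpose_matrix_vector)
  have D': "sderiv D = D * psi_smat k - psi_smat \<kappa> * D"
  proof (rule smat_eqI)
    fix x
    let ?H' = "H x ** skew_block (k x) 0 - skew_block (\<kappa> x) 0 ** H x"
    have "((\<lambda>x. block 1 0 0 0 + block 0 0 0 (H x)) has_vector_derivative 0 + block 0 0 0 ?H') (at x)"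
      by (intro has_vector_derivative_add has_vector_derivative_const
          bounded_linear.has_vector_derivative[OF lin H'])
    then have "((\<lambda>x. block 1 0 0 (H x)) has_vector_derivative block 0 0 0 ?H') (at x)"
      by (subst diag) simp
    then have "fn (sderiv D) x = block 0 0 0 ?H'" unfolding fn_sderiv D by (rule vector_derivative_at)
    then show "fn (sderiv D) x = fn (D * psi_smat k - psi_smat \<kappa> * D) x"
      by (simp add: D fn_psi_smat[OF k] fn_psi_smat[OF \<kappa>] Psi_def even_mat_def block_mult block_arith)
  qed
  obtain q where q: "is_Q_fps k q" by (rule Q_series_fps[OF k])
  obtain p where p: "is_Q_fps \<kappa> p" by (rule Q_series_fps[OF \<kappa>])
  have "p * fps_const D = fps_const D * q"
  proof (rule sderiv.Q_solution_intertwine[OF sconst_amat_cube])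
    show "sderiv.Q_solution (sconst amat) (psi_smat \<kappa>) p" "sderiv.Q_solution (sconst amat) (psi_smat k) q"
      using p q by (simp_all add: is_Q_fps_def)
    have "fps_const D * sderiv.lax (sconst amat) (psi_smat k) =
        fps_const (D * sconst amat) + fps_X * fps_const (D * psi_smat k)"
      unfolding sderiv.lax_def distrib_left fps_X_left_commute[of "fps_const D"] by simp
    moreover have "sderiv.lax (sconst amat) (psi_smat \<kappa>) * fps_const D =
        fps_const (sconst amat * D) + fps_X * fps_const (psi_smat \<kappa> * D)"
      unfolding sderiv.lax_def distrib_right mult.assoc by simp
    moreover have "sderiv.DD (fps_const D) = fps_const (sderiv D)"
      by (rule fps_ext) simp
    ultimately show "fps_X * sderiv.DD (fps_const D) =
      fps_const D * sderiv.lax (sconst amat) (psi_smat k) - sderiv.lax (sconst amat) (psi_smat \<kappa>) * fps_const D"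
      by (simp add: D' Da right_diff_distrib[symmetric] flip: fps_const_sub)
  qed
  note eq = arg_cong[OF this, of "\<lambda>f. fn (fps_nth f (2 * i)) x"]
  have "fn (fps_nth q (2 * i)) x = skew_block (wc i k x) 0"
    "fn (fps_nth p (2 * i)) x = skew_block (wc i \<kappa> x) 0"
    using Qc_odd[OF k, of i x] Qc_odd[OF \<kappa>, of i x]
    by (simp_all add: fn_Q_fps[OF k q] fn_Q_fps[OF \<kappa> p])
  then show ?thesis using eq by (simp add: D skew_block_0 block_mult block_eq_iff)
qed

section \<open>The frame at \<open>\<lambda> = -is\<close>\<close>

lemma ivec_arith: "ivec p v + ivec q w = ivec (p + q) (v + w)" "r *\<^sub>R ivec p v = ivec (r * p) (r *\<^sub>R v)"
  "- ivec p v = ivec (- p) (- v)"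
  by (simp_all add: ivec_def vec_option_eq_iff complex_eq_iff)

lemma ivec_eq_iff: "ivec p v = ivec q w \<longleftrightarrow> p = q \<and> v = w"
  by (auto simp: ivec_def vec_option_eq_iff vec_eq_iff)

text \<open>Odd matrices produce a factor -i and even ones none. At \<open>\<lambda> = -is\<close>
  the odd coefficients come with odd powers of \<open>\<lambda>\<close>, so every term keeps the
  shape \<open>ivec\<close>.\<close>

lemma cmat_mult_ivec:
  "cmat (skew_block w 0) *v ivec p v = (- \<i>) *s ivec (w \<bullet> v) (p *\<^sub>R w)"
  "cmat (block 0 0 0 K) *v ivec p v = ivec 0 (K *v v)"
  by (simp_all add: vec_option_eq_iff cmat_def ivec_def skew_block_def matrix_vector_mult_def
      sum_UNIV_option inner_vec_def sum_distrib_left sum_negf algebra_simps)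

lemma mat_mult_vec: "(mat z ** A) *v v = z *s (A *v v :: 'a::comm_semiring_1 ^ 'n)"
  by (simp add: matrix_vector_mul_assoc[symmetric])
    (simp add: matrix_vector_mult_def mat_def vec_eq_iff if_distrib if_distribR sum.delta cong: if_cong)

text \<open>Raising \<open>i\<close> by one multiplies the polynomial by
  \<open>\<mu>^2 = -s^2\<close> and adds one odd and one even term. Modulo \<open>ivec 1 c\<close>
  this is the recursion for the differences of the two series; the multiple \<open>\<alpha>\<close>
  disappears once the vector is normalised by its first entry.\<close>

lemma frame_matrix_mult_ivec:
  fixes k k' :: "real \<Rightarrow> real ^ 'm::finite"
  assumes k: "smooth k" and k': "smooth k'" and norm: "norm c = 1" and s: "s \<noteq> 0"
    and rel: "\<And>i. wc (Suc i) k x - wc (Suc i) k' x =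
      s\<^sup>2 *\<^sub>R (wc i k x + refl_mat c *v wc i k' x) - (2 * s) *\<^sub>R (Kc i k x *v c)"
  defines "\<mu> \<equiv> - \<i> * of_real s"
  shows "\<exists>\<alpha>. (mat (\<mu> ^ (2 * i + 1)) ** cmat amat +
      (\<Sum>l=0..2*i. mat (\<mu> ^ (2 * i - l)) ** cmat (Qc (int l) k x))) *v ivec 1 c =
    ivec \<alpha> (\<alpha> *\<^sub>R c - (1 / (2 * s)) *\<^sub>R (wc (Suc i) k x - wc (Suc i) k' x))"
proof -
  define V where "V i = (\<mu> ^ (2 * i + 1)) *s (cmat amat *v ivec 1 c) +
      (\<Sum>l=0..2*i. (\<mu> ^ (2 * i - l)) *s (cmat (Qc (int l) k x) *v ivec 1 c))" for i
  define \<delta> where "\<delta> i = (1 / (2 * s)) *\<^sub>R (wc i k x - wc i k' x)" for i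
  have \<mu>\<i>: "\<mu> * (- \<i>) = of_real (- s)" by (simp add: \<mu>_def complex_eq_iff)
  have \<mu>2: "\<mu> * \<mu> = of_real (- s\<^sup>2)" by (simp add: \<mu>_def power2_eq_square complex_eq_iff)
  have smult: "of_real r *s v = r *\<^sub>R v" for r and v :: "complex ^ 'm option option"
    by (simp add: vec_eq_iff complex_eq_iff)
  have odd: "\<mu> *s (cmat (Qc (2 * int i - 1) k x) *v ivec 1 c) = ivec (- s * (c \<bullet> wc i k x)) (- s *\<^sub>R wc i k x)" for i
    unfolding Qc_odd[OF k] cmat_mult_ivec vector_smult_assoc \<mu>\<i> smult ivec_arith by (simp add: inner_commute)
  have even: "cmat (Qc (2 * int i) k x) *v ivec 1 c = ivec 0 (Kc i k x *v c)" for i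
    unfolding Qc_even(1)[OF k] cmat_mult_ivec ..
  \<comment> \<open>The reflected term is eliminated using that both series have the same component
    along \<open>c\<close>.\<close>
  have \<delta>_rec: "\<delta> (Suc i) = s *\<^sub>R wc i k x - s\<^sup>2 *\<^sub>R \<delta> i - (s * (c \<bullet> wc i k x)) *\<^sub>R c - Kc i k x *v c" for i
  proof -
    have r: "refl_mat c *v wc i k' x = wc i k x - (2 * s) *\<^sub>R \<delta> i - (2 * (c \<bullet> wc i k x)) *\<^sub>R c"
      using s wc_dressing_inner[OF k k' norm rel, of i] by (simp add: refl_mat_mult_vec \<delta>_def)
    have "(2 * s) *\<^sub>R \<delta> (Suc i) = s\<^sup>2 *\<^sub>R (wc i k x + refl_mat c *v wc i k' x) - (2 * s) *\<^sub>R (Kc i k x *v c)"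
      using s by (simp add: \<delta>_def rel)
    also have "\<dots> = (2 * s) *\<^sub>R (s *\<^sub>R wc i k x - s\<^sup>2 *\<^sub>R \<delta> i - (s * (c \<bullet> wc i k x)) *\<^sub>R c - Kc i k x *v c)"
      unfolding r by (simp add: vec_eq_iff algebra_simps power2_eq_square)
    finally have "(2 * s) *\<^sub>R \<delta> (Suc i) =
      (2 * s) *\<^sub>R (s *\<^sub>R wc i k x - s\<^sup>2 *\<^sub>R \<delta> i - (s * (c \<bullet> wc i k x)) *\<^sub>R c - Kc i k x *v c)" .
    then show ?thesis using s by simp
  qed
  have "\<exists>\<alpha>. V i = ivec \<alpha> (\<alpha> *\<^sub>R c - \<delta> (Suc i))"
  proof (induction i)
    case 0
    \<comment> \<open>The leading term with \<open>a\<close> counts as \<open>Q_(-1)\<close>, and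
      \<open>\<delta> 0 = 0\<close> since both series start with the same vector.\<close>
    have "V 0 = \<mu> *s (cmat (Qc (2 * int 0 - 1) k x) *v ivec 1 c) + cmat (Qc (2 * int 0) k x) *v ivec 1 c"
      by (simp add: V_def Qc_minus_1[OF k])
    also have "\<dots> = ivec (- s * (c \<bullet> wc 0 k x)) ((- s * (c \<bullet> wc 0 k x)) *\<^sub>R c - \<delta> (Suc 0))"
      unfolding odd even ivec_arith by (simp add: ivec_eq_iff \<delta>_rec) (simp add: \<delta>_def wc_0 k k')
    finally show ?case by blast
  next
    case (Suc i)
    then obtain \<alpha> where \<alpha>: "V i = ivec \<alpha> (\<alpha> *\<^sub>R c - \<delta> (Suc i))" by blast
    have "(\<Sum>l=0..2 * Suc i. (\<mu> ^ (2 * Suc i - l)) *s (cmat (Qc (int l) k x) *v ivec 1 c)) =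
       (\<Sum>l=0..2 * i. (\<mu> ^ (2 * Suc i - l)) *s (cmat (Qc (int l) k x) *v ivec 1 c)) +
       \<mu> *s (cmat (Qc (int (2 * i + 1)) k x) *v ivec 1 c) + cmat (Qc (int (2 * i + 2)) k x) *v ivec 1 c"
      by simp
    also have "(\<Sum>l=0..2 * i. (\<mu> ^ (2 * Suc i - l)) *s (cmat (Qc (int l) k x) *v ivec 1 c)) =
      (\<mu> * \<mu>) *s (\<Sum>l=0..2 * i. (\<mu> ^ (2 * i - l)) *s (cmat (Qc (int l) k x) *v ivec 1 c))"
      unfolding vec.scale_sum_right vector_smult_assoc
      by (intro sum.cong refl arg_cong2[where f="(*s)"]) (simp add: Suc_diff_le)
    finally have "V (Suc i) = (\<mu> * \<mu>) *s V i + \<mu> *s (cmat (Qc (2 * int (Suc i) - 1) k x) *v ivec 1 c) +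
        cmat (Qc (2 * int (Suc i)) k x) *v ivec 1 c"
      by (simp add: V_def vector_add_ldistrib vector_smult_assoc algebra_simps)
    also have "\<dots> = ivec (- s\<^sup>2 * \<alpha> - s * (c \<bullet> wc (Suc i) k x))
      ((- s\<^sup>2 * \<alpha> - s * (c \<bullet> wc (Suc i) k x)) *\<^sub>R c - \<delta> (Suc (Suc i)))"
      unfolding odd even \<mu>2 smult \<alpha> ivec_arith ivec_eq_iff \<delta>_rec[of "Suc i"] by (simp add: algebra_simps)
    finally show ?case by blast
  qed
  moreover have "(mat (\<mu> ^ (2 * i + 1)) ** cmat amat +
      (\<Sum>l=0..2*i. mat (\<mu> ^ (2 * i - l)) ** cmat (Qc (int l) k x))) *v ivec 1 c = V i"
  proof -
    have sum: "(\<Sum>l\<in>A. M l) *v v = (\<Sum>l\<in>A. M l *v v)" for A :: "nat set" and M and v :: "complex ^ 'm option option"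
      by (induction A rule: infinite_finite_induct) (auto simp: matrix_vector_mult_add_rdistrib)
    show ?thesis by (simp only: matrix_vector_mult_add_rdistrib sum mat_mult_vec V_def)
  qed
  ultimately show ?thesis by (simp add: \<delta>_def)
qed

section \<open>Reflections\<close>

lemma matrix_mult_outer: "A ** outer v w = outer (A *v v) w"
  by (simp add: outer_def matrix_matrix_mult_def matrix_vector_mult_def vec_eq_iff sum_distrib_right mult.assoc)

lemma outer_mult_matrix: "outer v w ** A = outer v (transpose A *v w)"
  by (simp add: outer_def matrix_matrix_mult_def matrix_vector_mult_def transpose_def vec_eq_iff
      sum_distrib_left algebra_simps del: transpose_matrix_vector)

lemma bounded_bilinear_outer: "bounded_bilinear (outer :: real ^ 'n::finite \<Rightarrow> real ^ 'm::finite \<Rightarrow> _)"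
  unfolding bilinear_conv_bounded_bilinear[symmetric] bilinear_def
  by (auto intro!: linearI simp: outer_def vec_eq_iff algebra_simps)

lemmas outer_arith =
  bounded_bilinear.add_left[OF bounded_bilinear_outer] bounded_bilinear.add_right[OF bounded_bilinear_outer]
  bounded_bilinear.diff_left[OF bounded_bilinear_outer] bounded_bilinear.diff_right[OF bounded_bilinear_outer]
  bounded_bilinear.scaleR_left[OF bounded_bilinear_outer] bounded_bilinear.scaleR_right[OF bounded_bilinear_outer]

lemma smooth_refl_mat: "smooth c \<Longrightarrow> smooth (\<lambda>x. refl_mat (c x))"
  unfolding refl_mat_outer
  by (intro smooth_diff smooth_const smooth_scaleR smooth_bilinear[OF bounded_bilinear_outer])

lemma transpose_refl_mat: "transpose (refl_mat c) = refl_mat c"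
  by (simp add: refl_mat_def transpose_def vec_eq_iff mat_def mult.commute)

lemma orthogonal_refl_mat:
  assumes "norm c = 1"
  shows "orthogonal_matrix (refl_mat c)"
proof -
  have "outer c c ** outer c c = outer c c"
    using assms by (simp add: matrix_mult_outer outer_mult_vec norm_eq_1)
  then have "refl_mat c ** refl_mat c = mat 1"
    by (simp add: refl_mat_outer matrix_distribs) (simp add: vec_eq_iff)
  then show ?thesis by (simp add: orthogonal_matrix transpose_refl_mat)
qed

text \<open>An orthogonal matrix taking a basis vector to \<open>c\<close> reduces this to a
  diagonal determinant.\<close>

lemma det_refl_mat:
  assumes "norm c = 1"
  shows "det (refl_mat c) = -1"
proof -
  fix k :: 'a
  obtain A where A: "orthogonal_matrix A" "A *v axis k 1 = c"
    using orthogonal_matrix_exists_basis[OF assms] by metis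
  have AA: "A ** transpose A = mat 1" using A(1) by (simp add: orthogonal_matrix_def)
  have "A ** outer (axis k 1) (axis k 1) ** transpose A = outer c c"
    by (simp add: matrix_mult_outer outer_mult_matrix A(2) del: transpose_matrix_vector)
  then have "A ** refl_mat (axis k 1) ** transpose A = refl_mat c"
    by (simp add: refl_mat_outer matrix_distribs AA)
  then have "det (refl_mat c) = det (refl_mat (axis k 1 :: real ^ 'a)) * (det A * det (transpose A))"
    by (metis det_mul mult.commute mult.assoc)
  also have "det A * det (transpose A) = 1"
    using AA by (metis det_I det_mul)
  also have "det (refl_mat (axis k 1 :: real ^ 'a)) = (\<Prod>i\<in>UNIV. refl_mat (axis k 1 :: real ^ 'a) $ i $ i)"
    by (rule det_diagonal) (auto simp: refl_mat_def mat_def axis_def)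
  also have "\<dots> = (\<Prod>i\<in>UNIV. if i = k then -1 else 1)"
    by (rule prod.cong) (auto simp: refl_mat_def mat_def axis_def)
  also have "\<dots> = -1" by simp
  finally show ?thesis by simp
qed

lemma orthogonal_matrix_inv: "orthogonal_matrix A \<Longrightarrow> matrix_inv A = transpose A"
  by (simp add: matrix_inv_eqI orthogonal_matrix_def)

section \<open>Parallel frames\<close>

lemma parallel_frameD:
  assumes "parallel_frame \<gamma> g k"
  shows "smooth \<gamma>" "smooth g" "orthogonal_matrix (g x)" "det (g x) = 1"
    "(\<gamma> has_vector_derivative g x *v axis None 1) (at x)"
    "(g has_vector_derivative g x ** skew_block (k x) 0) (at x)"
proof -
  show sm: "smooth \<gamma>" "smooth g" and o: "orthogonal_matrix (g x)" and "det (g x) = 1"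
    using assms by (auto simp: parallel_frame_def rotation_matrix_def)
  show "(\<gamma> has_vector_derivative g x *v axis None 1) (at x)"
    using smooth_has_vector_derivative[OF sm(1), of x] assms by (simp add: parallel_frame_def matrix_vector_mult_basis)
  have "matrix_inv (g x) ** vector_derivative g (at x) = skew_block (k x) 0"
    using assms by (simp add: parallel_frame_def)
  then have "vector_derivative g (at x) = g x ** skew_block (k x) 0"
    using o by (metis matrix_mul_assoc matrix_mul_lid orthogonal_matrix_def orthogonal_matrix_inv)
  then show "(g has_vector_derivative g x ** skew_block (k x) 0) (at x)"
    using smooth_has_vector_derivative[OF sm(2), of x] by simp
qed

lemma orthogonal_matrix_norm: 
  assumes "orthogonal_matrix (A :: real ^ 'n ^ 'n)" shows "norm (A *v v) = norm v"
proof -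
  have "orthogonal_transformation ((*v) A)"
    using assms by (simp add: orthogonal_transformation_matrix)
  then show ?thesis by (simp add: orthogonal_transformation_norm)
qed

lemma parallel_frameI:
  assumes "smooth \<gamma>" "smooth g" "\<And>x. orthogonal_matrix (g x)" "\<And>x. det (g x) = 1"
    and \<gamma>: "\<And>x. (\<gamma> has_vector_derivative g x *v axis None 1) (at x)"
    and g: "\<And>x. (g has_vector_derivative g x ** skew_block (k x) 0) (at x)"
  shows "parallel_frame \<gamma> g k"
proof -
  have "matrix_inv (g x) ** vector_derivative g (at x) = skew_block (k x) 0" for x
    using assms(3)[of x] vector_derivative_at[OF g, of x]
    by (simp add: orthogonal_matrix_inv orthogonal_matrix_def matrix_mul_assoc)
  moreover have "norm (vector_derivative \<gamma> (at x)) = 1" for x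
    unfolding vector_derivative_at[OF \<gamma>] orthogonal_matrix_norm[OF assms(3)] by (simp add: norm_axis_1)
  moreover have "column None (g x) = vector_derivative \<gamma> (at x)" for x
    using vector_derivative_at[OF \<gamma>, of x] by (simp add: matrix_vector_mult_basis)
  ultimately show ?thesis using assms(1-4) by (simp add: parallel_frame_def rotation_matrix_def)
qed

lemma matrix_mult_vcons:
  fixes A :: "real ^ 'm::finite option ^ 'n"
  shows "A *v vcons p w = p *\<^sub>R column None A + (\<Sum>i\<in>UNIV. w $ i *\<^sub>R column (Some i) A)"
  by (simp add: vec_eq_iff matrix_vector_mult_def sum_UNIV_option column_def mult.commute)

text \<open>Both frames begin with the tangent, so \<open>e^t g\<close> fixes the first basis vector
  and \<open>wc_gauge\<close> applies.\<close>

lemma wc_parallel_frame_independent: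
  assumes e: "parallel_frame \<gamma> e \<kappa>" and g: "parallel_frame \<gamma> g k" and k: "smooth k"
  shows "e x *v wc i \<kappa> x = g x *v wc i k x"
proof -
  note eD = parallel_frameD[OF e] and gD = parallel_frameD[OF g]
  define H where "H x = transpose (e x) ** g x" for x
  have oe: "transpose (e x) ** e x = mat 1" "e x ** transpose (e x) = mat 1"
    and og: "transpose (g x) ** g x = mat 1" for x
    using eD(3) gD(3) by (simp_all add: orthogonal_matrix_def)
  have col: "e x *v axis None 1 = g x *v axis None 1" for x
    by (rule vector_derivative_unique_at[OF eD(5) gD(5)])
  have tr: "smooth (\<lambda>x. transpose (e x))"
    by (rule smooth_bounded_linear[OF bounded_linear_transpose eD(2)])
  have sH: "smooth H" unfolding H_def by (rule smooth_matrix_mult[OF tr gD(2)])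
  have He: "H x *v axis None 1 = axis None 1" "transpose (H x) *v axis None 1 = axis None 1" for x
  proof -
    have "H x *v axis None 1 = transpose (e x) *v (e x *v axis None 1)"
      unfolding H_def col by (simp only: matrix_vector_mul_assoc)
    then show "H x *v axis None 1 = axis None 1" by (simp only: matrix_vector_mul_assoc oe matrix_vector_mul_lid)
    have "transpose (H x) *v axis None 1 = transpose (g x) *v (e x *v axis None 1)"
      by (simp only: H_def matrix_transpose_mul transpose_transpose matrix_vector_mul_assoc)
    then show "transpose (H x) *v axis None 1 = axis None 1"
      by (simp only: col matrix_vector_mul_assoc og matrix_vector_mul_lid)
  qed
  have skew: "transpose (skew_block w 0) = - skew_block w 0" for w :: "real ^ 'a"
    by (rule transpose_skew_block) (simp add: transpose_def vec_eq_iff)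
  have H': "(H has_vector_derivative H x ** skew_block (k x) 0 - skew_block (\<kappa> x) 0 ** H x) (at x)" for x
    unfolding H_def
    using has_vector_derivative_matrix_mult[OF bounded_linear.has_vector_derivative[OF bounded_linear_transpose eD(6)] gD(6), of x]
    by (simp add: matrix_transpose_mul skew matrix_minus_left matrix_mul_assoc)
  \<comment> \<open>Smoothness of the curvatures has to be recovered from the frame, as entries of
    \<open>e^t e_x\<close>.\<close>
  have \<kappa>: "smooth \<kappa>"
  proof -
    have "\<kappa> = (\<lambda>x. \<chi> i. (transpose (e x) ** vector_derivative e (at x)) $ Some i $ None)"
    proof
      fix x
      have "transpose (e x) ** vector_derivative e (at x) = skew_block (\<kappa> x) 0"
        using e orthogonal_matrix_inv[OF eD(3)] by (simp add: parallel_frame_def)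
      then show "\<kappa> x = (\<chi> i. (transpose (e x) ** vector_derivative e (at x)) $ Some i $ None)"
        by (simp add: skew_block_def vec_eq_iff)
    qed
    moreover have "bounded_linear (\<lambda>A :: real ^ 'a option ^ 'a option. \<chi> i. A $ Some i $ None)"
      unfolding linear_conv_bounded_linear[symmetric] by (rule linearI) (simp_all add: vec_eq_iff)
    then have "smooth (\<lambda>x. \<chi> i. (transpose (e x) ** vector_derivative e (at x)) $ Some i $ None)"
      by (rule smooth_bounded_linear) (intro smooth_matrix_mult tr smooth_vector_derivative eD(2))
    ultimately show ?thesis by simp
  qed
  have "wc i \<kappa> x = H x *v wc i k x"
    by (rule wc_gauge[OF k \<kappa> sH He H'])
  then show ?thesis by (simp add: H_def matrix_vector_mul_assoc matrix_mul_assoc oe)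
qed

lemma airy_flow_eq:
  "airy_flow (Suc N) \<gamma> \<longleftrightarrow> smooth2 \<gamma> \<and>
     (\<forall>t. \<exists>e \<kappa>. parallel_frame (\<lambda>x. \<gamma> x t) e \<kappa> \<and> (\<forall>x. dt \<gamma> x t = e x *v wc N \<kappa> x))"
proof -
  have "2 * int (Suc N) - 3 = 2 * int N - 1" by simp
  then show ?thesis unfolding airy_flow_def wc_def matrix_mult_vcons by (simp only: refl)
qed

section \<open>Frames of solutions\<close>

lemma bounded_linear_cmat: "bounded_linear (cmat :: real ^ 'n::finite ^ 'm::finite \<Rightarrow> _)"
  unfolding linear_conv_bounded_linear[symmetric]
  by (rule linearI) (simp_all add: cmat_def vec_eq_iff complex_eq_iff)

lemma cmat_mult: "cmat (A ** B) = cmat A ** cmat B"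
  by (simp add: cmat_def matrix_matrix_mult_def vec_eq_iff)

lemma cmat_transpose: "cmat (transpose A) = transpose (cmat A)"
  by (simp add: cmat_def transpose_def vec_eq_iff)

lemma cmat_mat1: "cmat (mat 1) = mat 1"
  by (simp add: cmat_def mat_def vec_eq_iff)

lemma cmat_minus: "cmat (- A) = - cmat A"
  by (simp add: cmat_def vec_eq_iff)

lemma bounded_linear_transpose_complex: "bounded_linear (transpose :: complex ^ 'n ^ 'n \<Rightarrow> _)"
  unfolding linear_conv_bounded_linear[symmetric]
  by (rule linearI) (simp_all add: transpose_def vec_eq_iff)

text \<open>Uniqueness for the linear equation: skewness of \<open>U\<close> makes
  \<open>A B^t\<close> constant.\<close>

lemma frames_eq:
  fixes A B :: "real \<Rightarrow> complex ^ 'n ^ 'n"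
  assumes A: "\<And>x. (A has_vector_derivative A x ** U x) (at x)"
    and B: "\<And>x. (B has_vector_derivative B x ** U x) (at x)"
    and U: "\<And>x. transpose (U x) = - U x"
    and oB: "\<And>x. orthogonal_matrix (B x)" and 0: "A 0 = B 0"
  shows "A x = B x"
proof -
  have "((\<lambda>x. A x ** transpose (B x)) has_vector_derivative 0) (at x within UNIV)" for x
    using has_vector_derivative_matrix_mult[OF A bounded_linear.has_vector_derivative[OF bounded_linear_transpose_complex B], of x]
    by (simp add: matrix_transpose_mul U matrix_minus_left matrix_minus_right matrix_mul_assoc)
  then obtain C where C: "A x ** transpose (B x) = C" for x
    using has_vector_derivative_zero_constant[of UNIV "\<lambda>x. A x ** transpose (B x)"] by auto
  then have "A x ** transpose (B x) = mat 1" for x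
    using 0 oB[of 0] C[of 0] C[of x] by (simp add: orthogonal_matrix_def)
  moreover have "transpose (B x) ** B x = mat 1" for x using oB[of x] by (simp add: orthogonal_matrix_def)
  ultimately show ?thesis by (metis matrix_mul_assoc matrix_mul_lid matrix_mul_rid)
qed

text \<open>Comes from differentiating \<open>A (A^t v) = v\<close>.\<close>

lemma inverse_frame_derivative:
  fixes A :: "real \<Rightarrow> complex ^ 'n ^ 'n"
  assumes A: "(A has_vector_derivative A') (at x)" and o: "\<And>x. orthogonal_matrix (A x)"
  shows "((\<lambda>x. matrix_inv (A x) *v v) has_vector_derivative - (matrix_inv (A x) ** A') *v (matrix_inv (A x) *v v)) (at x)"
proof -
  let ?w = "\<lambda>x. transpose (A x) *v v"
  have AA: "A x ** transpose (A x) = mat 1" "transpose (A x) ** A x = mat 1" for x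
    using o by (simp_all add: orthogonal_matrix_def)
  have w: "(?w has_vector_derivative transpose A' *v v) (at x)"
    using has_vector_derivative_matrix_vector_mult[OF bounded_linear.has_vector_derivative[OF bounded_linear_transpose_complex A]
        has_vector_derivative_const[of v]] by (simp del: transpose_matrix_vector)
  have "(\<lambda>x. A x *v ?w x) = (\<lambda>_. v)"
    by (simp only: matrix_vector_mul_assoc AA matrix_vector_mul_lid)
  then have "((\<lambda>_. v) has_vector_derivative A x *v (transpose A' *v v) + A' *v ?w x) (at x)"
    using has_vector_derivative_matrix_vector_mult[OF A w] by (simp only:)
  then have "A x *v (transpose A' *v v) + A' *v ?w x = 0"
    by (rule vector_derivative_unique_at) (rule has_vector_derivative_const)
  then have "transpose (A x) *v (A x *v (transpose A' *v v)) = transpose (A x) *v (- (A' *v ?w x))"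
    by (metis add_eq_0_iff add.commute)
  then have "transpose A' *v v = - (transpose (A x) ** A') *v ?w x"
    by (simp only: matrix_vector_mul_assoc AA matrix_vector_mul_lid matrix_vec_minus matrix_minus_vec matrix_minus_left
        matrix_mul_assoc matrix_mul_lid)
  then show ?thesis using w by (simp only: orthogonal_matrix_inv[OF o])
qed

lemma orthogonal_frame_derivative:
  fixes A :: "real \<Rightarrow> 'a::{euclidean_space,real_algebra_1} ^ 'n ^ 'n"
  assumes "(A has_vector_derivative A') (at x)" "orthogonal_matrix (A x)" "matrix_inv (A x) ** A' = U"
  shows "(A has_vector_derivative A x ** U) (at x)"
proof -
  have "A x ** U = A'"
    using assms(2) unfolding assms(3)[symmetric] orthogonal_matrix_inv[OF assms(2)]
    by (simp add: matrix_mul_assoc orthogonal_matrix_def)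
  then show ?thesis using assms(1) by simp
qed

lemma cmat_diag1_frame:
  fixes g :: "real \<Rightarrow> real ^ 'm::finite ^ 'm"
  assumes g: "(g has_vector_derivative g x ** K) (at x)"
  shows "((\<lambda>x. cmat (diag1 (g x))) has_vector_derivative cmat (diag1 (g x)) ** cmat (block 0 0 0 K)) (at x)"
proof -
  have lin: "bounded_linear (\<lambda>A :: real ^ 'm ^ 'm. cmat (block 0 0 0 A))"
  proof (rule bounded_linear_compose[OF bounded_linear_cmat])
    show "bounded_linear (\<lambda>A :: real ^ 'm ^ 'm. block 0 0 0 A)"
      unfolding linear_conv_bounded_linear[symmetric]
      by (rule linearI) (simp_all add: block_arith)
  qed
  have "cmat (diag1 (g x)) ** cmat (block 0 0 0 K) = 0 + cmat (block 0 0 0 (g x ** K))"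
    by (simp add: diag1_def block_diag_mult flip: cmat_mult)
  moreover have "(\<lambda>x. cmat (diag1 (g x))) = (\<lambda>x. cmat (block 1 0 0 0) + cmat (block 0 0 0 (g x)))"
    by (simp add: diag1_def cmat_def fun_eq_iff vec_option_eq_iff)
  ultimately show ?thesis
    by (simp only:) (intro has_vector_derivative_add has_vector_derivative_const
        bounded_linear.has_vector_derivative[OF lin g])
qed

lemma orthogonal_cmat_diag1:
  assumes "orthogonal_matrix (A :: real ^ 'm::finite ^ 'm)"
  shows "orthogonal_matrix (cmat (diag1 A))"
  using assms
  by (simp add: orthogonal_matrix_def diag1_def transpose_block block_diag_mult block_1 cmat_mat1
      flip: cmat_transpose cmat_mult)

lemma transpose_cmat_even:
  assumes "transpose K = - (K :: real ^ 'm::finite ^ 'm)"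
  shows "transpose (cmat (block 0 0 0 K)) = - cmat (block 0 0 0 K)"
  using assms by (simp add: transpose_block block_arith flip: cmat_transpose cmat_minus)

lemma transpose_skew_block_0: "transpose (skew_block w 0) = - skew_block w 0"
  by (rule transpose_skew_block) (simp add: transpose_def vec_eq_iff)

section \<open>Reality conditions and isotropic vectors\<close>

lemma I1n_nth: "I1n $ i $ j = (if i = j then if i = None then 1 else -1 else 0)"
  by (cases i; cases j) (simp_all add: I1n_def diag1_def mat_def)

lemma I1n_mult:
  fixes A :: "complex ^ 'm::finite option ^ 'm option"
  shows "(I1n ** A) $ r $ s = (if r = None then A $ r $ s else - A $ r $ s)"
    and "(A ** I1n) $ r $ s = (if s = None then A $ r $ s else - A $ r $ s)"
proof -
  have "(I1n ** A) $ r $ s = (\<Sum>k\<in>{r}. I1n $ r $ k * A $ k $ s)"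
    unfolding matrix_matrix_mult_def vec_lambda_beta by (rule sum.mono_neutral_right) (auto simp: I1n_nth)
  then show "(I1n ** A) $ r $ s = (if r = None then A $ r $ s else - A $ r $ s)" by (simp add: I1n_nth)
  have "(A ** I1n) $ r $ s = (\<Sum>k\<in>{s}. A $ r $ k * I1n $ k $ s)"
    unfolding matrix_matrix_mult_def vec_lambda_beta by (rule sum.mono_neutral_right) (auto simp: I1n_nth)
  then show "(A ** I1n) $ r $ s = (if s = None then A $ r $ s else - A $ r $ s)" by (simp add: I1n_nth)
qed

lemma matrix_inv_I1n: "matrix_inv I1n = (I1n :: complex ^ 'm::finite option ^ 'm option)"
proof -
  have "I1n ** I1n = (mat 1 :: complex ^ 'm option ^ 'm option)"
    unfolding vec_eq_iff I1n_mult by (auto simp: I1n_nth mat_def)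
  then show ?thesis by (rule matrix_inv_eqI) fact
qed

text \<open>Over the complex numbers the invariant is this bilinear form, not the Hermitian norm;
  \<open>(1, i c)\<close> is isotropic for it and so is its image.\<close>

lemma orthogonal_sum_square:
  fixes A :: "'a::comm_ring_1 ^ 'n ^ 'n"
  assumes "orthogonal_matrix A"
  shows "(\<Sum>r\<in>UNIV. ((A *v v) $ r)\<^sup>2) = (\<Sum>r\<in>UNIV. (v $ r)\<^sup>2)"
proof -
  have A: "(\<Sum>r\<in>UNIV. A $ r $ p * A $ r $ q) = (if p = q then 1 else 0)" for p q
    using assms by (simp add: orthogonal_matrix_def matrix_matrix_mult_def transpose_def mat_def vec_eq_iff)
  have "(\<Sum>r\<in>UNIV. ((A *v v) $ r)\<^sup>2) =
      (\<Sum>r\<in>UNIV. \<Sum>p\<in>UNIV. \<Sum>q\<in>UNIV. (A $ r $ p * v $ p) * (A $ r $ q * v $ q))"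
    by (simp add: matrix_vector_mult_def power2_eq_square sum_product)
  also have "\<dots> = (\<Sum>p\<in>UNIV. \<Sum>q\<in>UNIV. (v $ p * v $ q) * (\<Sum>r\<in>UNIV. A $ r $ p * A $ r $ q))"
    by (subst sum.swap, rule sum.cong[OF refl], subst sum.swap) (simp add: sum_distrib_left algebra_simps)
  also have "\<dots> = (\<Sum>p\<in>UNIV. (v $ p)\<^sup>2)"
    by (simp add: A if_distrib sum.delta power2_eq_square cong: if_cong)
  finally show ?thesis .
qed

definition ivec_re :: "complex ^ 'n::finite option \<Rightarrow> real" where
  "ivec_re v = Re (v $ None)"

definition ivec_im :: "complex ^ 'n::finite option \<Rightarrow> real ^ 'n" where
  "ivec_im v = (\<chi> i. Im (v $ Some i))"

lemma bounded_linear_ivec_re: "bounded_linear ivec_re"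
  and bounded_linear_ivec_im: "bounded_linear ivec_im"
  unfolding linear_conv_bounded_linear[symmetric]
  by (rule linearI; simp add: ivec_re_def ivec_im_def vec_eq_iff)+

lemma ivec_re_ivec [simp]: "ivec_re (ivec p w) = p"
  and ivec_im_ivec [simp]: "ivec_im (ivec p w) = w"
  by (simp_all add: ivec_re_def ivec_im_def ivec_def vec_eq_iff)

text \<open>The reality assumption makes the diagonal blocks of \<open>A\<close> real and the
  off-diagonal ones imaginary. Isotropy gives the sum of squares, and a vanishing first entry would
  then force the whole vector, hence also \<open>ivec 1 c\<close>, to be zero.\<close>

lemma matrix_inv_mult_ivec:
  fixes A :: "complex ^ 'n::finite option ^ 'n option"
  assumes o: "orthogonal_matrix A"
    and real: "\<And>r s. A $ r $ s = cnj ((I1n ** A ** I1n) $ r $ s)"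
    and c: "norm c = 1"
  defines "w \<equiv> matrix_inv A *v ivec 1 c"
  shows "w = ivec (ivec_re w) (ivec_im w)" and "ivec_re w \<noteq> 0"
    and "(\<Sum>i\<in>UNIV. (ivec_im w $ i)\<^sup>2) = (ivec_re w)\<^sup>2"
proof -
  have w: "w $ r = A $ None $ r + (\<Sum>i\<in>UNIV. A $ Some i $ r * (\<i> * of_real (c $ i)))" for r
    unfolding w_def orthogonal_matrix_inv[OF o]
    by (simp add: matrix_vector_mult_def transpose_def ivec_def sum_UNIV_option del: transpose_matrix_vector)
  have "Im (A $ None $ None) = 0" "Re (A $ Some i $ None) = 0" "Re (A $ None $ Some i) = 0" 
    "Im (A $ Some i $ Some l) = 0" for i l
    using real[of None None] real[of "Some i" None] real[of None "Some i"] real[of "Some i" "Some l"]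
    by (simp_all add: I1n_mult complex_eq_iff)
  then have "Im (w $ None) = 0" "Re (w $ Some i) = 0" for i
    by (simp_all add: w Re_sum Im_sum)
  then show e: "w = ivec (ivec_re w) (ivec_im w)"
    by (simp add: ivec_def ivec_re_def ivec_im_def vec_option_eq_iff complex_eq_iff)
  have oi: "orthogonal_matrix (matrix_inv A)"
    using o by (simp add: orthogonal_matrix_inv orthogonal_matrix_def)
  have sq: "(\<Sum>r\<in>UNIV. (ivec p v $ r)\<^sup>2) = of_real (p\<^sup>2 - (\<Sum>i\<in>UNIV. (v $ i)\<^sup>2))" for p and v :: "real ^ 'n"
    by (simp add: sum_UNIV_option ivec_def power_mult_distrib sum_negf)
  have c1: "(\<Sum>i\<in>UNIV. (c $ i)\<^sup>2) = 1"
    using c by (simp add: norm_eq_1 inner_vec_def power2_eq_square)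
  have "(\<Sum>r\<in>UNIV. (w $ r)\<^sup>2) = (\<Sum>r\<in>UNIV. (ivec 1 c $ r)\<^sup>2)"
    unfolding w_def by (rule orthogonal_sum_square[OF oi])
  then have "complex_of_real ((ivec_re w)\<^sup>2 - (\<Sum>i\<in>UNIV. (ivec_im w $ i)\<^sup>2)) = of_real 0"
    by (subst (asm) e) (simp only: sq c1, simp)
  then show sum: "(\<Sum>i\<in>UNIV. (ivec_im w $ i)\<^sup>2) = (ivec_re w)\<^sup>2"
    unfolding of_real_eq_iff by simp
  show "ivec_re w \<noteq> 0"
  proof
    assume z: "ivec_re w = 0"
    then have "ivec_im w = 0" using sum by (simp add: sum_nonneg_eq_0_iff vec_eq_iff)
    then have "w = 0" using e z by (simp add: ivec_def vec_option_eq_iff)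
    then have "A *v w = 0" by simp
    then have "ivec 1 c = (0 :: complex ^ 'n option)"
      using o unfolding w_def orthogonal_matrix_inv[OF o]
      by (simp only: matrix_vector_mul_assoc orthogonal_matrix_def matrix_vector_mul_lid)
    then show False by (simp add: ivec_def vec_option_eq_iff)
  qed
qed

text \<open>In the affine coordinate on lines the linear equation for \<open>w\<close> becomes a
  Riccati equation, since \<open>\<alpha>\<close> and \<open>\<beta>\<close> may depend on the
  quotient.\<close>

lemma ivec_quotient_derivative:
  fixes w :: "real \<Rightarrow> complex ^ 'n::finite option"
  assumes w: "(w has_vector_derivative - (ivec_re (w x) *\<^sub>R ivec \<alpha> \<beta>)) (at x)"
    and nz: "\<And>x. ivec_re (w x) \<noteq> 0"
  shows "((\<lambda>x. (1 / ivec_re (w x)) *\<^sub>R ivec_im (w x)) has_vector_derivative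
     \<alpha> *\<^sub>R ((1 / ivec_re (w x)) *\<^sub>R ivec_im (w x)) - \<beta>) (at x)"
proof -
  let ?r = "ivec_re (w x)"
  have r: "((\<lambda>x. ivec_re (w x)) has_real_derivative - (?r * \<alpha>)) (at x)"
    using bounded_linear.has_vector_derivative[OF bounded_linear_ivec_re w]
    by (simp add: ivec_arith has_real_derivative_iff_has_vector_derivative)
  have i: "((\<lambda>x. ivec_im (w x)) has_vector_derivative - (?r *\<^sub>R \<beta>)) (at x)"
    using bounded_linear.has_vector_derivative[OF bounded_linear_ivec_im w] by (simp add: ivec_arith)
  have "((\<lambda>x. 1 / ivec_re (w x)) has_real_derivative \<alpha> / ?r) (at x)"
    using nz[of x] by (auto intro!: derivative_eq_intros r simp: field_simps)
  from bounded_bilinear.has_vector_derivative[OF bounded_bilinear_scaleR this[unfolded has_real_derivative_iff_has_vector_derivative] i]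
  show ?thesis using nz[of x] by (simp add: algebra_simps)
qed

text \<open>The two reflections give the new frame determinant 1. The factor \<open>2 / s\<close> is
  what turns the term \<open>s (e - (c . e) c)\<close> of the Riccati equation into the reflection
  of \<open>e\<close>.\<close>

lemma parallel_frame_transform:
  fixes c :: "real \<Rightarrow> real ^ 'm::finite option"
  assumes pf: "parallel_frame \<gamma> g k" and c0: "norm c0 = 1" and s: "s \<noteq> 0"
    and c: "smooth c" and norm: "\<And>x. norm (c x) = 1"
    and c': "\<And>x. (c has_vector_derivative
        s *\<^sub>R (axis None 1 - (c x $ None) *\<^sub>R c x) - skew_block (k x) 0 *v c x) (at x)"
  shows "parallel_frame (\<lambda>x. - (refl_mat c0 *v (\<gamma> x - (2 / s) *\<^sub>R (g x *v c x))))
    (\<lambda>x. refl_mat c0 ** g x ** refl_mat (c x)) (\<lambda>x. k x + (2 * s) *\<^sub>R vtail (c x))"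
proof (rule parallel_frameI)
  note D = parallel_frameD[OF pf]
  let ?e = "axis None 1 :: real ^ 'm option"
  show "smooth (\<lambda>x. - (refl_mat c0 *v (\<gamma> x - (2 / s) *\<^sub>R (g x *v c x))))"
    by (intro smooth_minus smooth_matrix_vector_mult smooth_const smooth_diff smooth_scaleR D c)
  show "smooth (\<lambda>x. refl_mat c0 ** g x ** refl_mat (c x))"
    by (intro smooth_matrix_mult smooth_const smooth_refl_mat D c)
  show "orthogonal_matrix (refl_mat c0 ** g x ** refl_mat (c x))" for x
    by (intro orthogonal_matrix_mul orthogonal_refl_mat c0 norm D)
  show "det (refl_mat c0 ** g x ** refl_mat (c x)) = 1" for x
    by (simp add: det_mul det_refl_mat c0 norm D)
  fix x
  let ?K = "skew_block (k x) 0"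
  let ?c' = "s *\<^sub>R (?e - (c x $ None) *\<^sub>R c x) - ?K *v c x"
  have "((\<lambda>x. - (refl_mat c0 *v (\<gamma> x - (2 / s) *\<^sub>R (g x *v c x)))) has_vector_derivative
      - (refl_mat c0 *v (g x *v ?e - (2 / s) *\<^sub>R (g x *v ?c' + (g x ** ?K) *v c x)))) (at x)"
    by (intro has_vector_derivative_minus has_vector_derivative_diff D
        bounded_linear.has_vector_derivative[OF bounded_linear_scaleR_right]
        bounded_linear.has_vector_derivative[OF matrix_vector_mul_bounded_linear]
        has_vector_derivative_matrix_vector_mult c')
  \<comment> \<open>The connection term \<open>K c\<close> from \<open>g_x\<close> cancels the one
    in the derivative of \<open>c\<close>.\<close>
  moreover have "- (g x *v ?e - (2 / s) *\<^sub>R (g x *v ?c' + (g x ** ?K) *v c x)) =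
      g x *v (refl_mat (c x) *v ?e)"
  proof -
    have "refl_mat (c x) *v ?e = - (?e - (2 / s) *\<^sub>R (?c' + ?K *v c x))"
      using s by (simp add: refl_mat_mult_vec inner_axis vec_eq_iff algebra_simps)
    then show ?thesis
      by (simp add: matrix_vec_minus matrix_vector_mult_diff_distrib matrix_vector_right_distrib
          matrix_vector_mult_scaleR flip: matrix_vector_mul_assoc)
  qed
  ultimately show "((\<lambda>x. - (refl_mat c0 *v (\<gamma> x - (2 / s) *\<^sub>R (g x *v c x)))) has_vector_derivative
      (refl_mat c0 ** g x ** refl_mat (c x)) *v ?e) (at x)"
    by (simp only: matrix_vec_minus[symmetric] matrix_vector_mul_assoc[symmetric])
  have "((\<lambda>x. refl_mat (c x)) has_vector_derivative 0 - 2 *\<^sub>R (outer (c x) ?c' + outer ?c' (c x))) (at x)"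
    unfolding refl_mat_outer
    by (intro has_vector_derivative_diff has_vector_derivative_const
        bounded_linear.has_vector_derivative[OF bounded_linear_scaleR_right]
        bounded_bilinear.has_vector_derivative[OF bounded_bilinear_outer] c')
  then have "((\<lambda>x. refl_mat c0 ** g x ** refl_mat (c x)) has_vector_derivative
     refl_mat c0 ** g x ** (0 - 2 *\<^sub>R (outer (c x) ?c' + outer ?c' (c x))) +
     (refl_mat c0 ** (g x ** ?K) + 0 ** g x) ** refl_mat (c x)) (at x)"
    by (intro has_vector_derivative_matrix_mult has_vector_derivative_const D)
  \<comment> \<open>For the reflection \<open>R\<close> this says \<open>R_x = R S - K R\<close>,
    where \<open>S\<close> differs from \<open>K\<close> by a skew matrix of rank at most
    two.\<close>
  moreover have "?K ** refl_mat (c x) - 2 *\<^sub>R (outer (c x) ?c' + outer ?c' (c x)) =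
      refl_mat (c x) ** skew_block (k x + (2 * s) *\<^sub>R vtail (c x)) 0"
  proof -
    define S where "S = skew_block (k x + (2 * s) *\<^sub>R vtail (c x)) 0"
    define w where "w = ?K *v c x"
    have S: "S = ?K + (2 * s) *\<^sub>R (outer (c x) ?e - outer ?e (c x))"
      by (simp add: S_def skew_block_def vec_option_eq_iff outer_def axis_def vtail_def)
    have cc: "c x \<bullet> c x = 1" using norm[of x] by (simp add: norm_eq_1)
    have Sc: "S *v c x = w + (2 * s) *\<^sub>R ((c x $ None) *\<^sub>R c x - ?e)"
      unfolding S w_def
      by (simp add: matrix_vector_mult_add_rdistrib matrix_vector_mult_diff_rdistrib outer_mult_vec cc
          inner_axis inner_commute flip: scaleR_matrix_vector_assoc)
    have "transpose S *v c x = - (S *v c x)"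
      unfolding S_def transpose_skew_block_0 matrix_minus_vec ..
    then have RS: "refl_mat (c x) ** S = S + 2 *\<^sub>R outer (c x) (w + (2 * s) *\<^sub>R ((c x $ None) *\<^sub>R c x - ?e))"
      by (simp only: refl_mat_outer matrix_distribs outer_mult_matrix outer_minus Sc matrix_mul_lid
          scaleR_minus_right diff_minus_eq_add)
    have KR: "?K ** refl_mat (c x) = ?K - 2 *\<^sub>R outer w (c x)"
      by (simp add: refl_mat_outer matrix_distribs matrix_mult_outer w_def)
    show ?thesis
      unfolding S_def[symmetric] RS KR w_def[symmetric]
      unfolding S outer_arith
      by (simp add: vec_eq_iff algebra_simps)
  qed
  then have "refl_mat c0 ** g x ** (?K ** refl_mat (c x) + (0 - 2 *\<^sub>R (outer (c x) ?c' + outer ?c' (c x)))) =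
      refl_mat c0 ** g x ** (refl_mat (c x) ** skew_block (k x + (2 * s) *\<^sub>R vtail (c x)) 0)"
    by simp
  ultimately show "((\<lambda>x. refl_mat c0 ** g x ** refl_mat (c x)) has_vector_derivative
     refl_mat c0 ** g x ** refl_mat (c x) ** skew_block (k x + (2 * s) *\<^sub>R vtail (c x)) 0) (at x)"
    by (simp only: matrix_mul_assoc matrix_add_ldistrib add.commute matrix_zero_left add_0_left add_0_right)
qed

theorem theorem5p3:
  fixes \<gamma> :: "real \<Rightarrow> real \<Rightarrow> real ^ 'm::finite option"
    and g :: "real \<Rightarrow> real \<Rightarrow> real ^ 'm option ^ 'm option"
    and k :: "real \<Rightarrow> real \<Rightarrow> real ^ 'm"
    and E :: "real \<Rightarrow> real \<Rightarrow> complex \<Rightarrow> complex ^ 'm option option ^ 'm option option"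
    and c :: "real ^ 'm option"
    and s :: real and j :: nat
    and v :: "complex ^ 'm option option"
    and v' :: "real \<Rightarrow> real \<Rightarrow> complex ^ 'm option option"
  assumes "j \<ge> 1"
    and "airy_flow j \<gamma>"
    and "parallel_frames \<gamma> g k"
    and "\<And>x t. matrix_inv (g x t) ** dt g x t =
           skew_block (zc (2 * int j - 2) (\<lambda>\<xi>. k \<xi> t) x) (xic (2 * int j - 2) (\<lambda>\<xi>. k \<xi> t) x)"
    and "vmkdv_frame j k E"
    and "\<And>l. E 0 0 l = cmat (diag1 (g 0 0))"
    and "s \<noteq> 0"
    and "norm c = 1"
    and "v = ivec 1 c"
    and "\<And>x t. v' x t = matrix_inv (E x t (- \<i> * of_real s)) *v v"
  shows "(\<forall>x t. E x t 0 = cmat (diag1 (g x t))) \<and>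
    (\<exists>(y\<^sub>0 :: real \<Rightarrow> real \<Rightarrow> real) (y :: real \<Rightarrow> real \<Rightarrow> real ^ 'm option).
       (\<forall>x t. v' x t = ivec (y\<^sub>0 x t) (y x t)) \<and>
       (\<forall>x t. y\<^sub>0 x t \<noteq> 0) \<and>
       (\<forall>x t. (\<Sum>i\<in>UNIV. (y x t $ i)\<^sup>2) = (y\<^sub>0 x t)\<^sup>2) \<and>
       (let c' = (\<lambda>x t. (1 / y\<^sub>0 x t) *\<^sub>R y x t);
            \<gamma>' = (\<lambda>x t. - (refl_mat c *v
                   (\<gamma> x t - (2 / (s * y\<^sub>0 x t)) *\<^sub>R (\<Sum>i\<in>UNIV. y x t $ i *\<^sub>R column i (g x t)))));
            g' = (\<lambda>x t. refl_mat c ** g x t ** refl_mat (c' x t));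
            k' = (\<lambda>x t. k x t + (2 * s / y\<^sub>0 x t) *\<^sub>R vtail (y x t))
        in airy_flow j \<gamma>' \<and> parallel_frames \<gamma>' g' k'))"
proof -
  \<comment> \<open>With \<open>j = N + 1\<close> the coefficients of index \<open>2j-3\<close> and
    \<open>2j-2\<close> are those in \<open>wc N\<close> and \<open>Kc N\<close>.\<close>
  obtain N where j: "j = Suc N" using assms(1) by (cases j) auto
  let ?e = "axis None 1 :: real ^ 'm option"
  let ?k = "\<lambda>t \<xi>. k \<xi> t"
  define \<mu> where "\<mu> = - \<i> * complex_of_real s"
  have jN: "2 * int j - 2 = 2 * int N" "2 * j - 2 = 2 * N" "2 * j - 1 = 2 * N + 1" by (simp_all add: j)
  have k2: "smooth2 k" and Esm: "\<And>l. smooth2 (\<lambda>x t. E x t l)" and Eo: "\<And>x t l. orthogonal_matrix (E x t l)"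
    and Ex: "\<And>x t l. matrix_inv (E x t l) ** dx (\<lambda>x t. E x t l) x t = mat l ** cmat amat + cmat (Psi (k x t))"
    and Et: "\<And>x t l. matrix_inv (E x t l) ** dt (\<lambda>x t. E x t l) x t =
        mat (l ^ (2 * N + 1)) ** cmat amat + (\<Sum>i = 0..2 * N. mat (l ^ (2 * N - i)) ** cmat (Qc (int i) (?k t) x))"
    and Ereal: "\<And>x t l. (\<chi> r s. cnj (E x t (cnj l) $ r $ s)) = E x t l"
    and Epar: "\<And>x t l. I1n ** E x t (- l) ** I1n = E x t l"
    using assms(5) unfolding vmkdv_frame_def vmkdv_flow_def jN matrix_inv_I1n by blast+
  have ks: "smooth (?k t)" for t by (rule smooth2_x[OF k2])
  have g2: "smooth2 g" and pf: "\<And>t. parallel_frame (\<lambda>x. \<gamma> x t) (\<lambda>x. g x t) (?k t)"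
    using assms(3) by (auto simp: parallel_frames_def)
  note D = parallel_frameD[OF pf]
  have gt: "((\<lambda>\<tau>. g x \<tau>) has_vector_derivative g x t ** Kc N (?k t) x) (at t)" for x t
    by (rule orthogonal_frame_derivative[OF smooth2_dt[OF g2] D(3)])
      (simp only: assms(4) jN Kc_def)
  \<comment> \<open>At \<open>\<lambda> = 0\<close> only the last term survives, with
    \<open>0 ^ 0 = 1\<close>.\<close>
  have sum0: "(\<Sum>i = 0..2 * N. mat (0 ^ (2 * N - i)) ** cmat (Qc (int i) (?k t) x)) = cmat (Qc (2 * int N) (?k t) x)" for x t
  proof -
    have "(\<Sum>i = 0..2 * N. mat (0 ^ (2 * N - i)) ** cmat (Qc (int i) (?k t) x)) =
        (\<Sum>i \<in> {2 * N}. mat (0 ^ (2 * N - i)) ** cmat (Qc (int i) (?k t) x))"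
      by (rule sum.mono_neutral_right) (auto simp: mat_0 power_0_left split: if_splits)
    then show ?thesis by simp
  qed
  \<comment> \<open>Uniqueness of frames is applied along \<open>x = 0\<close> in \<open>t\<close>,
    and then in \<open>x\<close> for each fixed \<open>t\<close>.\<close>
  have E0: "E x t 0 = cmat (diag1 (g x t))" for x t
  proof -
    have t: "E 0 t 0 = cmat (diag1 (g 0 t))" for t
    proof (rule frames_eq[where A="\<lambda>t. E 0 t 0" and B="\<lambda>t. cmat (diag1 (g 0 t))" and x=t
          and U="\<lambda>t. cmat (block 0 0 0 (Kc N (?k t) 0))"])
      show "((\<lambda>t. E 0 t 0) has_vector_derivative E 0 t 0 ** cmat (block 0 0 0 (Kc N (?k t) 0))) (at t)" for t
      proof (rule orthogonal_frame_derivative[OF smooth2_dt[OF Esm] Eo])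
        show "matrix_inv (E 0 t 0) ** dt (\<lambda>x t. E x t 0) 0 t = cmat (block 0 0 0 (Kc N (?k t) 0))"
          unfolding Et sum0 Qc_even(1)[OF ks] by (simp add: mat_0)
      qed
    qed (use assms(6) in \<open>auto intro!: cmat_diag1_frame gt transpose_cmat_even Qc_even ks orthogonal_cmat_diag1 D\<close>)
    show ?thesis
    proof (rule frames_eq[where A="\<lambda>x. E x t 0" and B="\<lambda>x. cmat (diag1 (g x t))" and x=x
          and U="\<lambda>x. cmat (block 0 0 0 (skew_block (k x t) 0))"])
      show "((\<lambda>x. E x t 0) has_vector_derivative E x t 0 ** cmat (block 0 0 0 (skew_block (k x t) 0))) (at x)" for x
      proof (rule orthogonal_frame_derivative[OF smooth2_dx[OF Esm] Eo])
        show "matrix_inv (E x t 0) ** dx (\<lambda>x t. E x t 0) x t = cmat (block 0 0 0 (skew_block (k x t) 0))"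
          unfolding Ex by (simp add: mat_0 Psi_def even_mat_def)
      qed
    qed (use t in \<open>auto intro!: cmat_diag1_frame transpose_cmat_even transpose_skew_block_0 orthogonal_cmat_diag1 D\<close>)
  qed
  have v': "v' x t = matrix_inv (E x t \<mu>) *v ivec 1 c" for x t
    by (simp only: assms(9,10) \<mu>_def)
  define y0 where "y0 x t = ivec_re (v' x t)" for x t
  define y where "y x t = ivec_im (v' x t)" for x t
  \<comment> \<open>Conjugation sends \<open>\<mu> = -is\<close> to \<open>-\<mu>\<close>, so the
    two symmetries of \<open>E\<close> combine into a condition at the single point
    \<open>\<mu>\<close>.\<close>
  have Eentry: "E x t \<mu> $ p $ q = cnj ((I1n ** E x t \<mu> ** I1n) $ p $ q)" for x t p q
  proof -
    have "cnj \<mu> = - \<mu>" by (simp add: \<mu>_def)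
    then have "E x t \<mu> = (\<chi> p q. cnj ((I1n ** E x t \<mu> ** I1n) $ p $ q))"
      using Ereal[of x t \<mu>] Epar[of x t "- \<mu>"] by simp
    from arg_cong[OF this, of "\<lambda>M. M $ p $ q"] show ?thesis by (simp only: vec_lambda_beta)
  qed
  note yprops = matrix_inv_mult_ivec[OF Eo Eentry assms(8), folded v', folded y0_def y_def]
  define c' where "c' x t = (1 / y0 x t) *\<^sub>R y x t" for x t
  have v'c: "v' x t = y0 x t *\<^sub>R ivec 1 (c' x t)" for x t
    using yprops(1,2)[of x t] by (simp add: c'_def ivec_arith)
  have cnorm: "norm (c' x t) = 1" for x t
  proof -
    have "y x t \<bullet> y x t = (y0 x t)\<^sup>2" using yprops(3)[of x t] by (simp add: inner_vec_def power2_eq_square)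
    then have "c' x t \<bullet> c' x t = 1" using yprops(2)[of x t] by (simp add: c'_def power2_eq_square)
    then show ?thesis by (simp add: norm_eq_1)
  qed
  have v'sm: "smooth (\<lambda>p. v' (fst p) (snd p))"
    unfolding v' orthogonal_matrix_inv[OF Eo]
    by (intro smooth_matrix_vector_mult smooth_const smooth_bounded_linear[OF bounded_linear_transpose_complex]
        Esm[of \<mu>, unfolded smooth2_def])
  have csm2: "smooth (\<lambda>p. c' (fst p) (snd p))"
    unfolding c'_def divide_inverse mult_1 y0_def y_def
    by (intro smooth_scaleR smooth_inverse smooth_bounded_linear[OF bounded_linear_ivec_re]
        smooth_bounded_linear[OF bounded_linear_ivec_im] v'sm yprops(2)[unfolded y0_def])
  have cs: "smooth (\<lambda>x. c' x t)" for t
    by (rule smooth2_x) (simp add: smooth2_def csm2)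
  \<comment> \<open>Stated along a path \<open>(f, h)\<close> so that it serves the
    \<open>x\<close>- and the \<open>t\<close>-direction alike.\<close>
  have cderiv: "((\<lambda>r. c' (f r) (h r)) has_vector_derivative \<alpha> *\<^sub>R c' (f \<tau>) (h \<tau>) - \<beta>) (at \<tau>)"
    if E: "((\<lambda>r. E (f r) (h r) \<mu>) has_vector_derivative E') (at \<tau>)"
      and A: "(matrix_inv (E (f \<tau>) (h \<tau>) \<mu>) ** E') *v ivec 1 (c' (f \<tau>) (h \<tau>)) = ivec \<alpha> \<beta>"
    for f h :: "real \<Rightarrow> real" and \<tau> E' \<alpha> \<beta>
  proof -
    have sc: "M *v (r *\<^sub>R w) = r *\<^sub>R (M *v w)" for M :: "complex ^ 'm option option ^ 'm option option" and r w
      by (rule bounded_bilinear.scaleR_right[OF bounded_bilinear_matrix_vector_mult])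
    have "((\<lambda>r. v' (f r) (h r)) has_vector_derivative - (y0 (f \<tau>) (h \<tau>) *\<^sub>R ivec \<alpha> \<beta>)) (at \<tau>)"
      using inverse_frame_derivative[OF E Eo, of "ivec 1 c"]
      unfolding v'[symmetric] by (simp only: v'c[of "f \<tau>" "h \<tau>"] sc A matrix_minus_vec scaleR_minus_right)
    from ivec_quotient_derivative[OF this[unfolded y0_def] yprops(2)[unfolded y0_def]]
    show ?thesis unfolding c'_def y0_def y_def .
  qed
  have cx: "((\<lambda>x. c' x t) has_vector_derivative
        s *\<^sub>R (?e - (c' x t $ None) *\<^sub>R c' x t) - skew_block (k x t) 0 *v c' x t) (at x)" for x t
  proof -
    have sm: "of_real r *s w = r *\<^sub>R w" for r and w :: "complex ^ 'm option option"
      by (simp add: vec_eq_iff complex_eq_iff)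
    have "\<mu> * - \<i> = complex_of_real (- s)" by (simp add: \<mu>_def complex_eq_iff)
    then have "(mat \<mu> ** cmat amat + cmat (Psi (k x t))) *v ivec 1 (c' x t) =
        ivec (- s * (c' x t $ None)) (skew_block (k x t) 0 *v c' x t - s *\<^sub>R ?e)"
      unfolding matrix_vector_mult_add_rdistrib mat_mult_vec amat_skew Psi_def even_mat_def cmat_mult_ivec
        vector_smult_assoc
      by (simp only: sm ivec_arith) (simp add: inner_axis' ivec_eq_iff)
    then have "((\<lambda>x. c' x t) has_vector_derivative (- s * (c' x t $ None)) *\<^sub>R c' x t -
        (skew_block (k x t) 0 *v c' x t - s *\<^sub>R ?e)) (at x)"
      by (intro cderiv[OF smooth2_dx[OF Esm]]) (simp only: Ex)
    then show ?thesis by (simp add: algebra_simps)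
  qed
  define k' where "k' x t = k x t + (2 * s) *\<^sub>R vtail (c' x t)" for x t
  define \<gamma>' where "\<gamma>' x t = - (refl_mat c *v (\<gamma> x t - (2 / s) *\<^sub>R (g x t *v c' x t)))" for x t
  define g' where "g' x t = refl_mat c ** g x t ** refl_mat (c' x t)" for x t
  have pf': "parallel_frame (\<lambda>x. \<gamma>' x t) (\<lambda>x. g' x t) (\<lambda>x. k' x t)" for t
    unfolding \<gamma>'_def g'_def k'_def
    by (rule parallel_frame_transform[OF pf assms(8,7) cs cnorm cx])
  have k's: "smooth (\<lambda>x. k' x t)" for t
    unfolding k'_def by (rule Qc_dressing(1)[OF ks cs cnorm cx])
  have rel: "wc (Suc i) (?k t) x - wc (Suc i) (\<lambda>\<xi>. k' \<xi> t) x =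
      s\<^sup>2 *\<^sub>R (wc i (?k t) x + refl_mat (c' x t) *v wc i (\<lambda>\<xi>. k' \<xi> t) x) - (2 * s) *\<^sub>R (Kc i (?k t) x *v c' x t)" for i x t
    unfolding k'_def by (rule Qc_dressing(2)[OF ks cs cnorm cx])
  \<comment> \<open>The unknown \<open>\<alpha>\<close> cancels in the quotient, leaving the
    difference of the vectors \<open>wc (Suc N)\<close> divided by \<open>2 s\<close>, which
    \<open>rel\<close> expresses at level \<open>N\<close>.\<close>
  have ct: "((\<lambda>t. c' x t) has_vector_derivative
        (s / 2) *\<^sub>R (wc N (?k t) x + refl_mat (c' x t) *v wc N (\<lambda>\<xi>. k' \<xi> t) x) - Kc N (?k t) x *v c' x t) (at t)" for x t
  proof -
    let ?d = "wc (Suc N) (?k t) x - wc (Suc N) (\<lambda>\<xi>. k' \<xi> t) x"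
    obtain \<alpha> where "(mat (\<mu> ^ (2 * N + 1)) ** cmat amat +
      (\<Sum>l=0..2*N. mat (\<mu> ^ (2 * N - l)) ** cmat (Qc (int l) (?k t) x))) *v ivec 1 (c' x t) =
      ivec \<alpha> (\<alpha> *\<^sub>R c' x t - (1 / (2 * s)) *\<^sub>R ?d)"
      using frame_matrix_mult_ivec[OF ks k's cnorm assms(7) rel] unfolding \<mu>_def by blast
    then have "((\<lambda>t. c' x t) has_vector_derivative
        \<alpha> *\<^sub>R c' x t - (\<alpha> *\<^sub>R c' x t - (1 / (2 * s)) *\<^sub>R ?d)) (at t)"
      by (intro cderiv[OF smooth2_dt[OF Esm]]) (simp only: Et)
    then show ?thesis
      using assms(7) unfolding rel by (simp add: scaleR_diff_right power2_eq_square)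
  qed
  have \<gamma>2: "smooth2 \<gamma>" using assms(2) by (simp add: airy_flow_def)
  \<comment> \<open>The flow provides some parallel frame at each time; its velocity is rewritten in
    the given frame \<open>g\<close>.\<close>
  have \<gamma>t: "((\<lambda>t. \<gamma> x t) has_vector_derivative g x t *v wc N (?k t) x) (at t)" for x t
  proof -
    obtain e \<kappa> where e: "parallel_frame (\<lambda>x. \<gamma> x t) e \<kappa>" "dt \<gamma> x t = e x *v wc N \<kappa> x"
      using assms(2) unfolding j airy_flow_eq by blast
    show ?thesis
      using smooth2_dt[OF \<gamma>2, of x t] wc_parallel_frame_independent[OF e(1) pf ks, of x N] e(2) by simp
  qed
  have \<gamma>'2: "smooth2 \<gamma>'" and g'2: "smooth2 g'"
    unfolding smooth2_def \<gamma>'_def g'_def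
    by (intro smooth_minus smooth_matrix_vector_mult smooth_matrix_mult smooth_const smooth_diff smooth_scaleR
        smooth_refl_mat csm2 \<gamma>2[unfolded smooth2_def] g2[unfolded smooth2_def])+
  have \<gamma>'t: "dt \<gamma>' x t = g' x t *v wc N (\<lambda>\<xi>. k' \<xi> t) x" for x t
  proof -
    let ?w = "wc N (?k t) x" and ?w' = "wc N (\<lambda>\<xi>. k' \<xi> t) x" and ?K = "Kc N (?k t) x"
    let ?c' = "(s / 2) *\<^sub>R (?w + refl_mat (c' x t) *v ?w') - ?K *v c' x t"
    have "((\<lambda>t. \<gamma>' x t) has_vector_derivative
        - (refl_mat c *v (g x t *v ?w - (2 / s) *\<^sub>R (g x t *v ?c' + (g x t ** ?K) *v c' x t)))) (at t)"
      unfolding \<gamma>'_def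
      by (intro has_vector_derivative_minus has_vector_derivative_diff
        bounded_linear.has_vector_derivative[OF bounded_linear_scaleR_right]
        bounded_linear.has_vector_derivative[OF matrix_vector_mul_bounded_linear]
        has_vector_derivative_matrix_vector_mult ct gt \<gamma>t)
    then have "dt \<gamma>' x t = - (refl_mat c *v (g x t *v ?w - (2 / s) *\<^sub>R (g x t *v ?c' + (g x t ** ?K) *v c' x t)))"
      unfolding dt_def by (rule vector_derivative_at)
    \<comment> \<open>\<open>Kc N\<close> cancels between \<open>g_t\<close> and the derivative of
      \<open>c'\<close>, the old velocity \<open>?w\<close> cancels as well, and only the reflected
      new coefficient remains.\<close>
    also have "g x t *v ?w - (2 / s) *\<^sub>R (g x t *v ?c' + (g x t ** ?K) *v c' x t) =
        - (g x t *v (refl_mat (c' x t) *v ?w'))"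
      using assms(7)
      by (simp add: matrix_vector_mult_diff_distrib matrix_vector_right_distrib matrix_vector_mult_scaleR
          scaleR_add_right flip: matrix_vector_mul_assoc)
    finally show ?thesis
      by (simp add: g'_def matrix_vec_minus matrix_vector_mul_assoc matrix_mul_assoc)
  qed
  have airy': "airy_flow j \<gamma>'" unfolding j airy_flow_eq using \<gamma>'2 pf' \<gamma>'t by blast
  have frames': "parallel_frames \<gamma>' g' k'" using g'2 pf' by (simp add: parallel_frames_def)
  have \<gamma>'_eq: "\<gamma>' = (\<lambda>x t. - (refl_mat c *v
       (\<gamma> x t - (2 / (s * y0 x t)) *\<^sub>R (\<Sum>i\<in>UNIV. y x t $ i *\<^sub>R column i (g x t)))))"
  proof -
    have "(\<Sum>i\<in>UNIV. y x t $ i *\<^sub>R column i (g x t)) = g x t *v y x t" for x t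
      by (simp add: vec_eq_iff matrix_vector_mult_def column_def mult.commute)
    then show ?thesis by (simp add: \<gamma>'_def c'_def matrix_vector_mult_scaleR fun_eq_iff)
  qed
  have k'_eq: "k' = (\<lambda>x t. k x t + (2 * s / y0 x t) *\<^sub>R vtail (y x t))"
    by (simp add: k'_def c'_def vtail_def fun_eq_iff vec_eq_iff)
  show ?thesis
  proof (intro conjI allI exI[of _ y0] exI[of _ y])
    show "let c' = (\<lambda>x t. (1 / y0 x t) *\<^sub>R y x t);
            \<gamma>' = (\<lambda>x t. - (refl_mat c *v
                   (\<gamma> x t - (2 / (s * y0 x t)) *\<^sub>R (\<Sum>i\<in>UNIV. y x t $ i *\<^sub>R column i (g x t)))));
            g' = (\<lambda>x t. refl_mat c ** g x t ** refl_mat (c' x t));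
            k' = (\<lambda>x t. k x t + (2 * s / y0 x t) *\<^sub>R vtail (y x t))
        in airy_flow j \<gamma>' \<and> parallel_frames \<gamma>' g' k'"
      unfolding Let_def \<gamma>'_eq[symmetric] k'_eq[symmetric] c'_def[symmetric] g'_def[symmetric]
      using airy' frames' by simp
  qed (rule E0 yprops)+
qed

end
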